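(* Let $G$ be a planar Hamiltonian graph, and let $\mathcal{P}(G)$ be the set of all plane geometric drawings of $G$. Then $\mathcal{P}(G)$ is not geometric-packable unless $G$ is (isomorphic to) one of $C_3$, $C_4$, $\Theta_1$, $\Theta_2$, $\Theta_3$, $\Theta_4$. Further, $\mathcal{P}(G)$ is geometric-packable if $G$ is one of $C_3$, $C_4$, $\Theta_1$.
   Context: Graphs are finite and simple; $v(G)$ and $e(G)$ denote the numbers of vertices and edges of $G$. A graph is Hamiltonian if it contains a Hamiltonian cycle; $C_k$ is the $k$-cycle. A geometric graph is a graph whose vertex set is a finite set of points in general position (no three on a line) in the Euclidean plane and whose edges are closed line segments with endpoints in the vertex set. It is plane if no two of its edges cross. A graph is planar if it has a plane geometric drawing, i.e. is isomorphic to a plane geometric graph. Two geometric graphs are congruent if one can be transformed into the other by a translation and/or a rotation. $\mathcal{P}(G)$ denotes the set of all plane geometric graphs whose underlying abstract graph is isomorphic to $G$. Let $\mathcal{G}$ be a set of geometric graphs all having the same number of edges $e(\mathcal{G})$ (for $\mathcal{G}=\mathcal{P}(G)$ this is $e(G)$), and let $H$ be a geometric graph. A $\mathcal{G}$-packing of $H$ is a collection of pairwise edge-disjoint subgraphs of $H$, each congruent to some member of $\mathcal{G}$; $p(H,\mathcal{G})$ is the maximum size of a $\mathcal{G}$-packing of $H$. A sequence $\{H_n\}_{n\ge 1}$ of geometric graphs with $v(H_n)=n$ can be asymptotically packed by $\mathcal{G}$ if $\lim_{n\to\infty} p(H_n,\mathcal{G})\,e(\mathcal{G})/e(H_n)=1$.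 The set $\mathcal{G}$ is geometric-packable if every sequence $\{D_n\}_{n\ge1}$, where $D_n$ is a geometric drawing of the complete graph $K_n$ (a geometric graph on $n$ points in general position with all $\binom n2$ segments as edges), can be asymptotically packed by $\mathcal{G}$. The graphs $\Theta_i$: - $\Theta_1$: the 4-cycle $1,2,3,4$ plus the chord $\{2,4\}$. - $\Theta_2$: the 5-cycle $1,2,3,4,5$ plus the chords $\{1,3\},\{1,4\}$. - $\Theta_3$: the 6-cycle $1,2,3,4,5,6$ plus the chords $\{2,4\},\{2,5\},\{1,5\}$. - $\Theta_4$: the 6-cycle $1,2,3,4,5,6$ plus the chords $\{2,4\},\{2,5\},\{2,6\}$. *)

theory Defs
  imports "HOL-Analysis.Analysis" "HOL-Library.Ramsey"
begin

section \<open>Finite simple graphs\<close>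

datatype 'a graph = Graph (verts: "'a set") (edges: "'a set set")

definition simple_graph :: "'a graph \<Rightarrow> bool" where
  "simple_graph G \<longleftrightarrow> finite (verts G) \<and> edges G \<subseteq> nsets (verts G) 2"

definition num_verts :: "'a graph \<Rightarrow> nat" where
  "num_verts G = card (verts G)"

definition num_edges :: "'a graph \<Rightarrow> nat" where
  "num_edges G = card (edges G)"

definition subgraph :: "'a graph \<Rightarrow> 'a graph \<Rightarrow> bool" where
  "subgraph F H \<longleftrightarrow> simple_graph F \<and> verts F \<subseteq> verts H \<and> edges F \<subseteq> edges H"

definition graph_image :: "('a \<Rightarrow> 'b) \<Rightarrow> 'a graph \<Rightarrow> 'b graph" where
  "graph_image f G = Graph (f ` verts G) ((`) f ` edges G)"

definition isomorphic :: "'a graph \<Rightarrow> 'b graph \<Rightarrow> bool" where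
  "isomorphic G H \<longleftrightarrow> (\<exists>f. inj_on f (verts G) \<and> H = graph_image f G)"

text \<open>The edges of the closed walk \<open>xs!0, xs!1, \<dots>, xs!(length xs - 1), xs!0\<close>.\<close>

definition cycle_edges :: "'a list \<Rightarrow> 'a set set" where
  "cycle_edges xs = {{xs ! i, xs ! (Suc i mod length xs)} | i. i < length xs}"

definition hamiltonian :: "'a graph \<Rightarrow> bool" where
  "hamiltonian G \<longleftrightarrow>
     (\<exists>xs. distinct xs \<and> length xs \<ge> 3 \<and> set xs = verts G \<and> cycle_edges xs \<subseteq> edges G)"

definition cycle_graph :: "nat \<Rightarrow> nat graph" where
  "cycle_graph k = Graph {1..k} (cycle_edges [1..<Suc k])"

definition Theta1 :: "nat graph" where
  "Theta1 = Graph {1..4} (cycle_edges [1, 2, 3, 4] \<union> {{2, 4}})"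

definition Theta2 :: "nat graph" where
  "Theta2 = Graph {1..5} (cycle_edges [1, 2, 3, 4, 5] \<union> {{1, 3}, {1, 4}})"

definition Theta3 :: "nat graph" where
  "Theta3 = Graph {1..6} (cycle_edges [1, 2, 3, 4, 5, 6] \<union> {{2, 4}, {2, 5}, {1, 5}})"

definition Theta4 :: "nat graph" where
  "Theta4 = Graph {1..6} (cycle_edges [1, 2, 3, 4, 5, 6] \<union> {{2, 4}, {2, 5}, {2, 6}})"


section \<open>Geometric graphs\<close>

text \<open>
  An edge of a geometric graph is represented by the set of the two endpoints of the closed
  segment.
\<close>

type_synonym point = "real ^ 2"

definition general_position :: "point set \<Rightarrow> bool" where
  "general_position S \<longleftrightarrow> (\<forall>T \<in> nsets S 3. \<not> collinear T)"

definition geometric_graph :: "point graph \<Rightarrow> bool" where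
  "geometric_graph D \<longleftrightarrow> simple_graph D \<and> general_position (verts D)"

text \<open>
  Open segments, since edges that merely meet in a common endpoint do not cross.
  In general position, two distinct edges with a common endpoint have disjoint open segments.
\<close>

definition crossing :: "point set \<Rightarrow> point set \<Rightarrow> bool" where
  "crossing e f \<longleftrightarrow>
     (\<exists>a b c d. e = {a, b} \<and> f = {c, d} \<and> open_segment a b \<inter> open_segment c d \<noteq> {})"

definition plane :: "point graph \<Rightarrow> bool" where
  "plane D \<longleftrightarrow> (\<forall>e \<in> edges D. \<forall>f \<in> edges D. e \<noteq> f \<longrightarrow> \<not> crossing e f)"

definition plane_drawings :: "'a graph \<Rightarrow> point graph set" where
  "plane_drawings G = {D. geometric_graph D \<and> plane D \<and> isomorphic G D}"

definition planar :: "'a graph \<Rightarrow> bool" where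
  "planar G \<longleftrightarrow> (\<exists>D. geometric_graph D \<and> plane D \<and> isomorphic G D)"

text \<open>Only orientation-preserving motions are admitted: there are no reflections.\<close>

definition congruent :: "point graph \<Rightarrow> point graph \<Rightarrow> bool" where
  "congruent D D' \<longleftrightarrow>
     (\<exists>(A :: real ^ 2 ^ 2) b. rotation_matrix A \<and> D' = graph_image (\<lambda>x. A *v x + b) D)"


section \<open>Packings\<close>

definition packing :: "point graph \<Rightarrow> point graph set \<Rightarrow> point graph set \<Rightarrow> bool" where
  "packing H \<G> \<S> \<longleftrightarrow>
     (\<forall>F \<in> \<S>. subgraph F H \<and> (\<exists>D \<in> \<G>. congruent F D)) \<and>
     pairwise (\<lambda>F F'. disjnt (edges F) (edges F')) \<S>"

definition packing_number :: "point graph \<Rightarrow> point graph set \<Rightarrow> nat" where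
  "packing_number H \<G> = Max {card \<S> | \<S>. packing H \<G> \<S>}"

text \<open>The common number of edges; only meaningful if all members of \<open>\<G>\<close> have equally many.\<close>

definition common_num_edges :: "point graph set \<Rightarrow> nat" where
  "common_num_edges \<G> = the_elem (num_edges ` \<G>)"

definition asymptotically_packed :: "(nat \<Rightarrow> point graph) \<Rightarrow> point graph set \<Rightarrow> bool" where
  "asymptotically_packed H \<G> \<longleftrightarrow>
     (\<lambda>n. real (packing_number (H n) \<G>) * real (common_num_edges \<G>) / real (num_edges (H n)))
       \<longlonglongrightarrow> 1"

definition complete_drawing :: "nat \<Rightarrow> point graph \<Rightarrow> bool" where
  "complete_drawing n D \<longleftrightarrow>
     geometric_graph D \<and> num_verts D = n \<and> edges D = nsets (verts D) 2"

definition geometric_packable :: "point graph set \<Rightarrow> bool" where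
  "geometric_packable \<G> \<longleftrightarrow>
     (\<forall>D. (\<forall>n \<ge> 1. complete_drawing n (D n)) \<longrightarrow> asymptotically_packed D \<G>)"


section \<open>Well-definedness\<close>

lemma num_edges_isomorphic:
  assumes "simple_graph G" "isomorphic G H"
  shows "num_edges H = num_edges G"
proof -
  obtain f where f: "inj_on f (verts G)" "H = graph_image f G"
    using assms(2) by (auto simp: isomorphic_def)
  have "edges G \<subseteq> Pow (verts G)"
    using assms(1) by (auto simp: simple_graph_def nsets_def)
  then have "inj_on ((`) f) (edges G)"
    using inj_on_image_Pow[OF f(1)] inj_on_subset by blast
  then show ?thesis
    by (simp add: f(2) num_edges_def graph_image_def card_image)
qed

lemma common_num_edges_plane_drawings:
  assumes "simple_graph G" "planar G"
  shows "common_num_edges (plane_drawings G) = num_edges G"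
proof -
  have "num_edges ` plane_drawings G = {num_edges G}"
    using assms num_edges_isomorphic[OF assms(1)]
    by (fastforce simp: planar_def plane_drawings_def)
  then show ?thesis
    by (simp add: common_num_edges_def)
qed

lemma finite_subgraphs:
  assumes "simple_graph H"
  shows "finite {F. subgraph F H}"
proof (rule finite_subset)
  show "{F. subgraph F H} \<subseteq> case_prod Graph ` (Pow (verts H) \<times> Pow (edges H))"
  proof
    fix F assume "F \<in> {F. subgraph F H}"
    then show "F \<in> case_prod Graph ` (Pow (verts H) \<times> Pow (edges H))"
      by (cases F) (auto simp: subgraph_def)
  qed
  have "finite (edges H)"
    using assms finite_imp_finite_nsets[of "verts H" 2] finite_subset
    by (auto simp: simple_graph_def)
  then show "finite (case_prod Graph ` (Pow (verts H) \<times> Pow (edges H)))"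
    using assms by (auto simp: simple_graph_def)
qed

text \<open>The maximum in \<open>packing_number\<close> ranges over a finite nonempty set.\<close>

lemma packing_empty: "packing H \<G> {}"
  by (simp add: packing_def)

lemma finite_packing_cards:
  assumes "simple_graph H"
  shows "finite {card \<S> | \<S>. packing H \<G> \<S>}"
proof (rule finite_subset)
  show "{card \<S> | \<S>. packing H \<G> \<S>} \<subseteq> card ` Pow {F. subgraph F H}"
    by (auto simp: packing_def)
  show "finite (card ` Pow {F. subgraph F H})"
    using finite_subgraphs[OF assms] by simp
qed

end

theory Submission
  imports Defs "HOL-Number_Theory.Cong"
begin

text \<open>
  Non-packability: draw \<open>K\<^sub>n\<close> on points of a parabola. A plane Hamiltonian copy of \<open>G\<close> is then a
  convex polygon with non-crossing chords. Weigh an edge by its cyclic length truncated at \<open>T = t n\<close>.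
  The total weight of \<open>K\<^sub>n\<close> is about \<open>n T (n - T) / 2\<close>, while a copy weighs at most
  \<open>n + (e - k) T\<close>, where \<open>G\<close> has \<open>k\<close> vertices and \<open>e\<close> edges. With \<open>t = k / 2e\<close>, packability
  forces \<open>k\<^sup>2 \<le> 4 e\<close>, and since \<open>e \<le> 2 k - 3\<close> only the listed graphs and the hexagon with an
  inscribed triangle remain; the latter is excluded by \<open>t = 1/2\<close>.

  Packability: triangles come from a transversal design and recursion inside its columns. For \<open>C\<^sub>4\<close>,
  take a perfect matching of maximal total length: any two of its edges span a plane 4-cycle made of
  the four connecting edges. For \<open>\<Theta>\<^sub>1\<close>, pair up almost all points into twins, which few lines through
  two other points separate; six pairs of twins in general position decompose into 12 plane copies,
  and a transversal design with six columns that avoids bad triples reduces the problem to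
  the columns.
\<close>

section \<open>Isomorphisms and congruences\<close>

text \<open>One bad sequence of drawings refutes packability, and convex position is chosen because
  planarity then depends only on the cyclic order of the vertices. Truncation limits what a chord
  can contribute. Comparing averages gives e t (1 - t) \<le> 1 + (e - k) t, that is k t - e t^2
  \<le> 1, whose left side is largest at t = k / 2e. All triangulated hexagons meet the resulting
  bound with equality; the inscribed triangle is special because its three chords together go round
  the polygon only once.

  The obstacle to packing is that the drawing is arbitrary, so a block of a design need not carry a
  plane copy. Any triangle is plane; and in a good block the side of a line depends only on the pair
  of twins, not on the chosen twin. Twelve copies with five edges use exactly the 60 edges between
  six pairs of twins, so a good block loses nothing. Edges inside columns are recovered because
  density \<alpha> there yields (c - 1 + \<alpha>) / c overall, c being the number of columns, and 1
  is the only fixed point of this map.\<close>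

lemma simple_graph_edge_subset: "simple_graph G \<Longrightarrow> e \<in> edges G \<Longrightarrow> e \<subseteq> verts G"
  by (auto simp: simple_graph_def nsets_def)

lemma graph_image_comp: "graph_image g (graph_image f G) = graph_image (g \<circ> f) G"
  by (simp add: graph_image_def image_comp comp_def)

lemma graph_image_cong_id:
  assumes "simple_graph G" "\<And>x. x \<in> verts G \<Longrightarrow> f x = x"
  shows "graph_image f G = G"
proof -
  have "(`) f ` edges G = edges G"
  proof -
    have "f ` e = e" if "e \<in> edges G" for e
      using simple_graph_edge_subset[OF assms(1) that] assms(2) by force
    then show ?thesis by simp
  qed
  moreover have "f ` verts G = verts G"
    using assms(2) by simp
  ultimately show ?thesis
    by (cases G) (simp add: graph_image_def)
qed

lemma isomorphic_trans:
  assumes "isomorphic F G" "isomorphic G H"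
  shows "isomorphic F H"
proof -
  obtain f g where f: "inj_on f (verts F)" "G = graph_image f F"
    and g: "inj_on g (verts G)" "H = graph_image g G"
    using assms by (auto simp: isomorphic_def)
  have "verts G = f ` verts F"
    by (simp add: f(2) graph_image_def)
  then have "inj_on (g \<circ> f) (verts F)"
    using f(1) g(1) by (simp add: comp_inj_on)
  then show ?thesis
    unfolding isomorphic_def by (intro exI[of _ "g \<circ> f"]) (simp add: f(2) g(2) graph_image_comp)
qed

lemma isomorphic_sym:
  assumes "simple_graph F" "isomorphic F G"
  shows "isomorphic G F"
proof -
  obtain f where f: "inj_on f (verts F)" "G = graph_image f F"
    using assms(2) by (auto simp: isomorphic_def)
  let ?g = "inv_into (verts F) f"
  have "graph_image ?g G = F"
    using graph_image_cong_id[OF assms(1), of "?g \<circ> f"] f by (simp add: graph_image_comp)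
  moreover have "inj_on ?g (verts G)"
    by (simp add: f(2) graph_image_def inj_on_inv_into)
  ultimately show ?thesis
    unfolding isomorphic_def by (intro exI[of _ ?g]) simp
qed

lemma simple_graph_image:
  assumes "simple_graph F" "inj_on f (verts F)"
  shows "simple_graph (graph_image f F)"
proof -
  have "card (f ` e) = 2" if "e \<in> edges F" for e
  proof -
    have "card e = 2"
      using that assms(1) by (auto simp: simple_graph_def nsets_def)
    then show ?thesis
      using card_image[OF inj_on_subset[OF assms(2) simple_graph_edge_subset[OF assms(1) that]]]
      by simp
  qed
  then show ?thesis
    using assms(1) by (auto simp: simple_graph_def graph_image_def nsets_def)
qed

lemma simple_graph_isomorphic: "simple_graph F \<Longrightarrow> isomorphic F G \<Longrightarrow> simple_graph G"
  by (auto simp: isomorphic_def simple_graph_image)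

section \<open>Invariance of plane drawings under rigid motions\<close>

lemma general_position_subset: "general_position V \<Longrightarrow> U \<subseteq> V \<Longrightarrow> general_position U"
  unfolding general_position_def using nsets_mono by blast

lemma inj_rotation_matrix_affine:
  fixes A :: "real^2^2"
  assumes "rotation_matrix A"
  shows "inj (\<lambda>x. A *v x + b)"
proof -
  have "transpose A ** A = mat 1"
    using assms by (simp add: rotation_matrix_def orthogonal_matrix_def)
  then have "inj ((*v) A)"
    using matrix_left_invertible_injective by blast
  then show ?thesis
    by (simp add: inj_def)
qed

lemma crossingI: "z \<in> open_segment a b \<Longrightarrow> z \<in> open_segment c d \<Longrightarrow> crossing {a, b} {c, d}"
  unfolding crossing_def by (intro exI[of _ a] exI[of _ b] exI[of _ c] exI[of _ d] conjI refl) blast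

lemma crossing_affine_image:
  fixes A :: "real^2^2"
  assumes "rotation_matrix A" "crossing e f"
  shows "crossing ((\<lambda>x. A *v x + b) ` e) ((\<lambda>x. A *v x + b) ` f)"
proof -
  let ?h = "\<lambda>x. A *v x + b"
  obtain p q r s z where pq: "e = {p, q}" "f = {r, s}"
    and z: "z \<in> open_segment p q" "z \<in> open_segment r s"
    using assms(2) unfolding crossing_def by blast
  have inj: "inj ((*v) A)"
    using inj_rotation_matrix_affine[OF assms(1), of 0] by simp
  have seg: "open_segment (?h x) (?h y) = ?h ` open_segment x y" for x y
    using open_segment_linear_image[OF matrix_vector_mul_linear inj, of x y]
      open_segment_translation[of b "A *v x" "A *v y"]
    by (simp add: image_image add.commute)
  have "?h z \<in> open_segment (?h p) (?h q)" "?h z \<in> open_segment (?h r) (?h s)"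
    using imageI[OF z(1), of ?h] imageI[OF z(2), of ?h] by (simp_all only: seg)
  then have "crossing {?h p, ?h q} {?h r, ?h s}"
    by (rule crossingI)
  then show ?thesis
    by (simp only: pq image_insert image_empty)
qed

lemma congruent_imp_isomorphic: "congruent F D \<Longrightarrow> isomorphic F D"
  unfolding congruent_def isomorphic_def
  by (blast intro: inj_on_subset[OF inj_rotation_matrix_affine])

lemma congruent_refl: "simple_graph F \<Longrightarrow> congruent F F"
  unfolding congruent_def
  by (rule exI[of _ "mat 1"], rule exI[of _ 0])
     (simp add: graph_image_cong_id rotation_matrix_def orthogonal_matrix_id)

text \<open>The motion carries a crossing of two edges of \<open>F\<close> to a crossing in
  \<open>D\<close>. So inside a point set in general position a packing is simply a family of
  edge-disjoint plane copies of \<open>G\<close>.\<close>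

lemma plane_drawings_congruent:
  assumes "simple_graph G" "D \<in> plane_drawings G" "congruent F D"
    and "simple_graph F" "general_position (verts F)"
  shows "F \<in> plane_drawings G"
proof -
  have "isomorphic G F"
    using assms(2) isomorphic_trans
      isomorphic_sym[OF assms(4) congruent_imp_isomorphic[OF assms(3)]]
    unfolding plane_drawings_def by blast
  moreover have "plane F"
    unfolding plane_def
  proof (intro ballI impI notI)
    fix e f assume ef: "e \<in> edges F" "f \<in> edges F" "e \<noteq> f" "crossing e f"
    obtain A :: "real^2^2" and b where A: "rotation_matrix A"
      and D: "D = graph_image (\<lambda>x. A *v x + b) F"
      using assms(3) unfolding congruent_def by blast
    let ?h = "\<lambda>x. A *v x + b"
    have "?h ` e \<noteq> ?h ` f"
      using ef(3) inj_rotation_matrix_affine[OF A, of b] by (simp add: inj_image_eq_iff)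
    moreover have "crossing (?h ` e) (?h ` f)"
      using crossing_affine_image[OF A ef(4)] .
    moreover have "?h ` e \<in> edges D" "?h ` f \<in> edges D"
      using ef by (auto simp: D graph_image_def)
    moreover have "plane D"
      using assms(2) by (simp add: plane_drawings_def)
    ultimately show False
      by (simp add: plane_def)
  qed
  ultimately show ?thesis
    using assms by (simp add: plane_drawings_def geometric_graph_def)
qed

section \<open>Tilings of complete geometric graphs\<close>

text \<open>The host is a bare point set, standing for its complete geometric graph, and congruence
  is dropped: both make it easy to pass to subsets and to unite tilings. For plane drawings nothing
  is lost.\<close>

definition tiling :: "point graph set \<Rightarrow> point set \<Rightarrow> point graph set \<Rightarrow> bool" where
  "tiling \<G> V S \<longleftrightarrow> finite S \<and> S \<subseteq> \<G> \<and> (\<forall>F \<in> S. verts F \<subseteq> V) \<and>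
     pairwise (\<lambda>F F'. disjnt (edges F) (edges F')) S"

text \<open>The threshold \<open>n0\<close> must not depend on \<open>V\<close>, since the recursion
  applies the same \<alpha> to columns of unknown shape. Comparing with half of the square of
  \<open>card V\<close> instead of a binomial coefficient avoids lower-order terms.\<close>

definition tileable :: "point graph set \<Rightarrow> nat \<Rightarrow> real \<Rightarrow> bool" where
  "tileable \<G> e \<alpha> \<longleftrightarrow> (\<exists>n0. \<forall>V. finite V \<and> general_position V \<and> n0 \<le> card V \<longrightarrow>
     (\<exists>S. tiling \<G> V S \<and> \<alpha> * real (card V)^2 / 2 \<le> real (e * card S)))"

lemma packing_edge_count:
  assumes "simple_graph H" "packing H (plane_drawings G) S" "simple_graph G"
  shows "finite S" "num_edges G * card S \<le> num_edges H"
    "card (\<Union>F\<in>S. edges F) = num_edges G * card S"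
proof -
  have fin: "finite (edges H)"
    using assms(1) finite_imp_finite_nsets finite_subset unfolding simple_graph_def by blast
  have "S \<subseteq> {F. subgraph F H}"
    using assms(2) by (auto simp: packing_def)
  then show S: "finite S"
    using finite_subgraphs[OF assms(1)] finite_subset by blast
  have "card (edges F) = num_edges G" if F: "F \<in> S" for F
  proof -
    obtain D where D: "D \<in> plane_drawings G" "congruent F D" "simple_graph F"
      using assms(2) F unfolding packing_def subgraph_def by blast
    have "num_edges D = num_edges F"
      using num_edges_isomorphic[OF D(3) congruent_imp_isomorphic[OF D(2)]] .
    moreover have "num_edges D = num_edges G"
      using num_edges_isomorphic[OF assms(3), of D] D(1) by (simp add: plane_drawings_def)
    ultimately have "num_edges F = num_edges G" by simp
    then show ?thesis by (simp add: num_edges_def)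
  qed
  moreover have "edges F \<subseteq> edges H" if "F \<in> S" for F
    using assms(2) that unfolding packing_def subgraph_def by blast
  moreover have "card (\<Union>F\<in>S. edges F) = (\<Sum>F\<in>S. card (edges F))"
  proof (rule card_UN_disjoint[OF S])
    show "\<forall>F\<in>S. finite (edges F)"
      using calculation(2) fin finite_subset by blast
    show "\<forall>F\<in>S. \<forall>F'\<in>S. F \<noteq> F' \<longrightarrow> edges F \<inter> edges F' = {}"
      using assms(2) unfolding packing_def pairwise_def disjnt_def by blast
  qed
  ultimately show *: "card (\<Union>F\<in>S. edges F) = num_edges G * card S"
    by simp
  have "(\<Union>F\<in>S. edges F) \<subseteq> edges H"
    using \<open>\<And>F. F \<in> S \<Longrightarrow> edges F \<subseteq> edges H\<close> by blast
  then show "num_edges G * card S \<le> num_edges H"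
    using card_mono[OF fin, of "\<Union>F\<in>S. edges F"] * by (simp add: num_edges_def)
qed

lemma complete_drawingD:
  assumes "complete_drawing n D"
  shows "simple_graph D" "finite (verts D)" "general_position (verts D)" "card (verts D) = n"
    "edges D = nsets (verts D) 2" "num_edges D = n choose 2"
  using assms
  by (auto simp: complete_drawing_def geometric_graph_def simple_graph_def num_verts_def
      num_edges_def card_nsets)

lemma packing_number_obtain:
  assumes "simple_graph H"
  obtains S where "packing H \<G> S" "packing_number H \<G> = card S"
proof -
  have "packing_number H \<G> \<in> {card S | S. packing H \<G> S}"
    unfolding packing_number_def
    using finite_packing_cards[OF assms] packing_empty by (intro Max_in) auto
  then show ?thesis using that by blast
qed

lemma tiling_le_packing_number:
  assumes "complete_drawing n D" "tiling (plane_drawings G) (verts D) S"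
  shows "card S \<le> packing_number D (plane_drawings G)"
proof -
  have "subgraph F D \<and> (\<exists>D'\<in>plane_drawings G. congruent F D')" if "F \<in> S" for F
  proof -
    have F: "F \<in> plane_drawings G" "verts F \<subseteq> verts D"
      using assms(2) that by (auto simp: tiling_def)
    then have s: "simple_graph F"
      by (simp add: plane_drawings_def geometric_graph_def)
    then have "edges F \<subseteq> edges D"
      using complete_drawingD(5)[OF assms(1)] nsets_mono[OF F(2), of 2]
      unfolding simple_graph_def by auto
    then show ?thesis
      using s F congruent_refl unfolding subgraph_def by blast
  qed
  then have "packing D (plane_drawings G) S"
    using assms(2) by (simp add: packing_def tiling_def)
  then show ?thesis
    unfolding packing_number_def
    using finite_packing_cards[OF complete_drawingD(1)[OF assms(1)]] by (intro Max_ge) auto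
qed

text \<open>Disjointness of the copies bounds the ratio by 1 from above. A tiling of density
  \<alpha> bounds it by \<alpha> from below, because half of the square of \<open>n\<close> exceeds
  \<open>n choose 2\<close>.\<close>

lemma tileable_imp_geometric_packable:
  assumes G: "simple_graph G" "planar G" and e: "num_edges G = e" "e > 0"
    and til: "\<And>\<alpha>. \<alpha> < 1 \<Longrightarrow> tileable (plane_drawings G) e \<alpha>"
  shows "geometric_packable (plane_drawings G)"
  unfolding geometric_packable_def asymptotically_packed_def
proof (intro allI impI)
  fix D assume D: "\<forall>n\<ge>1. complete_drawing n (D n)"
  let ?r = "\<lambda>n. real (packing_number (D n) (plane_drawings G)) *
                 real (common_num_edges (plane_drawings G)) / real (num_edges (D n))"
  have le1: "?r n \<le> 1" if "n \<ge> 2" for n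
  proof -
    have Dn: "complete_drawing n (D n)" using D that by simp
    obtain S where S: "packing (D n) (plane_drawings G) S"
      "packing_number (D n) (plane_drawings G) = card S"
      using packing_number_obtain[OF complete_drawingD(1)[OF Dn]] .
    have "e * card S \<le> n choose 2"
      using packing_edge_count(2)[OF complete_drawingD(1)[OF Dn] S(1) G(1)] e
        complete_drawingD(6)[OF Dn] by simp
    then have "real (card S) * real e \<le> real (n choose 2)"
      unfolding of_nat_mult[symmetric] by (subst of_nat_le_iff) (simp add: mult.commute)
    then show ?thesis
      using S(2) complete_drawingD(6)[OF Dn] common_num_edges_plane_drawings[OF G] e
      by (simp add: divide_le_eq)
  qed
  show "?r \<longlonglongrightarrow> 1"
  proof (rule LIMSEQ_I)
    fix \<epsilon> :: real assume "\<epsilon> > 0"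
    define \<alpha> where "\<alpha> = 1 - \<epsilon> / 2"
    have "\<alpha> < 1" using \<open>\<epsilon> > 0\<close> by (simp add: \<alpha>_def)
    from til[OF this] obtain n0 where n0: "\<And>V. finite V \<Longrightarrow> general_position V \<Longrightarrow> n0 \<le> card V \<Longrightarrow>
      \<exists>S. tiling (plane_drawings G) V S \<and> \<alpha> * real (card V)^2 / 2 \<le> real (e * card S)"
      unfolding tileable_def by blast
    have "norm (?r n - 1) < \<epsilon>" if n: "n \<ge> max n0 2" for n
    proof -
      have Dn: "complete_drawing n (D n)" using D n by simp
      obtain S where S: "tiling (plane_drawings G) (verts (D n)) S"
        "\<alpha> * real n^2 / 2 \<le> real (e * card S)"
        using n0[of "verts (D n)"] complete_drawingD[OF Dn] n by auto
      have pos: "real (n choose 2) > 0"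
        using n by (simp add: zero_less_binomial)
      have ch: "real (n choose 2) = real n * (real n - 1) / 2"
        using n by (cases n) (simp_all add: choose_two field_char_0_class.of_nat_div mod_eq_0_iff_dvd algebra_simps)
      have "\<alpha> * real (n choose 2) \<le> real (e * card S)"
      \<comment> \<open>For \<epsilon> > 2 the number \<alpha> is negative, and then the bound is
        trivial.\<close>
      proof (cases "\<alpha> \<ge> 0")
        case True
        have "\<alpha> * real (n choose 2) \<le> \<alpha> * (real n^2 / 2)"
          using True ch by (intro mult_left_mono) (auto simp: power2_eq_square field_simps)
        then show ?thesis using S(2) by simp
      next
        case False
        then have "\<alpha> * real (n choose 2) \<le> 0" using pos by (simp add: mult_nonpos_nonneg)
        also have "0 \<le> real (e * card S)" by simp
        finally show ?thesis .
      qed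
      also have "\<dots> \<le> real (packing_number (D n) (plane_drawings G)) * real e"
        using tiling_le_packing_number[OF Dn S(1)] by (simp add: mult.commute mult_left_mono)
      finally have "\<alpha> \<le> ?r n"
        using pos complete_drawingD(6)[OF Dn] common_num_edges_plane_drawings[OF G] e
        by (simp add: le_divide_eq)
      then show ?thesis
        using le1[of n] n \<open>\<epsilon> > 0\<close> by (simp add: \<alpha>_def)
    qed
    then show "\<exists>no. \<forall>n\<ge>no. norm (?r n - 1) < \<epsilon>" by blast
  qed
qed

section \<open>Orientation and plane drawings of small graphs\<close>

text \<open>Twice the signed area of the triangle, positive for a counterclockwise triple.\<close>

definition orient :: "point \<Rightarrow> point \<Rightarrow> point \<Rightarrow> real" where
  "orient p q r = (q$1 - p$1) * (r$2 - p$2) - (q$2 - p$2) * (r$1 - p$1)"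

lemma orient_cyclic: "orient q r p = orient p q r"
  by (simp add: orient_def algebra_simps)

lemma orient_same [simp]: "orient p p q = 0" "orient p q p = 0" "orient q p p = 0"
  by (simp_all add: orient_def)

lemma orient_affine: "orient p q ((1 - t) *\<^sub>R a + t *\<^sub>R b) = (1 - t) * orient p q a + t * orient p q b"
  by (simp add: orient_def algebra_simps)

lemma collinear_iff_orient: "collinear {p, q, r} \<longleftrightarrow> orient p q r = 0"
proof
  assume "collinear {p, q, r}"
  then consider "p = r" | u where "q = u *\<^sub>R p + (1 - u) *\<^sub>R r"
    unfolding collinear_3_expand by blast
  then show "orient p q r = 0"
  proof cases
    case 2
    then have q: "q$1 = u * p$1 + (1 - u) * r$1" "q$2 = u * p$2 + (1 - u) * r$2"
      by simp_all
    show ?thesis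
      unfolding orient_def q by (simp add: algebra_simps)
  qed simp
next
  assume 0: "orient p q r = 0"
  show "collinear {p, q, r}"
  proof (cases "p = r")
    case False
    \<comment> \<open>The parameter is read off a coordinate in which \<open>p\<close> and
      \<open>r\<close> differ; the vanishing determinant makes it fit the other coordinate as
      well.\<close>
    then consider "p$1 \<noteq> r$1" | "p$2 \<noteq> r$2"
      by (auto simp: vec_eq_iff forall_2)
    then have "\<exists>u. q = u *\<^sub>R p + (1 - u) *\<^sub>R r"
    proof cases
      case 1
      define u where "u = (q$1 - r$1) / (p$1 - r$1)"
      have "u * (p$1 - r$1) = q$1 - r$1" "u * (p$2 - r$2) = q$2 - r$2"
        using 0 1 by (simp_all add: u_def orient_def divide_simps) (simp add: algebra_simps)
      then have "q = u *\<^sub>R p + (1 - u) *\<^sub>R r"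
        by (simp add: vec_eq_iff forall_2 algebra_simps)
      then show ?thesis ..
    next
      case 2
      define u where "u = (q$2 - r$2) / (p$2 - r$2)"
      have "u * (p$1 - r$1) = q$1 - r$1" "u * (p$2 - r$2) = q$2 - r$2"
        using 0 2 by (simp_all add: u_def orient_def divide_simps) (simp add: algebra_simps)
      then have "q = u *\<^sub>R p + (1 - u) *\<^sub>R r"
        by (simp add: vec_eq_iff forall_2 algebra_simps)
      then show ?thesis ..
    qed
    then show ?thesis
      by (simp add: collinear_3_expand)
  qed (simp add: insert_commute)
qed

lemma general_position_iff:
  "general_position V \<longleftrightarrow>
     (\<forall>p\<in>V. \<forall>q\<in>V. \<forall>r\<in>V. p \<noteq> q \<and> p \<noteq> r \<and> q \<noteq> r \<longrightarrow> orient p q r \<noteq> 0)"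
  unfolding general_position_def nsets_3_eq by (fastforce simp: collinear_iff_orient)

lemma general_position_orient:
  "general_position V \<Longrightarrow> p \<in> V \<Longrightarrow> q \<in> V \<Longrightarrow> r \<in> V \<Longrightarrow> p \<noteq> q \<Longrightarrow> p \<noteq> r \<Longrightarrow> q \<noteq> r
    \<Longrightarrow> orient p q r \<noteq> 0"
  by (simp add: general_position_iff)

text \<open>The definition lets the endpoints be named in any order. Open segments do not depend on
  that order, so the given names suffice.\<close>

lemma crossing_iff:
  "crossing {a, b} {c, d} \<longleftrightarrow> (\<exists>z. z \<in> open_segment a b \<and> z \<in> open_segment c d)"
proof
  assume "crossing {a, b} {c, d}"
  then obtain a' b' c' d' where *: "{a, b} = {a', b'}" "{c, d} = {c', d'}"
    "open_segment a' b' \<inter> open_segment c' d' \<noteq> {}"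
    unfolding crossing_def by blast
  have seg: "open_segment x y = open_segment x' y'" if "{x, y} = {x', y'}" for x y x' y' :: point
    using iffD1[OF doubleton_eq_iff that] by (elim disjE conjE) (simp_all add: open_segment_commute)
  have "\<exists>z. z \<in> open_segment a' b' \<inter> open_segment c' d'"
    using *(3) by (simp only: ex_in_conv not_False_eq_True)
  then show "\<exists>z. z \<in> open_segment a b \<and> z \<in> open_segment c d"
    unfolding seg[OF *(1)] seg[OF *(2)] Int_iff .
qed (elim exE conjE, rule crossingI)

lemma crossing_commute: "crossing e f \<longleftrightarrow> crossing f e"
  unfolding crossing_def by (metis inf_commute)

lemma open_segment_orient:
  assumes "z \<in> open_segment a b"
  shows "\<exists>t. 0 < t \<and> t < 1 \<and> (\<forall>p q. orient p q z = (1 - t) * orient p q a + t * orient p q b)"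
  using assms orient_affine unfolding in_segment by metis

text \<open>A common point would lie on the line \<open>p a\<close> and, as an inner point of
  \<open>p b\<close>, strictly to one side of it.\<close>

lemma adjacent_not_crossing:
  assumes "orient p a b \<noteq> 0"
  shows "\<not> crossing {p, a} {p, b}"
proof
  assume "crossing {p, a} {p, b}"
  then have "\<exists>z. z \<in> open_segment p a \<and> z \<in> open_segment p b"
    unfolding crossing_iff .
  then obtain z where z: "z \<in> open_segment p a" "z \<in> open_segment p b"
    by (elim exE conjE)
  obtain t where "orient p a z = (1 - t) * orient p a p + t * orient p a a"
    using open_segment_orient[OF z(1)] by metis
  moreover obtain t' where "0 < t'" "orient p a z = (1 - t') * orient p a p + t' * orient p a b"
    using open_segment_orient[OF z(2)] by metis
  ultimately show False using assms by simp
qed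

text \<open>Relative to the line \<open>p q\<close>, a common point would lie strictly on the side
  of \<open>a\<close>, being inside \<open>p a\<close>, and strictly on the side of
  \<open>b\<close>, being inside \<open>q b\<close>.\<close>

lemma separated_not_crossing:
  assumes "orient p q a * orient p q b < 0"
  shows "\<not> crossing {p, a} {q, b}"
proof
  assume "crossing {p, a} {q, b}"
  then have "\<exists>z. z \<in> open_segment p a \<and> z \<in> open_segment q b"
    unfolding crossing_iff .
  then obtain z where z: "z \<in> open_segment p a" "z \<in> open_segment q b"
    by (elim exE conjE)
  obtain t where t: "0 < t" "orient p q z = (1 - t) * orient p q p + t * orient p q a"
    using open_segment_orient[OF z(1)] by metis
  obtain t' where t': "0 < t'" "orient p q z = (1 - t') * orient p q q + t' * orient p q b"
    using open_segment_orient[OF z(2)] by metis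
  have "orient p q z * orient p q z = (t * orient p q a) * (t' * orient p q b)"
    using t(2) t'(2) by simp
  also have "\<dots> = (t * t') * (orient p q a * orient p q b)"
    by (simp add: ac_simps)
  also have "\<dots> < 0"
    using t(1) t'(1) assms by (simp add: mult_pos_neg)
  finally show False
    using zero_le_square[of "orient p q z"] by linarith
qed

lemma intersecting_edges_not_crossing:
  assumes "general_position V" "e \<in> nsets V 2" "f \<in> nsets V 2" "e \<noteq> f" "x \<in> e" "x \<in> f"
  shows "\<not> crossing e f"
proof -
  have "\<exists>y. d = {x, y} \<and> x \<noteq> y \<and> x \<in> V \<and> y \<in> V" if "d \<in> nsets V 2" "x \<in> d" for d
    using that by (auto simp: nsets_def card_2_iff)
  from this[OF assms(2,5)] this[OF assms(3,6)] obtain y z where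
    "e = {x, y}" "f = {x, z}" "x \<noteq> y" "x \<noteq> z" "x \<in> V" "y \<in> V" "z \<in> V"
    by blast
  then show ?thesis
    using adjacent_not_crossing general_position_orient[OF assms(1)] assms(4) by metis
qed

text \<open>General position takes care of edges with a common endpoint, so only disjoint pairs of
  edges have to be examined: none in a triangle, two in a four-cycle or in
  \<open>Theta1\<close>.\<close>

lemma plane_drawingsI:
  assumes "general_position V" "verts F \<subseteq> V" "isomorphic G F" "simple_graph F"
    and "\<And>e f. e \<in> edges F \<Longrightarrow> f \<in> edges F \<Longrightarrow> e \<inter> f = {} \<Longrightarrow> \<not> crossing e f"
  shows "F \<in> plane_drawings G"
proof -
  have gp: "general_position (verts F)"
    using general_position_subset[OF assms(1,2)] .
  have "\<not> crossing e f" if "e \<in> edges F" "f \<in> edges F" "e \<noteq> f" for e f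
  proof (cases "e \<inter> f = {}")
    case False
    have "e \<in> nsets (verts F) 2" "f \<in> nsets (verts F) 2"
      using that assms(4) by (auto simp: simple_graph_def)
    then show ?thesis
      using intersecting_edges_not_crossing[OF gp] that(3) False by blast
  qed (use assms(5) that in blast)
  then show ?thesis
    using assms(3,4) gp by (simp add: plane_drawings_def geometric_graph_def plane_def)
qed

lemma cycle_edges_image:
  "cycle_edges xs = (\<lambda>i. {xs ! i, xs ! (Suc i mod length xs)}) ` {..<length xs}"
  by (auto simp: cycle_edges_def)

section \<open>Plane drawings of the three graphs that are packed\<close>

definition triangle_graph :: "point \<Rightarrow> point \<Rightarrow> point \<Rightarrow> point graph" where
  "triangle_graph p q r = Graph {p, q, r} {{p, q}, {q, r}, {r, p}}"

definition four_cycle :: "point \<Rightarrow> point \<Rightarrow> point \<Rightarrow> point \<Rightarrow> point graph" where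
  "four_cycle p q r s = Graph {p, q, r, s} {{p, q}, {q, r}, {r, s}, {s, p}}"

text \<open>\<open>Theta1\<close> with the chord \<open>p q\<close>; \<open>a\<close> and
  \<open>b\<close> are the vertices of degree two.\<close>

definition theta :: "point \<Rightarrow> point \<Rightarrow> point \<Rightarrow> point \<Rightarrow> point graph" where
  "theta p q a b = Graph {p, q, a, b} {{p, q}, {p, a}, {p, b}, {q, a}, {q, b}}"

lemma cycle_edges_explicit:
  "cycle_edges [a, b, c] = {{a, b}, {b, c}, {c, a}}"
  "cycle_edges [a, b, c, d] = {{a, b}, {b, c}, {c, d}, {d, a}}"
  "cycle_edges [a, b, c, d, e] = {{a, b}, {b, c}, {c, d}, {d, e}, {e, a}}"
  "cycle_edges [a, b, c, d, e, f] = {{a, b}, {b, c}, {c, d}, {d, e}, {e, f}, {f, a}}"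
  unfolding cycle_edges_image by (auto simp: lessThan_Suc)

lemma cycle_graph_3: "cycle_graph 3 = Graph {1, 2, 3} {{1, 2}, {2, 3}, {3, 1}}"
proof -
  have *: "{1..3} = {1, 2, 3::nat}" "[1..<Suc 3] = [1, 2, 3]"
    by (auto simp: upt_rec)
  show ?thesis
    unfolding cycle_graph_def * cycle_edges_explicit ..
qed

lemma cycle_graph_4: "cycle_graph 4 = Graph {1, 2, 3, 4} {{1, 2}, {2, 3}, {3, 4}, {4, 1}}"
proof -
  have *: "{1..4} = {1, 2, 3, 4::nat}" "[1..<Suc 4] = [1, 2, 3, 4]"
    by (auto simp: upt_rec)
  show ?thesis
    unfolding cycle_graph_def * cycle_edges_explicit ..
qed

lemma Theta1_eq: "Theta1 = Graph {1, 2, 3, 4} {{1, 2}, {2, 3}, {3, 4}, {4, 1}, {2, 4}}"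
proof -
  have *: "{1..4} = {1, 2, 3, 4::nat}"
    by auto
  show ?thesis
    unfolding Theta1_def * cycle_edges_explicit by (simp add: insert_commute)
qed

lemma triangle_in_plane_drawings:
  assumes "general_position V" "p \<in> V" "q \<in> V" "r \<in> V" "p \<noteq> q" "p \<noteq> r" "q \<noteq> r"
    and "simple_graph G" "isomorphic (cycle_graph 3) G"
  shows "triangle_graph p q r \<in> plane_drawings G"
proof (rule plane_drawingsI[OF assms(1)])
  let ?h = "(\<lambda>i::nat. if i = 1 then p else if i = 2 then q else r)"
  have "isomorphic (cycle_graph 3) (triangle_graph p q r)"
    unfolding isomorphic_def triangle_graph_def cycle_graph_3
    using assms by (intro exI[of _ ?h]) (auto simp: graph_image_def inj_on_def)
  moreover have "simple_graph (cycle_graph 3)"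
    by (auto simp: cycle_graph_3 simple_graph_def nsets_def)
  ultimately show "isomorphic G (triangle_graph p q r)"
    using isomorphic_trans isomorphic_sym assms(9) by blast
qed (use assms in \<open>auto simp: triangle_graph_def simple_graph_def nsets_def\<close>)

lemma four_cycle_in_plane_drawings:
  assumes "general_position V" "{p, q, r, s} \<subseteq> V" "distinct [p, q, r, s]"
    and "\<not> crossing {p, q} {r, s}" "\<not> crossing {q, r} {s, p}"
    and "isomorphic (cycle_graph 4) G"
  shows "four_cycle p q r s \<in> plane_drawings G"
proof (rule plane_drawingsI[OF assms(1)])
  let ?h = "(\<lambda>i::nat. if i = 1 then p else if i = 2 then q else if i = 3 then r else s)"
  have "isomorphic (cycle_graph 4) (four_cycle p q r s)"
    unfolding isomorphic_def four_cycle_def cycle_graph_4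
    using assms(3) by (intro exI[of _ ?h]) (auto simp: graph_image_def inj_on_def)
  moreover have "simple_graph (cycle_graph 4)"
    by (auto simp: cycle_graph_4 simple_graph_def nsets_def)
  ultimately show "isomorphic G (four_cycle p q r s)"
    using isomorphic_trans isomorphic_sym assms(6) by blast
  show "simple_graph (four_cycle p q r s)"
    using assms(3) by (auto simp: four_cycle_def simple_graph_def nsets_def)
  show "verts (four_cycle p q r s) \<subseteq> V"
    using assms(2) by (simp add: four_cycle_def)
  fix e f assume "e \<in> edges (four_cycle p q r s)" "f \<in> edges (four_cycle p q r s)" "e \<inter> f = {}"
  then show "\<not> crossing e f"
    using assms(3,4,5) crossing_commute by (auto simp: four_cycle_def)
qed

text \<open>The line through the chord separates \<open>a\<close> from \<open>b\<close>, which keeps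
  both pairs of disjoint edges apart.\<close>

lemma theta_in_plane_drawings:
  assumes "general_position V" "{p, q, a, b} \<subseteq> V" "distinct [p, q, a, b]"
    and "orient p q a * orient p q b < 0" and "isomorphic Theta1 G"
  shows "theta p q a b \<in> plane_drawings G"
proof (rule plane_drawingsI[OF assms(1)])
  \<comment> \<open>The chord of \<open>Theta1\<close> joins 2 and 4, which therefore go to
    \<open>p\<close> and \<open>q\<close>.\<close>
  let ?h = "(\<lambda>i::nat. if i = 1 then a else if i = 2 then p else if i = 3 then b else q)"
  have "isomorphic Theta1 (theta p q a b)"
    unfolding isomorphic_def theta_def Theta1_eq
    using assms(3) by (intro exI[of _ ?h]) (auto simp: graph_image_def inj_on_def)
  moreover have "simple_graph Theta1"
    by (auto simp: Theta1_eq simple_graph_def nsets_def)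
  ultimately show "isomorphic G (theta p q a b)"
    using isomorphic_trans isomorphic_sym assms(5) by blast
  show "simple_graph (theta p q a b)"
    using assms(3) by (auto simp: theta_def simple_graph_def nsets_def)
  show "verts (theta p q a b) \<subseteq> V"
    using assms(2) by (simp add: theta_def)
  have "\<not> crossing {p, a} {q, b}" "\<not> crossing {p, b} {q, a}"
    using separated_not_crossing assms(4) by (auto simp: mult.commute)
  moreover fix e f assume "e \<in> edges (theta p q a b)" "f \<in> edges (theta p q a b)" "e \<inter> f = {}"
  ultimately show "\<not> crossing e f"
    using assms(3) crossing_commute by (auto simp: theta_def)
qed

section \<open>Recursive tilings\<close>

text \<open>Disjointness is phrased as: a shared edge forces equal indices. Since every member has
  an edge, this also makes the family injective, so its size is that of the index set.\<close>

lemma tilingI: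
  assumes "finite I" "\<And>i. i \<in> I \<Longrightarrow> T i \<in> \<G>" "\<And>i. i \<in> I \<Longrightarrow> verts (T i) \<subseteq> V"
    and ne: "\<And>i. i \<in> I \<Longrightarrow> edges (T i) \<noteq> {}"
    and disj: "\<And>i j e. i \<in> I \<Longrightarrow> j \<in> I \<Longrightarrow> e \<in> edges (T i) \<Longrightarrow> e \<in> edges (T j) \<Longrightarrow> i = j"
  shows "tiling \<G> V (T ` I) \<and> card (T ` I) = card I"
proof
  show "tiling \<G> V (T ` I)"
    using assms(1-3) disj unfolding tiling_def pairwise_def disjnt_iff by blast
  have "inj_on T I"
    using ne disj by (metis all_not_in_conv inj_onI)
  then show "card (T ` I) = card I"
    by (rule card_image)
qed

lemma tileable_mono: "tileable \<G> e \<alpha> \<Longrightarrow> \<beta> \<le> \<alpha> \<Longrightarrow> tileable \<G> e \<beta>"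
  unfolding tileable_def
  by (smt (verit) divide_right_mono mult_right_mono zero_le_power2)

lemma tileable_0: "tileable \<G> e 0"
  unfolding tileable_def
  by (intro exI[of _ 0] allI impI exI[of _ "{}"]) (simp add: tiling_def)

text \<open>Members of \<open>R i\<close> have all their edges inside the column \<open>W i\<close>,
  members of \<open>S\<close> have none inside a column, so nothing is shared. As edge sets are
  non-empty, the families are disjoint and their sizes add up.\<close>

lemma tiling_columns:
  fixes k :: nat
  assumes \<G>: "\<And>F. F \<in> \<G> \<Longrightarrow> simple_graph F \<and> edges F \<noteq> {}"
    and W: "\<And>i. i < k \<Longrightarrow> W i \<subseteq> V" "\<And>i j. i < k \<Longrightarrow> j < k \<Longrightarrow> i \<noteq> j \<Longrightarrow> W i \<inter> W j = {}"
    and S: "tiling \<G> V S" "\<And>F e i. F \<in> S \<Longrightarrow> e \<in> edges F \<Longrightarrow> i < k \<Longrightarrow> \<not> e \<subseteq> W i"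
    and Si: "\<And>i. i < k \<Longrightarrow> tiling \<G> (W i) (R i)"
  shows "\<exists>S'. tiling \<G> V S' \<and> card S' = card S + (\<Sum>i<k. card (R i))"
proof -
  have inW: "e \<subseteq> W i \<and> e \<noteq> {}" if "i < k" "F \<in> R i" "e \<in> edges F" for F e i
  proof -
    have "F \<in> \<G>" "verts F \<subseteq> W i"
      using Si[OF that(1)] that(2) by (auto simp: tiling_def)
    then show ?thesis
      using \<G>[of F] that(3) unfolding simple_graph_def nsets_def by fastforce
  qed
  have d1: "edges F \<inter> edges F' = {}" if "F \<in> S" "F' \<in> R i" "i < k" for F F' i
    using S(2)[OF that(1) _ that(3)] inW[OF that(3,2)] by blast
  have d2: "edges F \<inter> edges F' = {}" if "F \<in> R i" "F' \<in> R j" "i < k" "j < k" "i \<noteq> j" for F F' i j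
    using inW[OF that(3,1)] inW[OF that(4,2)] W(2)[OF that(3,4,5)] by blast
  have inG: "F \<in> \<G>" if "F \<in> S \<or> (\<exists>i<k. F \<in> R i)" for F
    using that S(1) Si unfolding tiling_def by blast
  have fin: "finite S" "\<And>i. i < k \<Longrightarrow> finite (R i)"
    using S(1) Si by (auto simp: tiling_def)
  let ?S = "S \<union> (\<Union>i<k. R i)"
  have "S \<inter> (\<Union>i<k. R i) = {}"
    using d1 \<G> inG by fastforce
  moreover have "card (\<Union>i<k. R i) = (\<Sum>i<k. card (R i))"
  proof (rule card_UN_disjoint)
    show "\<forall>i\<in>{..<k}. \<forall>j\<in>{..<k}. i \<noteq> j \<longrightarrow> R i \<inter> R j = {}"
      using d2 \<G> inG by fastforce
  qed (use fin in auto)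
  ultimately have "card ?S = card S + (\<Sum>i<k. card (R i))"
    using fin by (simp add: card_Un_disjoint)
  moreover have "tiling \<G> V ?S"
    unfolding tiling_def
  proof (intro conjI)
    show "finite ?S" using fin by simp
    show "?S \<subseteq> \<G>" using inG by blast
    show "\<forall>F\<in>?S. verts F \<subseteq> V"
      using S(1) Si W(1) unfolding tiling_def by blast
    show "pairwise (\<lambda>F F'. disjnt (edges F) (edges F')) ?S"
    proof (rule pairwiseI)
      fix F F' assume *: "F \<in> ?S" "F' \<in> ?S" "F \<noteq> F'"
      have same: "disjnt (edges F) (edges F')" if "tiling \<G> U Q" "F \<in> Q" "F' \<in> Q" for U Q
        using that *(3) unfolding tiling_def pairwise_def by blast
      from * consider "F \<in> S" "F' \<in> S" | i where "F \<in> S" "i < k" "F' \<in> R i"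
        | i where "F' \<in> S" "i < k" "F \<in> R i" | i j where "i < k" "j < k" "F \<in> R i" "F' \<in> R j"
        by blast
      then show "disjnt (edges F) (edges F')"
      proof cases
        case 1 then show ?thesis using same[OF S(1)] by blast
      next
        case 2 then show ?thesis using d1 by (simp add: disjnt_def)
      next
        case 3 then show ?thesis using d1[of F' F] by (auto simp: disjnt_def)
      next
        case 4 then show ?thesis
          using same[OF Si[of i]] d2[of F i F' j] by (cases "i = j") (auto simp: disjnt_def)
      qed
    qed
  qed
  ultimately show ?thesis by blast
qed

text \<open>The data of one round of the recursion. The parameter \<eta> bounds both the fraction of
  points outside the columns and the loss against the edge count of the complete
  \<open>k\<close>-partite graph on the columns.\<close>

definition cross_tiling ::
  "point graph set \<Rightarrow> nat \<Rightarrow> nat \<Rightarrow> real \<Rightarrow> point set \<Rightarrow> (nat \<Rightarrow> point set) \<Rightarrow> nat \<Rightarrow> point graph set \<Rightarrow> bool"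
  where "cross_tiling \<G> e k \<eta> V W w S \<longleftrightarrow>
     (\<forall>i<k. W i \<subseteq> V \<and> card (W i) = w) \<and> (\<forall>i<k. \<forall>j<k. i \<noteq> j \<longrightarrow> W i \<inter> W j = {}) \<and>
     (1 - \<eta>) * real (card V) \<le> real (k * w) \<and>
     tiling \<G> V S \<and> (\<forall>F\<in>S. \<forall>d\<in>edges F. \<forall>i<k. \<not> d \<subseteq> W i) \<and>
     (1 - \<eta>) * (real k * (real k - 1) / 2 * real w^2) \<le> real (e * card S)"

definition cross_tileable :: "point graph set \<Rightarrow> nat \<Rightarrow> nat \<Rightarrow> real \<Rightarrow> bool" where
  "cross_tileable \<G> e k \<eta> \<longleftrightarrow> (\<exists>n0. \<forall>V. finite V \<and> general_position V \<and> n0 \<le> card V \<longrightarrow>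
     (\<exists>W w S. cross_tiling \<G> e k \<eta> V W w S))"

text \<open>If n = k w, the columns contribute \<alpha> k w^2 / 2 edges and the pairs of columns k
  (k - 1) w^2 / 2, together the fraction (k - 1 + \<alpha>) / k of n^2 / 2. One factor 1 - \<eta>
  pays for lost cross edges, two pay for points outside the columns, which count
  quadratically.\<close>

lemma tileable_step:
  assumes \<G>: "\<And>F. F \<in> \<G> \<Longrightarrow> simple_graph F \<and> edges F \<noteq> {}"
    and k: "k \<ge> 2" and \<eta>: "0 < \<eta>" "\<eta> < 1" and \<alpha>: "0 \<le> \<alpha>"
    and cross: "cross_tileable \<G> e k \<eta>" and til: "tileable \<G> e \<alpha>"
  shows "tileable \<G> e ((1 - \<eta>)^3 * ((real k - 1 + \<alpha>) / real k))"
proof -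
  obtain n0 where n0: "\<And>V. finite V \<Longrightarrow> general_position V \<Longrightarrow> n0 \<le> card V \<Longrightarrow>
      \<exists>W w S. cross_tiling \<G> e k \<eta> V W w S"
    using cross unfolding cross_tileable_def by blast
  obtain n1 where n1: "\<And>V. finite V \<Longrightarrow> general_position V \<Longrightarrow> n1 \<le> card V \<Longrightarrow>
     (\<exists>S. tiling \<G> V S \<and> \<alpha> * real (card V)^2 / 2 \<le> real (e * card S))"
    using til unfolding tileable_def by blast
  \<comment> \<open>Large enough that each column has at least \<open>n1\<close> points, even after
    the fraction \<eta> of \<open>V\<close> is dropped.\<close>
  obtain n2 :: nat where n2: "real k * real n1 / (1 - \<eta>) < real n2"
    using reals_Archimedean2 by blast
  show ?thesis
    unfolding tileable_def
  proof (intro exI[of _ "max n0 n2"] allI impI)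
    fix V :: "point set" assume V: "finite V \<and> general_position V \<and> max n0 n2 \<le> card V"
    obtain W w S where "cross_tiling \<G> e k \<eta> V W w S"
      using n0[of V] V by auto
    then have W: "\<And>i. i < k \<Longrightarrow> W i \<subseteq> V" "\<And>i. i < k \<Longrightarrow> card (W i) = w"
      and Wd: "\<And>i j. i < k \<Longrightarrow> j < k \<Longrightarrow> i \<noteq> j \<Longrightarrow> W i \<inter> W j = {}"
      and w: "(1 - \<eta>) * real (card V) \<le> real (k * w)"
      and S: "tiling \<G> V S" "\<And>F d i. F \<in> S \<Longrightarrow> d \<in> edges F \<Longrightarrow> i < k \<Longrightarrow> \<not> d \<subseteq> W i"
      and cS: "(1 - \<eta>) * (real k * (real k - 1) / 2 * real w^2) \<le> real (e * card S)"
      unfolding cross_tiling_def by blast+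
    have "real k * real n1 < (1 - \<eta>) * real (card V)"
    proof -
      have "real k * real n1 < (1 - \<eta>) * real n2"
        using n2 \<eta> by (simp add: divide_less_eq mult.commute)
      also have "\<dots> \<le> (1 - \<eta>) * real (card V)"
        using V \<eta> by (intro mult_left_mono) auto
      finally show ?thesis .
    qed
    then have "real k * real n1 < real k * real w"
      using w by simp
    then have "n1 \<le> w" using k by simp
    then have "\<exists>R. tiling \<G> (W i) R \<and> \<alpha> * real w^2 / 2 \<le> real (e * card R)" if "i < k" for i
      using n1[of "W i"] that W V general_position_subset finite_subset by metis
    then obtain R where R: "\<And>i. i < k \<Longrightarrow> tiling \<G> (W i) (R i)"
      "\<And>i. i < k \<Longrightarrow> \<alpha> * real w^2 / 2 \<le> real (e * card (R i))"
      by metis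
    obtain S' where S': "tiling \<G> V S'" "card S' = card S + (\<Sum>i<k. card (R i))"
      using tiling_columns[of \<G> k W V S R] \<G> W(1) Wd S R(1) by blast
    have "real k * (\<alpha> * real w^2 / 2) = (\<Sum>i<k. \<alpha> * real w^2 / 2)"
      by simp
    also have "\<dots> \<le> (\<Sum>i<k. real (e * card (R i)))"
      using R(2) by (intro sum_mono) auto
    also have "\<dots> = real (e * (\<Sum>i<k. card (R i)))"
      by (simp add: sum_distrib_left)
    finally have "(1 - \<eta>) * (real k * (real k - 1) / 2 * real w^2) + real k * (\<alpha> * real w^2 / 2)
        \<le> real (e * card S')"
      using cS unfolding S'(2) distrib_left of_nat_add by linarith
    \<comment> \<open>The share of the columns is diminished by the same factor, so that the factor
      can be pulled out of the sum.\<close>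
    moreover have "(1 - \<eta>) * (real k * \<alpha> * real w^2 / 2) \<le> 1 * (real k * \<alpha> * real w^2 / 2)"
      using \<eta> \<alpha> by (intro mult_right_mono) auto
    moreover have "(1 - \<eta>) * (real k * (real k - 1 + \<alpha>) / 2 * real w^2)
        = (1 - \<eta>) * (real k * (real k - 1) / 2 * real w^2) + (1 - \<eta>) * (real k * \<alpha> * real w^2 / 2)"
      by (simp add: field_simps)
    moreover have "1 * (real k * \<alpha> * real w^2 / 2) = real k * (\<alpha> * real w^2 / 2)"
      by simp
    ultimately have 1: "(1 - \<eta>) * (real k * (real k - 1 + \<alpha>) / 2 * real w^2) \<le> real (e * card S')"
      by argo
    have "((1 - \<eta>) * real (card V))^2 \<le> (real (k * w))^2"
      using w \<eta> by (intro power_mono) auto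
    then have "(1 - \<eta>) * ((real k - 1 + \<alpha>) / (2 * real k)) * ((1 - \<eta>) * real (card V))^2
        \<le> (1 - \<eta>) * ((real k - 1 + \<alpha>) / (2 * real k)) * (real (k * w))^2"
      using \<eta> \<alpha> k by (intro mult_left_mono) auto
    also have "\<dots> = (1 - \<eta>) * (real k * (real k - 1 + \<alpha>) / 2 * real w^2)"
      using k by (simp add: field_simps power2_eq_square)
    finally have 2: "(1 - \<eta>)^3 * ((real k - 1 + \<alpha>) / real k) * real (card V)^2 / 2
        \<le> (1 - \<eta>) * (real k * (real k - 1 + \<alpha>) / 2 * real w^2)"
      by (simp add: power_mult_distrib power3_eq_cube power2_eq_square mult_ac)
    show "\<exists>S. tiling \<G> V S \<and>
        (1 - \<eta>)^3 * ((real k - 1 + \<alpha>) / real k) * real (card V)^2 / 2 \<le> real (e * card S)"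
      using S'(1) 1 2 by (intro exI[of _ S'] conjI) linarith+
  qed
qed

text \<open>The map from \<alpha> to (k - 1 + \<alpha>) / k moves every \<alpha> < 1 closer to 1, so
  the supremum of the reachable densities cannot lie below 1. The supremum argument spares an
  explicit iteration with its thresholds.\<close>

lemma cross_tileable_imp_tileable:
  assumes \<G>: "\<And>F. F \<in> \<G> \<Longrightarrow> simple_graph F \<and> edges F \<noteq> {}"
    and k: "k \<ge> 2" and cross: "\<And>\<eta>. 0 < \<eta> \<Longrightarrow> \<eta> < 1 \<Longrightarrow> cross_tileable \<G> e k \<eta>"
    and "\<beta> < 1"
  shows "tileable \<G> e \<beta>"
proof -
  define A where "A = {\<alpha>. 0 \<le> \<alpha> \<and> \<alpha> \<le> 1 \<and> tileable \<G> e \<alpha>}"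
  have A0: "0 \<in> A" by (simp add: A_def tileable_0)
  have bdd: "bdd_above A" by (auto simp: A_def)
  have "Sup A \<ge> 1"
  proof (rule ccontr)
    assume s: "\<not> Sup A \<ge> 1"
    define s where "s = Sup A"
    have "s \<ge> 0" using cSup_upper[OF A0 bdd] by (simp add: s_def)
    have "s < 1" using s by (simp add: s_def)
    \<comment> \<open>As k \<ge> 2, a round at least halves the distance to 1: from below 5/4 (1 -
      s) to below 5/8 (1 - s). The loss is at most 3 \<eta> = 3/16 (1 - s), and 5/8 + 3/16 < 1, so
      the new density exceeds s.\<close>
    then have "s - (1 - s) / 4 < Sup A" by (simp add: s_def)
    then obtain \<alpha> where \<alpha>: "\<alpha> \<in> A" "s - (1 - s) / 4 < \<alpha>"
      using less_cSup_iff[of A] A0 bdd by blast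
    define \<eta> where "\<eta> = (1 - s) / 16"
    have \<eta>: "0 < \<eta>" "\<eta> < 1" using \<open>s < 1\<close> \<open>s \<ge> 0\<close> by (auto simp: \<eta>_def)
    define q where "q = (real k - 1 + \<alpha>) / real k"
    have q: "0 \<le> q" "q \<le> 1" using k \<alpha>(1) by (auto simp: A_def q_def field_simps)
    have "tileable \<G> e ((1 - \<eta>)^3 * q)"
      using tileable_step[OF \<G> k \<eta> _ cross[OF \<eta>]] \<alpha>(1) by (simp add: A_def q_def)
    moreover have "(1 - \<eta>)^3 * q \<le> 1" "0 \<le> (1 - \<eta>)^3 * q"
      using q \<eta> mult_le_one[of "(1 - \<eta>)^3" q] mult_nonneg_nonneg[of "(1 - \<eta>)^3" q]
      by (simp_all add: power_le_one)
    ultimately have "(1 - \<eta>)^3 * q \<in> A" by (simp add: A_def)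
    then have le: "(1 - \<eta>)^3 * q \<le> s"
      unfolding s_def using bdd by (rule cSup_upper)
    have "1 - 3 * \<eta> \<le> (1 - \<eta>)^3"
      using \<eta> by (simp add: power3_eq_cube algebra_simps)
    then have "(1 - 3 * \<eta>) * q \<le> (1 - \<eta>)^3 * q"
      using q(1) by (rule mult_right_mono)
    moreover have "3 * \<eta> * q \<le> 3 * \<eta>"
      using q(2) \<eta> mult_left_mono[of q 1 "3 * \<eta>"] by simp
    ultimately have "q - 3 * \<eta> \<le> s"
      using le by (simp add: algebra_simps)
    moreover have "q > s + 3 * (1 - s) / 8"
    proof -
      have "(s + 3 * (1 - s) / 8) * real k = s * real k + (1 - s) * (3 * real k / 8)"
        by (simp add: algebra_simps)
      also have "\<dots> \<le> s * real k + (1 - s) * (real k - 5 / 4)"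
        using k \<open>s < 1\<close> by (intro add_left_mono mult_left_mono) auto
      also have "\<dots> = real k + (5 * s - 5) / 4"
        by (simp add: field_simps)
      also have "\<dots> < real k - 1 + \<alpha>"
        using \<alpha>(2) by argo
      finally show ?thesis using k by (simp add: q_def less_divide_eq)
    qed
    ultimately show False
      using \<open>s < 1\<close> unfolding \<eta>_def by argo
  qed
  then obtain \<alpha> where "\<alpha> \<in> A" "\<beta> < \<alpha>"
    using less_cSup_iff[of A \<beta>] A0 bdd \<open>\<beta> < 1\<close> by fastforce
  then show ?thesis
    using tileable_mono[of \<G> e \<alpha> \<beta>] by (simp add: A_def)
qed

lemma plane_drawings_edges:
  assumes "simple_graph G" "num_edges G > 0" "F \<in> plane_drawings G"
  shows "simple_graph F \<and> edges F \<noteq> {}"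
proof -
  have "isomorphic G F" "simple_graph F"
    using assms(3) by (simp_all add: plane_drawings_def geometric_graph_def)
  then show ?thesis
    using num_edges_isomorphic[OF assms(1)] assms(2) by (force simp: num_edges_def)
qed

lemma mod_add_cancel_nat:
  fixes a b c w :: nat
  assumes "(a + b) mod w = (a + c) mod w" "b < w" "c < w"
  shows "b = c"
proof -
  have "[b = c] (mod w)"
    using assms(1) unfolding cong_def[symmetric] cong_add_lcancel_nat .
  then show ?thesis using assms(2,3) by (simp add: cong_def)
qed

section \<open>Triangles and four-cycles\<close>

lemma obtain_columns:
  assumes "finite V" "k * w \<le> card V"
  obtains v :: "nat \<Rightarrow> nat \<Rightarrow> 'b" where
    "\<And>i x. i < k \<Longrightarrow> x < w \<Longrightarrow> v i x \<in> V"
    "\<And>i x j y. i < k \<Longrightarrow> x < w \<Longrightarrow> j < k \<Longrightarrow> y < w \<Longrightarrow> v i x = v j y \<longleftrightarrow> i = j \<and> x = y"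
proof -
  obtain f where f: "bij_betw f {0..<card V} V"
    using ex_bij_betw_nat_finite[OF assms(1)] by blast
  have lt: "i * w + x < card V" if "i < k" "x < w" for i x
  proof -
    have "i * w + x < i * w + w" using that by simp
    also have "\<dots> \<le> k * w" using that mult_le_mono1[of "Suc i" k w] by simp
    finally show ?thesis using assms(2) by simp
  qed
  have dec: "i = j \<and> x = y" if "i * w + x = j * w + y" "x < w" "y < w" for i j x y
  proof -
    have "(i * w + x) div w = i \<and> (i * w + x) mod w = x" if "x < w" for i x
      using that by simp
    from this[OF that(2), of i] this[OF that(3), of j] that(1) show ?thesis by metis
  qed
  show ?thesis
  proof (rule that[of "\<lambda>i x. f (i * w + x)"])
    fix i x assume "i < k" "x < w"
    then show "f (i * w + x) \<in> V"
      using f lt by (auto simp: bij_betw_def)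
  next
    fix i x j y assume *: "i < k" "x < w" "j < k" "y < w"
    show "f (i * w + x) = f (j * w + y) \<longleftrightarrow> i = j \<and> x = y"
    proof
      assume "f (i * w + x) = f (j * w + y)"
      then have "i * w + x = j * w + y"
        using f lt[of i x] lt[of j y] * by (auto simp: bij_betw_def inj_on_def)
      then show "i = j \<and> x = y" using dec * by blast
    qed simp
  qed
qed

text \<open>The triangle with index \<open>(a, b)\<close> joins entries \<open>a\<close> and
  \<open>b\<close> of the first two columns to entry a + b modulo w of the third. In this Latin
  square any two entries determine the third, so all cross edges are used exactly once. Every
  triangle is plane, hence the columns may be arbitrary.\<close>

lemma tileable_triangles:
  assumes G: "simple_graph G" "isomorphic (cycle_graph 3) G" "num_edges G = 3" and "\<alpha> < 1"
  shows "tileable (plane_drawings G) 3 \<alpha>"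
proof (rule cross_tileable_imp_tileable[OF _ _ _ \<open>\<alpha> < 1\<close>])
  show "simple_graph F \<and> edges F \<noteq> {}" if "F \<in> plane_drawings G" for F
    using plane_drawings_edges[OF G(1) _ that] G(3) by simp
  show "(2::nat) \<le> 3" by simp
  fix \<eta> :: real assume \<eta>: "0 < \<eta>" "\<eta> < 1"
  \<comment> \<open>Rounding the column size down leaves out at most two points, which is then less
    than the fraction \<eta>.\<close>
  obtain n0 :: nat where n0: "3 / \<eta> < real n0"
    using reals_Archimedean2 by blast
  show "cross_tileable (plane_drawings G) 3 3 \<eta>"
    unfolding cross_tileable_def
  proof (intro exI[of _ n0] allI impI)
    fix V :: "point set" assume V: "finite V \<and> general_position V \<and> n0 \<le> card V"
    define w where "w = card V div 3"
    obtain v where vV: "\<And>i x. i < (3::nat) \<Longrightarrow> x < w \<Longrightarrow> v i x \<in> V"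
      and v: "\<And>i x j y. i < (3::nat) \<Longrightarrow> x < w \<Longrightarrow> j < 3 \<Longrightarrow> y < w \<Longrightarrow> v i x = v j y \<longleftrightarrow> i = j \<and> x = y"
      using obtain_columns[of V 3 w] V by (auto simp: w_def)
    define T where "T = (\<lambda>(a, b). triangle_graph (v 0 a) (v 1 b) (v 2 ((a + b) mod w)))"
    define I where "I = {..<w} \<times> {..<w}"
    have eT: "d \<in> edges (T (a, b)) \<longleftrightarrow> d = {v 0 a, v 1 b} \<or> d = {v 1 b, v 2 ((a + b) mod w)}
        \<or> d = {v 2 ((a + b) mod w), v 0 a}" for a b d
      by (simp add: T_def triangle_graph_def)
    have T: "tiling (plane_drawings G) V (T ` I) \<and> card (T ` I) = card I"
    proof (rule tilingI)
      show "finite I" by (simp add: I_def)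
      fix i assume "i \<in> I"
      then obtain a b where i: "i = (a, b)" "a < w" "b < w" by (auto simp: I_def)
      then have "(a + b) mod w < w" by simp
      then show "T i \<in> plane_drawings G" "verts (T i) \<subseteq> V"
        using triangle_in_plane_drawings[of V "v 0 a" "v 1 b" "v 2 ((a + b) mod w)" G] i vV v V G
        by (auto simp: T_def triangle_graph_def)
      show "edges (T i) \<noteq> {}"
        using eT i by blast
      fix j d assume "j \<in> I" and d: "d \<in> edges (T i)" "d \<in> edges (T j)"
      then obtain a' b' where j: "j = (a', b')" "a' < w" "b' < w" by (auto simp: I_def)
      then have "(a' + b') mod w < w" by simp
      have 1: "a = a' \<and> b = b'" if "(a + b) mod w = (a' + b') mod w" "a = a' \<or> b = b'"
        using that(2)
      proof
        assume "a = a'"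
        then show ?thesis
          using mod_add_cancel_nat[of a b w b'] that(1) i(3) j(3) by blast
      next
        assume "b = b'"
        then show ?thesis
          using mod_add_cancel_nat[of b a w a'] that(1) i(2) j(2) by (metis add.commute)
      qed
      obtain s s' where s: "s = (a + b) mod w" "s' = (a' + b') mod w" "s < w" "s' < w"
        using \<open>(a + b) mod w < w\<close> \<open>(a' + b') mod w < w\<close> by blast
      have "a = a' \<and> b = b' \<or> s = s' \<and> (a = a' \<or> b = b')"
        using d i(2,3) j(2,3) s(3,4) v unfolding i(1) j(1) eT s(1,2)[symmetric]
        by (auto simp: doubleton_eq_iff)
      then show "i = j"
        using 1 s(1,2) i(1) j(1) by auto
    qed
    define W where "W = (\<lambda>i. v i ` {..<w})"
    have "cross_tiling (plane_drawings G) 3 3 \<eta> V W w (T ` I)"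
      unfolding cross_tiling_def
    proof (intro conjI allI impI ballI)
      fix i :: nat assume "i < 3"
      then show "W i \<subseteq> V" "card (W i) = w"
        using vV v by (auto simp: W_def card_image inj_on_def)
      fix j :: nat assume "j < 3" "i \<noteq> j"
      then show "W i \<inter> W j = {}"
        using v \<open>i < 3\<close> by (auto simp: W_def)
    next
      fix F d i assume "F \<in> T ` I" "d \<in> edges F" and i: "i < (3::nat)"
      then obtain a b where ab: "a < w" "b < w" "d \<in> edges (T (a, b))"
        by (auto simp: I_def)
      then have "(a + b) mod w < w" by simp
      then obtain s where s: "s = (a + b) mod w" "s < w" by blast
      have "v j y \<in> W i \<longleftrightarrow> i = j" if "j < 3" "y < w" for j y
        using v i that by (auto simp: W_def)
      then show "\<not> d \<subseteq> W i"
        using ab s(2) unfolding eT s(1)[symmetric] by auto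
    next
      have "real (card V) \<le> real (3 * w) + 3"
        unfolding w_def by linarith
      moreover have "3 \<le> \<eta> * real (card V)"
      proof -
        have "3 < \<eta> * real n0" using n0 \<eta> by (simp add: divide_less_eq mult.commute)
        also have "\<dots> \<le> \<eta> * real (card V)" using V \<eta> by simp
        finally show ?thesis by simp
      qed
      ultimately show "(1 - \<eta>) * real (card V) \<le> real (3 * w)"
        by (simp add: algebra_simps)
      have "card (T ` I) = w * w"
        using conjunct2[OF T] by (simp add: I_def card_cartesian_product)
      then show "(1 - \<eta>) * (real 3 * (real 3 - 1) / 2 * real w^2) \<le> real (3 * card (T ` I))"
        using \<eta> by (simp add: power2_eq_square mult_left_le_one_le)
    qed (use T in auto)
    then show "\<exists>W w S. cross_tiling (plane_drawings G) 3 3 \<eta> V W w S" by blast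
  qed
qed

section \<open>Four-cycles from a longest matching\<close>

text \<open>Apply the triangle inequality through the common point. It is strict for
  \<open>p r\<close>, because the common point does not lie on that line.\<close>

lemma open_segments_meet_dist:
  fixes p q r s :: point
  assumes "crossing {p, q} {r, s}" "orient p r s \<noteq> 0"
  shows "dist p r + dist q s < dist p q + dist r s"
proof -
  have "\<exists>z. z \<in> open_segment p q \<and> z \<in> open_segment r s"
    using assms(1) unfolding crossing_iff .
  then obtain z where z: "z \<in> open_segment p q" "z \<in> open_segment r s"
    by (elim exE conjE)
  then have b: "between (p, q) z" "between (r, s) z"
    by (auto simp: between_mem_segment open_segment_def)
  then have "dist p q = dist p z + dist z q" "dist r s = dist r z + dist z s"
    by (simp_all add: between)
  moreover have "dist q s \<le> dist z q + dist z s"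
    using dist_triangle[of q s z] by (simp add: dist_commute)
  moreover have "dist p r < dist p z + dist r z"
  proof (rule ccontr)
    assume "\<not> dist p r < dist p z + dist r z"
    then have "dist p r = dist p z + dist z r"
      using dist_triangle[of p r z] by (simp add: dist_commute)
    then have "between (p, r) z" by (simp add: between)
    then have "orient p r z = 0"
      using between_imp_collinear[of p r z] collinear_iff_orient[of p r z] by (simp add: insert_commute)
    moreover obtain t where "t < 1" "0 < t" "orient p r z = (1 - t) * orient p r r + t * orient p r s"
      using open_segment_orient[OF z(2)] by metis
    ultimately show False using assms(2) by simp
  qed
  ultimately show ?thesis by linarith
qed

text \<open>Two crossing connecting edges would be the diagonals of a quadrilateral with the two
  matching edges as opposite sides. Diagonals are longer in total, so exchanging them for the
  matching edges would lengthen a longest matching.\<close>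

lemma exists_matching_without_parallel_edges:
  fixes V :: "point set"
  assumes V: "finite V" "general_position V" and m: "2 * m \<le> card V"
  obtains p q :: "nat \<Rightarrow> point" where
    "inj_on p {..<m}" "inj_on q {..<m}" "p ` {..<m} \<subseteq> V" "q ` {..<m} \<subseteq> V" "p ` {..<m} \<inter> q ` {..<m} = {}"
    "\<And>i j. i < m \<Longrightarrow> j < m \<Longrightarrow> i \<noteq> j \<Longrightarrow> \<not> crossing {p i, p j} {q i, q j}"
    "\<And>i j. i < m \<Longrightarrow> j < m \<Longrightarrow> i \<noteq> j \<Longrightarrow> \<not> crossing {p j, q i} {q j, p i}"
proof -
  \<comment> \<open>A list of 2 m distinct points encodes the matching of the entries at positions 2
    i and 2 i + 1, so rematching four points is an exchange of two list entries.\<close>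
  define A where "A = {xs. distinct xs \<and> set xs \<subseteq> V \<and> length xs = 2 * m}"
  define len where "len = (\<lambda>xs::point list. \<Sum>i<m. dist (xs ! (2 * i)) (xs ! (2 * i + 1)))"
  have "finite A"
    using finite_lists_length_eq[OF V(1), of "2 * m"]
    by (rule rev_finite_subset) (auto simp: A_def)
  moreover have "A \<noteq> {}"
  proof -
    obtain ys where "set ys = V" "distinct ys"
      using finite_distinct_list[OF V(1)] by blast
    then have "take (2 * m) ys \<in> A"
      using m set_take_subset[of "2 * m" ys] by (auto simp: A_def distinct_card)
    then show ?thesis by blast
  qed
  ultimately obtain xs where xs: "xs \<in> A" and max: "\<And>ys. ys \<in> A \<Longrightarrow> len ys \<le> len xs"
    using Max_in[of "len ` A"] Max_ge[of "len ` A"] by (metis (no_types, lifting) finite_imageI image_iff image_is_empty)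
  define p q where "p = (\<lambda>i. xs ! (2 * i))" and "q = (\<lambda>i. xs ! (2 * i + 1))"
  have d: "distinct xs" and l: "length xs = 2 * m" and sV: "set xs \<subseteq> V"
    using xs by (auto simp: A_def)
  have pq: "p i \<in> V" "q i \<in> V" if "i < m" for i
    using that l sV by (auto simp: p_def q_def intro!: subsetD[OF sV] nth_mem)
  have pq_eq: "p i = p j \<longleftrightarrow> i = j" "q i = q j \<longleftrightarrow> i = j" "p i \<noteq> q j" if "i < m" "j < m" for i j
  proof -
    have "2 * i \<noteq> Suc (2 * j)" by presburger
    then show "p i = p j \<longleftrightarrow> i = j" "q i = q j \<longleftrightarrow> i = j" "p i \<noteq> q j"
      using that l d by (auto simp: p_def q_def nth_eq_iff_index_eq)
  qed
  have swap: "dist (p i) (q j) + dist (p j) (q i) \<le> dist (p i) (q i) + dist (p j) (q j)"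
     "dist (p i) (p j) + dist (q i) (q j) \<le> dist (p i) (q i) + dist (p j) (q j)"
    if ij: "i < m" "j < m" "i \<noteq> j" for i j
  proof -
    have len_split: "len ys = dist (ys ! (2*i)) (ys ! (2*i+1)) + dist (ys ! (2*j)) (ys ! (2*j+1))
        + (\<Sum>k\<in>{..<m} - {i, j}. dist (ys ! (2*k)) (ys ! (2*k+1)))" for ys
    proof -
      have "{..<m} - {i, j} = {..<m} - {i} - {j}" by blast
      then show ?thesis
        unfolding len_def using ij
        by (simp add: sum.remove[of "{..<m}" i] sum.remove[of "{..<m} - {i}" j])
    qed
    have *: "dist (ys ! (2*i)) (ys ! (2*i+1)) + dist (ys ! (2*j)) (ys ! (2*j+1))
        \<le> dist (p i) (q i) + dist (p j) (q j)"
      if ys: "ys = xs[a := xs ! b, b := xs ! a]" "a < 2 * m" "b < 2 * m" "a \<noteq> b"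
        "a \<in> {2*i, 2*i+1, 2*j, 2*j+1}" "b \<in> {2*i, 2*i+1, 2*j, 2*j+1}" for ys a b
    proof -
      have "ys \<in> A"
        using ys(1-3) xs l by (simp add: A_def distinct_swap set_swap)
      then have "len ys \<le> len xs" by (rule max)
      moreover have "ys ! (2*k) = xs ! (2*k)" "ys ! (2*k+1) = xs ! (2*k+1)" if "k \<noteq> i" "k \<noteq> j" for k
      proof -
        have "2*k \<notin> {2*i, 2*i+1, 2*j, 2*j+1}" "2*k+1 \<notin> {2*i, 2*i+1, 2*j, 2*j+1}"
          using that by (auto; presburger)+
        then show "ys ! (2*k) = xs ! (2*k)" "ys ! (2*k+1) = xs ! (2*k+1)"
          using ys(1,5,6) by (metis nth_list_update_neq)+
      qed
      then have "(\<Sum>k\<in>{..<m} - {i, j}. dist (ys ! (2*k)) (ys ! (2*k+1))) =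
          (\<Sum>k\<in>{..<m} - {i, j}. dist (xs ! (2*k)) (xs ! (2*k+1)))"
        by (intro sum.cong) auto
      ultimately show ?thesis
        unfolding len_split[of ys] len_split[of xs] by (simp add: p_def q_def)
    qed
    \<comment> \<open>Exchanging \<open>q i\<close> with \<open>q j\<close> gives the first
      alternative matching, exchanging \<open>q i\<close> with \<open>p j\<close> the
      second.\<close>
    have ne: "2*i+1 \<noteq> 2*j" "2*j+1 \<noteq> 2*i" by presburger+
    show "dist (p i) (q j) + dist (p j) (q i) \<le> dist (p i) (q i) + dist (p j) (q j)"
      using *[of _ "2*i+1" "2*j+1", OF refl] ij l ne by (simp add: p_def q_def)
    show "dist (p i) (p j) + dist (q i) (q j) \<le> dist (p i) (q i) + dist (p j) (q j)"
      using *[of _ "2*i+1" "2*j", OF refl] ij l ne by (simp add: p_def q_def)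
  qed
  have or: "orient x y z \<noteq> 0" if "x \<in> V" "y \<in> V" "z \<in> V" "x \<noteq> y" "x \<noteq> z" "y \<noteq> z" for x y z
    using general_position_orient[OF V(2)] that by blast
  show ?thesis
  proof (rule that[of p q])
    show "inj_on p {..<m}" "inj_on q {..<m}"
      using pq_eq by (auto simp: inj_on_def)
    show "p ` {..<m} \<subseteq> V" "q ` {..<m} \<subseteq> V" "p ` {..<m} \<inter> q ` {..<m} = {}"
      using pq pq_eq by auto
    fix i j assume ij: "i < m" "j < m" "i \<noteq> j"
    show "\<not> crossing {p i, p j} {q i, q j}"
    proof
      assume "crossing {p i, p j} {q i, q j}"
      then have "dist (p i) (q i) + dist (p j) (q j) < dist (p i) (p j) + dist (q i) (q j)"
        using open_segments_meet_dist or pq pq_eq ij by metis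
      then show False using swap(2)[OF ij] by simp
    qed
    show "\<not> crossing {p j, q i} {q j, p i}"
    proof
      assume "crossing {p j, q i} {q j, p i}"
      then have "dist (p j) (q j) + dist (q i) (p i) < dist (p j) (q i) + dist (q j) (p i)"
        using open_segments_meet_dist or pq pq_eq ij by metis
      then show False using swap(1)[OF ij] by (simp add: dist_commute)
    qed
  qed
qed

text \<open>The matching edges are the diagonals of the four-cycles, so different pairs of matching
  edges yield disjoint cycles. Only the matching itself and the edges at a possible unmatched point
  are lost, which is linear in the number of points.\<close>

lemma tileable_four_cycles:
  assumes G: "simple_graph G" "isomorphic (cycle_graph 4) G" and "\<alpha> < 1"
  shows "tileable (plane_drawings G) 4 \<alpha>"
proof -
  define \<beta> where "\<beta> = max \<alpha> 0"
  have \<beta>: "0 \<le> \<beta>" "\<beta> < 1" using assms(3) by (auto simp: \<beta>_def)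
  \<comment> \<open>Then n (1 - \<beta>) > 4, so \<beta> n^2 \<le> n (n - 4) \<le> (n - 1) (n - 3),
    and with n \<le> 2 m + 1 this is at most 8 times \<open>m choose 2\<close>.\<close>
  obtain n0 :: nat where n0: "4 / (1 - \<beta>) < real n0"
    using reals_Archimedean2 by blast
  have "tileable (plane_drawings G) 4 \<beta>"
    unfolding tileable_def
  proof (intro exI[of _ n0] allI impI)
    fix V :: "point set" assume V: "finite V \<and> general_position V \<and> n0 \<le> card V"
    define n m where "n = card V" and "m = n div 2"
    obtain p q where pq: "inj_on p {..<m}" "inj_on q {..<m}" "p ` {..<m} \<subseteq> V" "q ` {..<m} \<subseteq> V"
      "p ` {..<m} \<inter> q ` {..<m} = {}"
      and nc: "\<And>i j. i < m \<Longrightarrow> j < m \<Longrightarrow> i \<noteq> j \<Longrightarrow> \<not> crossing {p i, p j} {q i, q j}"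
        "\<And>i j. i < m \<Longrightarrow> j < m \<Longrightarrow> i \<noteq> j \<Longrightarrow> \<not> crossing {p j, q i} {q j, p i}"
      using exists_matching_without_parallel_edges[of V m] V by (auto simp: m_def n_def)
    define T where "T = (\<lambda>(i, j). four_cycle (p i) (p j) (q i) (q j))"
    define I where "I = {(i, j). i < j \<and> j < m}"
    have fin: "finite I"
      by (rule finite_subset[of _ "{..<m} \<times> {..<m}"]) (auto simp: I_def)
    have eq: "p i = p j \<longleftrightarrow> i = j" "q i = q j \<longleftrightarrow> i = j" "p i \<noteq> q j" "q i \<noteq> p j" if "i < m" "j < m" for i j
      using pq that by (auto simp: inj_on_def)
    have T: "tiling (plane_drawings G) V (T ` I) \<and> card (T ` I) = card I"
    proof (rule tilingI)
      show "finite I" by (rule fin)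
      fix x assume "x \<in> I"
      then obtain i j where x: "x = (i, j)" "i < j" "j < m" by (auto simp: I_def)
      then have im: "i < m" by simp
      have inV: "{p i, p j, q i, q j} \<subseteq> V"
        using pq(3,4) x im by auto
      show "T x \<in> plane_drawings G"
        unfolding x T_def prod.case
        using V inV nc[OF im \<open>j < m\<close>] G(2) eq im x
        by (intro four_cycle_in_plane_drawings[of V]) auto
      show "verts (T x) \<subseteq> V" "edges (T x) \<noteq> {}"
        using inV by (auto simp: T_def four_cycle_def x)
      fix y d assume "y \<in> I" and d: "d \<in> edges (T x)" "d \<in> edges (T y)"
      then obtain i' j' where y: "y = (i', j')" "i' < j'" "j' < m" by (auto simp: I_def)
      then have "i' < m" by simp
      then show "x = y"
        using d x im y eq by (auto simp: T_def four_cycle_def doubleton_eq_iff)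
    qed
    have "card I = m choose 2"
    proof -
      have "I = (\<lambda>e. (Min e, Max e)) ` nsets {..<m} 2"
        by (auto simp: I_def nsets_2_eq image_iff split: if_splits) (force simp: min_def max_def)+
      moreover have "inj_on (\<lambda>e. (Min e, Max e)) (nsets {..<m} 2)"
        by (auto simp: inj_on_def nsets_2_eq min_def max_def split: if_splits)
      ultimately show ?thesis
        by (simp add: card_image card_nsets)
    qed
    have "\<beta> * real n^2 / 2 \<le> real (4 * card (T ` I))"
    proof -
      have "real n \<le> 2 * real m + 1"
        unfolding m_def by linarith
      have "4 < real n * (1 - \<beta>)"
      proof -
        have "4 < real n0 * (1 - \<beta>)" using n0 \<beta> by (simp add: divide_less_eq)
        also have "\<dots> \<le> real n * (1 - \<beta>)" using V \<beta> by (simp add: n_def)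
        finally show ?thesis .
      qed
      then have "4 * real n \<le> real n * (1 - \<beta>) * real n"
        by (intro mult_right_mono) auto
      then have "\<beta> * real n^2 \<le> real n * (real n - 4)"
        by (simp add: power2_eq_square algebra_simps)
      also have "\<dots> \<le> (real n - 1) * (real n - 3)"
        by (simp add: algebra_simps)
      also have "\<dots> \<le> (2 * real m) * (2 * real m - 2)"
      proof (cases "n \<ge> 3")
        case True
        then show ?thesis using \<open>real n \<le> 2 * real m + 1\<close> by (intro mult_mono) auto
      next
        case False
        then have "real n * (1 - \<beta>) \<le> 2 * 1" using \<beta> by (intro mult_mono) auto
        then show ?thesis using \<open>4 < real n * (1 - \<beta>)\<close> by simp
      qed
      also have "\<dots> = 8 * real (m choose 2)"
        by (cases m) (simp_all add: choose_two field_char_0_class.of_nat_div mod_eq_0_iff_dvd algebra_simps)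
      finally show ?thesis
        using conjunct2[OF T] \<open>card I = m choose 2\<close> by simp
    qed
    then show "\<exists>S. tiling (plane_drawings G) V S \<and> \<beta> * real (card V)^2 / 2 \<le> real (4 * card S)"
      using conjunct1[OF T] by (auto simp: n_def)
  qed
  then show ?thesis
    using tileable_mono[of _ 4 \<beta> \<alpha>] by (simp add: \<beta>_def)
qed

section \<open>Six points in general position\<close>

definition separates :: "point \<Rightarrow> point \<Rightarrow> point \<Rightarrow> point \<Rightarrow> bool" where
  "separates p q a b \<longleftrightarrow> orient p q a * orient p q b < 0"

text \<open>Each matching edge can be the chord of a plane \<open>theta\<close> whose other two
  vertices are the ends of the next matching edge.\<close>

definition cyclic_matching :: "point list \<Rightarrow> bool" where
  "cyclic_matching ps \<longleftrightarrow> separates (ps!0) (ps!1) (ps!2) (ps!3) \<and>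
     separates (ps!2) (ps!3) (ps!4) (ps!5) \<and> separates (ps!4) (ps!5) (ps!0) (ps!1)"

text \<open>
  These separations hold in a convex pentagon \<open>ps!0, \<dots>, ps!4\<close> with a point \<open>ps!5\<close> inside the
  pentagon bounded by its diagonals. It is the only order type of six points that does not contain a
  cyclic matching.
\<close>

definition centred_pentagon :: "point list \<Rightarrow> bool" where
  "centred_pentagon ps \<longleftrightarrow> separates (ps!0) (ps!2) (ps!1) (ps!4) \<and>
     separates (ps!0) (ps!5) (ps!2) (ps!3) \<and>
     separates (ps!1) (ps!3) (ps!2) (ps!4) \<and>
     separates (ps!1) (ps!4) (ps!0) (ps!5) \<and>
     separates (ps!2) (ps!4) (ps!3) (ps!5) \<and>
     separates (ps!3) (ps!5) (ps!0) (ps!1)"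

lemma sign_of_convex_combination:
  fixes x y z :: real
  assumes "a * x = b * y + c * z" "0 < a" "0 < b" "0 < c" "x \<noteq> 0" "y \<noteq> 0" "z \<noteq> 0"
  shows "\<not> ((0 < y \<longleftrightarrow> 0 < z) \<and> (0 < x \<longleftrightarrow> \<not> 0 < y))"
proof
  assume "(0 < y \<longleftrightarrow> 0 < z) \<and> (0 < x \<longleftrightarrow> \<not> 0 < y)"
  then consider "0 < y" "0 < z" "x < 0" | "y < 0" "z < 0" "0 < x"
    using assms by linarith
  then show False
  proof cases
    case 1
    then show False
      using mult_pos_neg[of a x] mult_pos_pos[of b y] mult_pos_pos[of c z] assms(1-4) by linarith
  next
    case 2
    then show False
      using mult_pos_pos[of a x] mult_pos_neg[of b y] mult_pos_neg[of c z] assms(1-4) by linarith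
  qed
qed

text \<open>Three-term Grassmann-Pluecker relations of the five points with pivots \<open>j\<close>,
  \<open>m\<close>, \<open>k\<close> and \<open>l\<close>. The other points appear from
  \<open>o'\<close> in the angular order \<open>j\<close>, \<open>k\<close>, \<open>l\<close>,
  \<open>m\<close>, so all coefficients are positive and the relations restrict signs.\<close>

lemma orient_signs_around_point:
  assumes pos: "0 < orient o' j k" "0 < orient o' j l" "0 < orient o' j m" "0 < orient o' k l"
      "0 < orient o' k m" "0 < orient o' l m"
    and ne: "orient j k l \<noteq> 0" "orient j k m \<noteq> 0" "orient j l m \<noteq> 0" "orient k l m \<noteq> 0"
  shows "\<not> ((0 < orient j k l \<longleftrightarrow> 0 < orient j l m) \<and> (0 < orient j k m \<longleftrightarrow> \<not> 0 < orient j k l))"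
    "\<not> ((0 < orient j k m \<longleftrightarrow> 0 < orient k l m) \<and> (0 < orient j l m \<longleftrightarrow> \<not> 0 < orient j k m))"
    "\<not> ((0 < orient j k l \<longleftrightarrow> 0 < orient k l m) \<and> (0 < orient j k m \<longleftrightarrow> \<not> 0 < orient j k l))"
    "\<not> ((0 < orient j k l \<longleftrightarrow> 0 < orient k l m) \<and> (0 < orient j l m \<longleftrightarrow> \<not> 0 < orient j k l))"
proof -
  have "orient o' j l * orient j k m = orient o' j m * orient j k l + orient o' j k * orient j l m"
    "orient o' k m * orient j l m = orient o' l m * orient j k m + orient o' j m * orient k l m"
    "orient o' k l * orient j k m = orient o' k m * orient j k l + orient o' j k * orient k l m"
    "orient o' k l * orient j l m = orient o' l m * orient j k l + orient o' j l * orient k l m"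
    by (simp_all add: orient_def algebra_simps)
  from this[THEN sign_of_convex_combination] show
    "\<not> ((0 < orient j k l \<longleftrightarrow> 0 < orient j l m) \<and> (0 < orient j k m \<longleftrightarrow> \<not> 0 < orient j k l))"
    "\<not> ((0 < orient j k m \<longleftrightarrow> 0 < orient k l m) \<and> (0 < orient j l m \<longleftrightarrow> \<not> 0 < orient j k m))"
    "\<not> ((0 < orient j k l \<longleftrightarrow> 0 < orient k l m) \<and> (0 < orient j k m \<longleftrightarrow> \<not> 0 < orient j k l))"
    "\<not> ((0 < orient j k l \<longleftrightarrow> 0 < orient k l m) \<and> (0 < orient j l m \<longleftrightarrow> \<not> 0 < orient j k l))"
    using pos ne by blast+
qed

lemma separates_iff:
  assumes "orient p q a \<noteq> 0" "orient p q b \<noteq> 0"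
  shows "separates p q a b \<longleftrightarrow> (0 < orient p q a \<longleftrightarrow> \<not> 0 < orient p q b)"
  using assms by (auto simp: separates_def mult_less_0_iff)

text \<open>Orientations involving \<open>p0\<close> are positive, so the configuration is described
  by the ten signs among the other five points, subject to the relations above. The alternatives
  cover all sign patterns that survive; in the pentagon the inner point is \<open>p3\<close>, listed
  last.\<close>

lemma six_sorted_points:
  assumes pos: "0 < orient p0 p1 p2" "0 < orient p0 p1 p3" "0 < orient p0 p1 p4" "0 < orient p0 p1 p5" "0 < orient p0 p2 p3" "0 < orient p0 p2 p4" "0 < orient p0 p2 p5" "0 < orient p0 p3 p4" "0 < orient p0 p3 p5" "0 < orient p0 p4 p5"
    and ne: "orient p1 p2 p3 \<noteq> 0" "orient p1 p2 p4 \<noteq> 0" "orient p1 p2 p5 \<noteq> 0" "orient p1 p3 p4 \<noteq> 0" "orient p1 p3 p5 \<noteq> 0" "orient p1 p4 p5 \<noteq> 0" "orient p2 p3 p4 \<noteq> 0" "orient p2 p3 p5 \<noteq> 0" "orient p2 p4 p5 \<noteq> 0" "orient p3 p4 p5 \<noteq> 0"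
  shows "cyclic_matching [p0, p3, p2, p4, p1, p5] \<or>
    cyclic_matching [p0, p3, p1, p4, p2, p5] \<or>
    cyclic_matching [p0, p2, p1, p4, p3, p5] \<or>
    cyclic_matching [p0, p2, p1, p3, p4, p5] \<or>
    cyclic_matching [p0, p2, p1, p5, p3, p4] \<or>
    centred_pentagon [p0, p1, p2, p4, p5, p3] \<or>
    cyclic_matching [p0, p3, p1, p5, p2, p4]"
proof -
  \<comment> \<open>Every triple that occurs is brought into increasing order, so that only the ten
    sign variables remain.\<close>
  have eqs: "orient p0 p2 p1 = - orient p0 p1 p2"
    "orient p0 p3 p1 = - orient p0 p1 p3"
    "orient p0 p3 p2 = - orient p0 p2 p3"
    "orient p1 p4 p2 = - orient p1 p2 p4"
    "orient p1 p4 p3 = - orient p1 p3 p4"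
    "orient p1 p5 p0 = orient p0 p1 p5"
    "orient p1 p5 p2 = - orient p1 p2 p5"
    "orient p1 p5 p3 = - orient p1 p3 p5"
    "orient p1 p5 p4 = - orient p1 p4 p5"
    "orient p2 p4 p0 = orient p0 p2 p4"
    "orient p2 p4 p1 = orient p1 p2 p4"
    "orient p2 p4 p3 = - orient p2 p3 p4"
    "orient p2 p5 p0 = orient p0 p2 p5"
    "orient p2 p5 p3 = - orient p2 p3 p5"
    "orient p2 p5 p4 = - orient p2 p4 p5"
    "orient p3 p4 p0 = orient p0 p3 p4"
    "orient p3 p4 p2 = orient p2 p3 p4"
    "orient p3 p5 p0 = orient p0 p3 p5"
    "orient p3 p5 p2 = orient p2 p3 p5"
    "orient p4 p3 p0 = - orient p0 p3 p4"
    "orient p4 p3 p1 = - orient p1 p3 p4"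
    "orient p4 p5 p0 = orient p0 p4 p5"
    "orient p4 p5 p2 = orient p2 p4 p5"
    by (simp_all add: orient_def algebra_simps)
  have nz: "orient p0 p1 p2 \<noteq> 0" "orient p0 p1 p3 \<noteq> 0" "orient p0 p1 p4 \<noteq> 0" "orient p0 p1 p5 \<noteq> 0" "orient p0 p2 p3 \<noteq> 0" "orient p0 p2 p4 \<noteq> 0" "orient p0 p2 p5 \<noteq> 0" "orient p0 p3 p4 \<noteq> 0" "orient p0 p3 p5 \<noteq> 0" "orient p0 p4 p5 \<noteq> 0"
    using pos by auto
  have neg: "x < 0 \<longleftrightarrow> \<not> 0 < x" if "x \<noteq> 0" for x :: real
    using that by auto
  have seps: "separates p0 p3 p2 p4 \<longleftrightarrow> ((False) \<longleftrightarrow> \<not> (True))"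
    "separates p2 p4 p1 p5 \<longleftrightarrow> ((0 < orient p1 p2 p4) \<longleftrightarrow> \<not> (0 < orient p2 p4 p5))"
    "separates p1 p5 p0 p3 \<longleftrightarrow> ((True) \<longleftrightarrow> \<not> (\<not> 0 < orient p1 p3 p5))"
    "separates p0 p3 p1 p4 \<longleftrightarrow> ((False) \<longleftrightarrow> \<not> (True))"
    "separates p1 p4 p2 p5 \<longleftrightarrow> ((\<not> 0 < orient p1 p2 p4) \<longleftrightarrow> \<not> (0 < orient p1 p4 p5))"
    "separates p2 p5 p0 p3 \<longleftrightarrow> ((True) \<longleftrightarrow> \<not> (\<not> 0 < orient p2 p3 p5))"
    "separates p0 p2 p1 p4 \<longleftrightarrow> ((False) \<longleftrightarrow> \<not> (True))"
    "separates p1 p4 p3 p5 \<longleftrightarrow> ((\<not> 0 < orient p1 p3 p4) \<longleftrightarrow> \<not> (0 < orient p1 p4 p5))"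
    "separates p3 p5 p0 p2 \<longleftrightarrow> ((True) \<longleftrightarrow> \<not> (0 < orient p2 p3 p5))"
    "separates p0 p2 p1 p3 \<longleftrightarrow> ((False) \<longleftrightarrow> \<not> (True))"
    "separates p1 p3 p4 p5 \<longleftrightarrow> ((0 < orient p1 p3 p4) \<longleftrightarrow> \<not> (0 < orient p1 p3 p5))"
    "separates p4 p5 p0 p2 \<longleftrightarrow> ((True) \<longleftrightarrow> \<not> (0 < orient p2 p4 p5))"
    "separates p0 p2 p1 p5 \<longleftrightarrow> ((False) \<longleftrightarrow> \<not> (True))"
    "separates p1 p5 p3 p4 \<longleftrightarrow> ((\<not> 0 < orient p1 p3 p5) \<longleftrightarrow> \<not> (\<not> 0 < orient p1 p4 p5))"
    "separates p3 p4 p0 p2 \<longleftrightarrow> ((True) \<longleftrightarrow> \<not> (0 < orient p2 p3 p4))"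
    "separates p2 p5 p4 p3 \<longleftrightarrow> ((\<not> 0 < orient p2 p4 p5) \<longleftrightarrow> \<not> (\<not> 0 < orient p2 p3 p5))"
    "separates p4 p3 p0 p1 \<longleftrightarrow> ((False) \<longleftrightarrow> \<not> (\<not> 0 < orient p1 p3 p4))"
    "separates p0 p3 p1 p5 \<longleftrightarrow> ((False) \<longleftrightarrow> \<not> (True))"
    "separates p1 p5 p2 p4 \<longleftrightarrow> ((\<not> 0 < orient p1 p2 p5) \<longleftrightarrow> \<not> (\<not> 0 < orient p1 p4 p5))"
    "separates p2 p4 p0 p3 \<longleftrightarrow> ((True) \<longleftrightarrow> \<not> (\<not> 0 < orient p2 p3 p4))"
    using pos by (simp_all add: separates_iff eqs neg ne nz)
  have nth: "[a, b, c, d, e, f] ! 0 = a" "[a, b, c, d, e, f] ! 1 = b" "[a, b, c, d, e, f] ! 2 = c"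
    "[a, b, c, d, e, f] ! 3 = d" "[a, b, c, d, e, f] ! 4 = e" "[a, b, c, d, e, f] ! 5 = f"
    for a b c d e f :: point
    by simp_all
  show ?thesis
    unfolding cyclic_matching_def centred_pentagon_def nth seps
    \<comment> \<open>One instance for each four of the points \<open>p1\<close>, ...,
      \<open>p5\<close>; what is left is propositional in the ten signs.\<close>
    using orient_signs_around_point[OF pos(1,2,3,5,6,8) ne(1,2,4,7)]
      orient_signs_around_point[OF pos(1,2,4,5,7,9) ne(1,3,5,8)]
      orient_signs_around_point[OF pos(1,3,4,6,7,10) ne(2,3,6,9)]
      orient_signs_around_point[OF pos(2,3,4,8,9,10) ne(4,5,6,10)]
      orient_signs_around_point[OF pos(5,6,7,8,9,10) ne(7,8,9,10)]
    by argo
qed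

section \<open>Sorting points around an extreme point\<close>

text \<open>Two points with the same sheared coordinate determine \<open>u\<close>, so only finitely
  many values are excluded.\<close>

lemma exists_shear_injective:
  fixes V :: "point set"
  assumes "finite V"
  obtains u where "inj_on (\<lambda>p. p$1 + u * p$2) V"
proof -
  define B where "B = (\<lambda>(p, q). - (p$1 - q$1) / (p$2 - q$2)) ` (V \<times> V)"
  have "finite B" using assms by (simp add: B_def)
  then obtain u where u: "u \<notin> B"
    using ex_new_if_finite infinite_UNIV_char_0 by blast
  have "p = q" if pq: "p \<in> V" "q \<in> V" "p$1 + u * p$2 = q$1 + u * q$2" for p q
  proof (rule ccontr)
    assume "p \<noteq> q"
    then have "p$2 \<noteq> q$2"
      using pq(3) by (auto simp: vec_eq_iff forall_2)
    moreover have "u * (p$2 - q$2) = - (p$1 - q$1)"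
      using pq(3) by (simp add: algebra_simps)
    ultimately have "u = - (p$1 - q$1) / (p$2 - q$2)"
      by (metis eq_divide_eq right_minus_eq)
    then have "u \<in> B"
      using pq(1,2) by (force simp: B_def)
    then show False using u by simp
  qed
  then show ?thesis
    using that[of u] by (auto simp: inj_on_def)
qed

text \<open>A generic linear functional has a unique minimiser, the first point. The others lie in
  an open half-plane bounded by a line through it, where the order by slope is the counterclockwise
  order.\<close>

lemma exists_radial_ordering:
  assumes V: "finite V" "general_position V" "V \<noteq> {}"
  obtains ps where "distinct ps" "set ps = V"
    "\<And>i j. 0 < i \<Longrightarrow> i < j \<Longrightarrow> j < length ps \<Longrightarrow> 0 < orient (ps!0) (ps!i) (ps!j)"
proof -
  obtain u where u: "inj_on (\<lambda>p. p$1 + u * p$2) V"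
    using exists_shear_injective[OF V(1)] .
  define X where "X = (\<lambda>p::point. p$1 + u * p$2)"
  obtain p0 where p0: "p0 \<in> V" "\<And>q. q \<in> V \<Longrightarrow> X p0 \<le> X q"
    using arg_min_if_finite[OF V(1,3), of X] by (metis not_le)
  have lt: "X p0 < X q" if "q \<in> V" "q \<noteq> p0" for q
    using p0 that u inj_onD[OF u, of p0 q] by (fastforce simp: X_def less_le)
  define sl where "sl = (\<lambda>q::point. (q$2 - p0$2) / (X q - X p0))"
  obtain ys where ys: "set ys = V - {p0}" "distinct ys"
    using finite_distinct_list[of "V - {p0}"] V(1) by blast
  define zs where "zs = sort_key sl ys"
  have zs: "set zs = V - {p0}" "distinct zs" "sorted (map sl zs)"
    using ys by (simp_all add: zs_def)
  show ?thesis
  proof (rule that[of "p0 # zs"])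
    show "distinct (p0 # zs)" "set (p0 # zs) = V"
      using zs p0 by auto
    fix i j :: nat assume ij: "0 < i" "i < j" "j < length (p0 # zs)"
    define a b where "a = (p0 # zs) ! i" and "b = (p0 # zs) ! j"
    have ab: "a = zs ! (i - 1)" "b = zs ! (j - 1)"
      using ij by (simp_all add: a_def b_def nth_Cons')
    have "a \<in> V - {p0}" "b \<in> V - {p0}"
      unfolding ab zs(1)[symmetric] using ij by (auto intro!: nth_mem)
    moreover have "a \<noteq> b"
      using ij zs(2) by (auto simp: ab nth_eq_iff_index_eq)
    ultimately have ne: "orient p0 a b \<noteq> 0"
      using general_position_orient[OF V(2) p0(1)] by auto
    have "sl a \<le> sl b"
      using sorted_nth_mono[OF zs(3), of "i - 1" "j - 1"] ij by (simp add: ab)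
    moreover have "0 < X a - X p0" "0 < X b - X p0"
      using lt \<open>a \<in> V - {p0}\<close> \<open>b \<in> V - {p0}\<close> by auto
    ultimately have "(a$2 - p0$2) * (X b - X p0) \<le> (b$2 - p0$2) * (X a - X p0)"
      by (simp add: sl_def divide_simps mult.commute)
    moreover have "orient p0 a b = (b$2 - p0$2) * (X a - X p0) - (a$2 - p0$2) * (X b - X p0)"
      by (simp add: orient_def X_def algebra_simps)
    ultimately show "0 < orient ((p0 # zs) ! 0) ((p0 # zs) ! i) ((p0 # zs) ! j)"
      using ne by (simp add: a_def b_def)
  qed
qed

lemma six_points:
  assumes V: "finite V" "general_position V" "card V = 6"
  obtains ps where "distinct ps" "set ps = V" "length ps = 6" "cyclic_matching ps \<or> centred_pentagon ps"
proof -
  obtain qs where qs: "distinct qs" "set qs = V"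
    "\<And>i j. 0 < i \<Longrightarrow> i < j \<Longrightarrow> j < length qs \<Longrightarrow> 0 < orient (qs!0) (qs!i) (qs!j)"
    using exists_radial_ordering[OF V(1,2)] V(3) by (metis card.empty zero_neq_numeral)
  have len: "length qs = 6"
    using qs(1,2) V(3) distinct_card by fastforce
  then obtain p0 p1 p2 p3 p4 p5 where q: "qs = [p0, p1, p2, p3, p4, p5]"
    by (auto simp: numeral_eq_Suc length_Suc_conv)
  have pos: "0 < orient p0 p1 p2" "0 < orient p0 p1 p3" "0 < orient p0 p1 p4" "0 < orient p0 p1 p5"
    "0 < orient p0 p2 p3" "0 < orient p0 p2 p4" "0 < orient p0 p2 p5"
    "0 < orient p0 p3 p4" "0 < orient p0 p3 p5" "0 < orient p0 p4 p5"
    using qs(3)[of 1 2] qs(3)[of 1 3] qs(3)[of 1 4] qs(3)[of 1 5] qs(3)[of 2 3] qs(3)[of 2 4]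
      qs(3)[of 2 5] qs(3)[of 3 4] qs(3)[of 3 5] qs(3)[of 4 5]
    by (simp_all add: q)
  have d: "distinct [p0, p1, p2, p3, p4, p5]" and s: "set [p0, p1, p2, p3, p4, p5] = V"
    using qs(1,2) q by simp_all
  have ne: "orient x y z \<noteq> 0"
    if "x \<in> set [p0, p1, p2, p3, p4, p5]" "y \<in> set [p0, p1, p2, p3, p4, p5]"
      "z \<in> set [p0, p1, p2, p3, p4, p5]" "x \<noteq> y" "x \<noteq> z" "y \<noteq> z" for x y z
    using general_position_orient[OF V(2)] that unfolding s by blast
  have *: "distinct ps \<and> set ps = V \<and> length ps = 6"
    if "mset ps = mset [p0, p1, p2, p3, p4, p5]" for ps
    using mset_eq_imp_distinct_iff[OF that] mset_eq_setD[OF that] mset_eq_length[OF that] d s by simp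
  have ne': "orient p1 p2 p3 \<noteq> 0" "orient p1 p2 p4 \<noteq> 0" "orient p1 p2 p5 \<noteq> 0" "orient p1 p3 p4 \<noteq> 0"
    "orient p1 p3 p5 \<noteq> 0" "orient p1 p4 p5 \<noteq> 0" "orient p2 p3 p4 \<noteq> 0" "orient p2 p3 p5 \<noteq> 0"
    "orient p2 p4 p5 \<noteq> 0" "orient p3 p4 p5 \<noteq> 0"
    using d by (simp_all add: ne)
  let ?perms = "[[p0, p3, p2, p4, p1, p5], [p0, p3, p1, p4, p2, p5], [p0, p2, p1, p4, p3, p5],
      [p0, p2, p1, p3, p4, p5], [p0, p2, p1, p5, p3, p4], [p0, p1, p2, p4, p5, p3], [p0, p3, p1, p5, p2, p4]]"
  have "\<exists>ps \<in> set ?perms. cyclic_matching ps \<or> centred_pentagon ps"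
    using six_sorted_points[OF pos ne'] by (simp only: list.set bex_simps) blast
  moreover have "\<forall>ps \<in> set ?perms. mset ps = mset [p0, p1, p2, p3, p4, p5]"
    by simp
  ultimately have "\<exists>ps. (cyclic_matching ps \<or> centred_pentagon ps) \<and> mset ps = mset [p0, p1, p2, p3, p4, p5]"
    by (meson bexE)
  then show ?thesis
    using that * by blast
qed

section \<open>Tilings of a blown-up six-point set\<close>

text \<open>Pairs are stored in increasing order so that equal edges are equal pairs.
  Edge-disjointness of a whole pattern then becomes a single \<open>distinct\<close> test, decided
  by evaluation.\<close>

definition theta_pairs :: "nat \<times> nat \<times> nat \<times> nat \<Rightarrow> (nat \<times> nat) list" where
  "theta_pairs t = (case t of (p, q, a, b) \<Rightarrow>
     map (\<lambda>(x, y). (min x y, max x y)) [(p, q), (p, a), (p, b), (q, a), (q, b)])"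

definition theta_of :: "(nat \<Rightarrow> point) \<Rightarrow> nat \<times> nat \<times> nat \<times> nat \<Rightarrow> point graph" where
  "theta_of f t = (case t of (p, q, a, b) \<Rightarrow> theta (f p) (f q) (f a) (f b))"

lemma edges_theta_of: "edges (theta_of f t) = (\<lambda>(x, y). {f x, f y}) ` set (theta_pairs t)"
  by (cases t) (auto simp: theta_of_def theta_pairs_def theta_def min_def max_def)

lemma tiling_from_pattern:
  assumes f: "inj_on f {..<k}" "f ` {..<k} \<subseteq> V" and V: "general_position V"
    and L: "distinct (concat (map theta_pairs L))"
      "\<And>p q a b. (p, q, a, b) \<in> set L \<Longrightarrow> p < k \<and> q < k \<and> a < k \<and> b < k \<and> distinct [p, q, a, b] \<and>
        separates (f p) (f q) (f a) (f b)"
    and G: "isomorphic Theta1 G"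
  shows "tiling (plane_drawings G) V ((\<lambda>i. theta_of f (L ! i)) ` {..<length L}) \<and>
    card ((\<lambda>i. theta_of f (L ! i)) ` {..<length L}) = card {..<length L}"
proof (rule tilingI)
  fix i assume "i \<in> {..<length L}"
  then have iL: "i < length L" by simp
  obtain p q a b where t: "L ! i = (p, q, a, b)"
    by (metis surj_pair)
  then have pq: "p < k" "q < k" "a < k" "b < k" "distinct [p, q, a, b]" "separates (f p) (f q) (f a) (f b)"
    using L(2)[of p q a b] nth_mem[OF iL] by auto
  have fV: "{f p, f q, f a, f b} \<subseteq> V"
    using pq f(2) by auto
  have "distinct [f p, f q, f a, f b]"
    using pq f(1) by (auto simp: inj_on_def)
  then show "theta_of f (L ! i) \<in> plane_drawings G"
    using theta_in_plane_drawings[OF V fV] pq(6) G by (simp add: t theta_of_def separates_def)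
  show "verts (theta_of f (L ! i)) \<subseteq> V" "edges (theta_of f (L ! i)) \<noteq> {}"
    using fV by (auto simp: t theta_of_def theta_def)
  fix j e assume "j \<in> {..<length L}"
    and e: "e \<in> edges (theta_of f (L ! i))" "e \<in> edges (theta_of f (L ! j))"
  then have jL: "j < length L" by simp
  have pairs: "x < y \<and> y < k" if "(x, y) \<in> set (theta_pairs (L ! l))" "l < length L" for x y l
  proof -
    obtain p q a b where t: "L ! l = (p, q, a, b)"
      by (metis surj_pair)
    then have "p < k" "q < k" "a < k" "b < k" "p \<noteq> q" "p \<noteq> a" "p \<noteq> b" "q \<noteq> a" "q \<noteq> b"
      using L(2)[of p q a b] nth_mem[OF that(2)] by auto
    moreover have "(x, y) \<in> {(min p q, max p q), (min p a, max p a), (min p b, max p b),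
        (min q a, max q a), (min q b, max q b)}"
      using that(1) unfolding t by (simp add: theta_pairs_def)
    ultimately show ?thesis
      by (elim insertE emptyE; simp add: min_def max_def)
  qed
  obtain x y where xy: "(x, y) \<in> set (theta_pairs (L ! i))" "e = {f x, f y}"
    using e(1) unfolding edges_theta_of by auto
  obtain x' y' where xy': "(x', y') \<in> set (theta_pairs (L ! j))" "e = {f x', f y'}"
    using e(2) unfolding edges_theta_of by auto
  note lt = pairs[OF xy(1) iL] pairs[OF xy'(1) jL]
  have "f ` {x, y} = f ` {x', y'}"
    using xy(2) xy'(2) by simp
  then have "{x, y} = {x', y'}"
    using inj_on_image_eq_iff[OF f(1), of "{x, y}" "{x', y'}"] lt by simp
  then have "(x, y) = (x', y')"
    using lt by (auto simp: doubleton_eq_iff)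
  then have common: "(x, y) \<in> set (theta_pairs (L ! i)) \<inter> set (theta_pairs (L ! j))"
    using xy xy' by simp
  let ?M = "map theta_pairs L"
  have "\<forall>ys zs. ys \<in> set ?M \<and> zs \<in> set ?M \<and> ys \<noteq> zs \<longrightarrow> set ys \<inter> set zs = {}"
    using L(1) unfolding distinct_concat_iff by (elim conjE)
  moreover have "theta_pairs (L ! i) \<in> set ?M" "theta_pairs (L ! j) \<in> set ?M"
    using iL jL by simp_all
  ultimately have "theta_pairs (L ! i) = theta_pairs (L ! j)"
    using common by (metis empty_iff)
  moreover have "removeAll [] ?M = ?M"
    by (rule removeAll_id) (auto simp: theta_pairs_def)
  then have "distinct ?M"
    using L(1) unfolding distinct_concat_iff by simp
  ultimately show "i = j"
    using iL jL nth_eq_iff_index_eq[of ?M i j] by simp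
qed simp

text \<open>The twins of point \<open>i\<close> have the numbers 2 i and 2 i + 1. A matching edge
  has four copies; the twins of the next edge are assigned to them so that the four thetas use each
  of the 16 edges between the two groups once. Three rounds give 3 (4 + 16) = 60 edges.\<close>

definition cyclic_matching_pattern :: "(nat \<times> nat \<times> nat \<times> nat) list" where
  "cyclic_matching_pattern = [(0, 2, 4, 6), (0, 3, 5, 7), (1, 2, 5, 7), (1, 3, 4, 6), (4, 6, 8, 10), (4, 7, 9, 11), (5, 6, 9, 11), (5, 7, 8, 10), (8, 10, 0, 2), (8, 11, 1, 3), (9, 10, 1, 3), (9, 11, 0, 2)]"

text \<open>Each of the six separations in \<open>centred_pentagon\<close> serves two of the twelve
  thetas, with twins chosen so that all 60 edges between twins of different points occur
  once.\<close>

definition centred_pentagon_pattern :: "(nat \<times> nat \<times> nat \<times> nat) list" where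
  "centred_pentagon_pattern = [(0, 10, 4, 6), (0, 5, 2, 9), (7, 11, 0, 2), (3, 8, 0, 11), (1, 11, 5, 6), (4, 9, 7, 11), (1, 4, 3, 8), (3, 6, 5, 9), (2, 6, 4, 8), (2, 9, 1, 10), (5, 8, 7, 10), (7, 10, 1, 3)]"

lemma patterns_distinct:
  "distinct (concat (map theta_pairs cyclic_matching_pattern))"
  "distinct (concat (map theta_pairs centred_pentagon_pattern))"
  by (simp_all add: cyclic_matching_pattern_def centred_pentagon_pattern_def theta_pairs_def)

text \<open>No twin pair is cut by a line through copies of two other points, so the orientation of
  three copies depends only on the points they copy. Separations among six representatives therefore
  hold for all copies, and the pattern for their type applies.\<close>

lemma tiling_of_twin_sextuple:
  fixes Y :: "nat \<Rightarrow> nat \<Rightarrow> point"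
  assumes V: "general_position V" and YV: "\<And>i s. i < 6 \<Longrightarrow> s < 2 \<Longrightarrow> Y i s \<in> V"
    and inj: "\<And>i s j t. i < 6 \<Longrightarrow> s < 2 \<Longrightarrow> j < 6 \<Longrightarrow> t < 2 \<Longrightarrow> Y i s = Y j t \<longleftrightarrow> i = j \<and> s = t"
    and hom: "\<And>i j k s t. i < 6 \<Longrightarrow> j < 6 \<Longrightarrow> k < 6 \<Longrightarrow> i \<noteq> j \<Longrightarrow> i \<noteq> k \<Longrightarrow> j \<noteq> k \<Longrightarrow> s < 2 \<Longrightarrow> t < 2 \<Longrightarrow>
        0 < orient (Y i s) (Y j t) (Y k 0) * orient (Y i s) (Y j t) (Y k 1)"
    and G: "isomorphic Theta1 G"
  obtains S where "tiling (plane_drawings G) V S" "card S = 12"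
    "\<And>F e. F \<in> S \<Longrightarrow> e \<in> edges F \<Longrightarrow>
       \<exists>i<6. \<exists>j<6. \<exists>s<2. \<exists>t<2. i \<noteq> j \<and> e = {Y i s, Y j t}"
proof -
  note result = that
  have hom': "sgn (orient (Y i s) (Y j t) (Y k x)) = sgn (orient (Y i s) (Y j t) (Y k 0))"
    if "i < 6" "j < 6" "k < 6" "i \<noteq> j" "i \<noteq> k" "j \<noteq> k" "s < 2" "t < 2" "x < 2" for i j k s t x
  proof -
    have "x = 0 \<or> x = 1" using that(9) by auto
    then show ?thesis
      using hom[of i j k s t] that by (auto simp: zero_less_mult_iff)
  qed
  \<comment> \<open>The copies are replaced one at a time; a cyclic rotation brings the next one to
    the last place, where \<open>hom'\<close> applies.\<close>
  have sgn0: "sgn (orient (Y i s) (Y j t) (Y k x)) = sgn (orient (Y i 0) (Y j 0) (Y k 0))"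
    if "i < 6" "j < 6" "k < 6" "i \<noteq> j" "i \<noteq> k" "j \<noteq> k" "s < 2" "t < 2" "x < 2" for i j k s t x
  proof -
    have "sgn (orient (Y i s) (Y j t) (Y k x)) = sgn (orient (Y i s) (Y j t) (Y k 0))"
      using hom' that by blast
    also have "\<dots> = sgn (orient (Y j t) (Y k 0) (Y i s))"
      by (simp add: orient_cyclic)
    also have "\<dots> = sgn (orient (Y j t) (Y k 0) (Y i 0))"
      using hom'[of j k i t 0 s] that by auto
    also have "\<dots> = sgn (orient (Y k 0) (Y i 0) (Y j t))"
      by (simp add: orient_cyclic)
    also have "\<dots> = sgn (orient (Y k 0) (Y i 0) (Y j 0))"
      using hom'[of k i j 0 0 t] that by auto
    also have "\<dots> = sgn (orient (Y i 0) (Y j 0) (Y k 0))"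
      by (simp add: orient_cyclic)
    finally show ?thesis .
  qed
  have sep_twins: "separates (Y i s) (Y j t) (Y k x) (Y l y)"
    if "separates (Y i 0) (Y j 0) (Y k 0) (Y l 0)" "i < 6" "j < 6" "k < 6" "l < 6"
      "distinct [i, j, k, l]" "s < 2" "t < 2" "x < 2" "y < 2" for i j k l s t x y
  proof -
    have "sgn (orient (Y i s) (Y j t) (Y k x)) = sgn (orient (Y i 0) (Y j 0) (Y k 0))"
      "sgn (orient (Y i s) (Y j t) (Y l y)) = sgn (orient (Y i 0) (Y j 0) (Y l 0))"
      using sgn0[of i j k s t x] sgn0[of i j l s t y] that by auto
    then have "sgn (orient (Y i s) (Y j t) (Y k x) * orient (Y i s) (Y j t) (Y l y))
        = sgn (orient (Y i 0) (Y j 0) (Y k 0) * orient (Y i 0) (Y j 0) (Y l 0))"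
      by (simp add: sgn_mult)
    then show ?thesis
      using that(1) unfolding separates_def by (metis sgn_less)
  qed
  have Y0: "(\<lambda>i. Y i 0) ` {..<6} \<subseteq> V" "inj_on (\<lambda>i. Y i 0) {..<6}"
    using YV inj by (auto simp: inj_on_def)
  obtain ps where ps: "distinct ps" "set ps = (\<lambda>i. Y i 0) ` {..<6}" "length ps = 6"
    and type: "cyclic_matching ps \<or> centred_pentagon ps"
    using six_points[of "(\<lambda>i. Y i 0) ` {..<6}"] general_position_subset[OF V Y0(1)] Y0(2)
    by (auto simp: card_image)
  have "\<exists>i<6. ps ! j = Y i 0" if "j < 6" for j
    using nth_mem[of j ps] that ps by auto
  then obtain \<pi> where \<pi>: "\<And>j. j < 6 \<Longrightarrow> \<pi> j < 6" "\<And>j. j < 6 \<Longrightarrow> ps ! j = Y (\<pi> j) 0"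
    by metis
  have \<pi>_inj: "\<pi> i = \<pi> j \<longleftrightarrow> i = j" if "i < 6" "j < 6" for i j
    using \<pi>(2) that ps(1,3) by (metis nth_eq_iff_index_eq)
  define f where "f = (\<lambda>n. Y (\<pi> (n div 2)) (n mod 2))"
  have d2: "n div 2 < 6" "n mod 2 < 2" if "n < 12" for n :: nat
    using that by auto
  have f_eq: "f n = f n' \<longleftrightarrow> n = n'" if "n < 12" "n' < 12" for n n'
  proof -
    have "f n = f n' \<longleftrightarrow> \<pi> (n div 2) = \<pi> (n' div 2) \<and> n mod 2 = n' mod 2"
      unfolding f_def using inj \<pi>(1) d2[OF that(1)] d2[OF that(2)] by blast
    also have "\<dots> \<longleftrightarrow> n div 2 = n' div 2 \<and> n mod 2 = n' mod 2"
      using \<pi>_inj d2[OF that(1)] d2[OF that(2)] by blast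
    also have "\<dots> \<longleftrightarrow> n = n'"
      by (metis div_mult_mod_eq)
    finally show ?thesis .
  qed
  have f: "inj_on f {..<12}" "f ` {..<12} \<subseteq> V"
    using f_eq YV \<pi>(1) d2 by (auto simp: inj_on_def f_def)
  have sep_f: "separates (f p) (f q) (f a) (f b)"
    if "separates (ps ! (p div 2)) (ps ! (q div 2)) (ps ! (a div 2)) (ps ! (b div 2))"
      "p < 12" "q < 12" "a < 12" "b < 12" "distinct [p div 2, q div 2, a div 2, b div 2]" for p q a b
    unfolding f_def
  proof (rule sep_twins)
    show "separates (Y (\<pi> (p div 2)) 0) (Y (\<pi> (q div 2)) 0) (Y (\<pi> (a div 2)) 0) (Y (\<pi> (b div 2)) 0)"
      using that(1) \<pi>(2) d2 that(2-5) by simp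
    show "distinct [\<pi> (p div 2), \<pi> (q div 2), \<pi> (a div 2), \<pi> (b div 2)]"
      using that(6) \<pi>_inj d2 that(2-5) by simp
  qed (use \<pi>(1) d2 that in auto)
  have main: thesis
    if L: "distinct (concat (map theta_pairs L))" "length L = 12"
      "\<And>p q a b. (p, q, a, b) \<in> set L \<Longrightarrow> p < 12 \<and> q < 12 \<and> a < 12 \<and> b < 12 \<and>
        distinct [p div 2, q div 2, a div 2, b div 2] \<and>
        separates (ps ! (p div 2)) (ps ! (q div 2)) (ps ! (a div 2)) (ps ! (b div 2))" for L
  proof -
    let ?S = "(\<lambda>i. theta_of f (L ! i)) ` {..<length L}"
    have "tiling (plane_drawings G) V ?S \<and> card ?S = card {..<length L}"
      using L(1,3) sep_f by (intro tiling_from_pattern[OF f V _ _ G]) fastforce+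
    moreover have "\<exists>i<6. \<exists>j<6. \<exists>s<2. \<exists>t<2. i \<noteq> j \<and> e = {Y i s, Y j t}"
      if F: "F \<in> ?S" "e \<in> edges F" for F e
    proof -
      obtain l where l: "l < length L" "F = theta_of f (L ! l)" using F(1) by auto
      obtain p q a b where t: "L ! l = (p, q, a, b)" by (metis surj_pair)
      obtain x y where xy: "x < 12" "y < 12" "x div 2 \<noteq> y div 2" "e = {f x, f y}"
        using F(2) L(3)[of p q a b] nth_mem[OF l(1)] unfolding l(2) t
        by (auto simp: theta_of_def theta_def)
      then have "\<pi> (x div 2) < 6" "\<pi> (y div 2) < 6" "\<pi> (x div 2) \<noteq> \<pi> (y div 2)"
        using \<pi>(1) \<pi>_inj d2 by auto
      then show ?thesis
        using xy(4) d2(2)[OF xy(1)] d2(2)[OF xy(2)] unfolding f_def by blast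
    qed
    ultimately show thesis
      using result[of ?S] L(2) by simp
  qed
  show thesis
    using type
  proof
    assume "cyclic_matching ps"
    then show thesis
      by (intro main[of cyclic_matching_pattern] patterns_distinct(1))
        (auto simp: cyclic_matching_pattern_def cyclic_matching_def)
  next
    assume "centred_pentagon ps"
    then show thesis
      by (intro main[of centred_pentagon_pattern] patterns_distinct(2))
        (auto simp: centred_pentagon_pattern_def centred_pentagon_def)
  qed
qed

section \<open>Twins\<close>

text \<open>The negated strict inequality also counts degenerate pairs, with x = y or a member in
  {u, v}. So a pair of points of \<open>V\<close> outside the set has \<open>u\<close> and
  \<open>v\<close> strictly on the same side.\<close>

definition cuts :: "point set \<Rightarrow> point \<Rightarrow> point \<Rightarrow> (point \<times> point) set" where
  "cuts V u v = {(x, y) \<in> V \<times> V. \<not> 0 < orient x y u * orient x y v}"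

text \<open>The affine dependence of the four points, one diagonal against the other, has positive
  coefficients on both sides, so alternating signs would make the two sides differ in sign. The
  factor \<sigma> treats both orientations at once.\<close>

lemma convex_quadrilateral_not_alternating:
  assumes "0 < \<sigma> * orient i j k" "0 < \<sigma> * orient i j l" "0 < \<sigma> * orient i k l" "0 < \<sigma> * orient j k l"
    and "(0 < orient x y i) = p" "(0 < orient x y j) = (\<not> p)" "(0 < orient x y k) = p"
      "(0 < orient x y l) = (\<not> p)"
    and "orient x y i \<noteq> 0" "orient x y j \<noteq> 0" "orient x y k \<noteq> 0" "orient x y l \<noteq> 0"
  shows False
proof -
  have id: "(\<sigma> * orient j k l) * orient x y i + (\<sigma> * orient i j l) * orient x y k
      = (\<sigma> * orient i k l) * orient x y j + (\<sigma> * orient i j k) * orient x y l"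
    by (simp add: orient_def algebra_simps)
  show False
  proof (cases p)
    case True
    then have "orient x y j < 0" "orient x y l < 0" "0 < orient x y i" "0 < orient x y k"
      using assms(5-12) by auto
    then show False
      using id assms(1-4) mult_pos_pos[of "\<sigma> * orient j k l" "orient x y i"]
        mult_pos_pos[of "\<sigma> * orient i j l" "orient x y k"]
        mult_pos_neg[of "\<sigma> * orient i k l" "orient x y j"]
        mult_pos_neg[of "\<sigma> * orient i j k" "orient x y l"]
      by linarith
  next
    case False
    then have "orient x y i < 0" "orient x y k < 0" "0 < orient x y j" "0 < orient x y l"
      using assms(5-12) by auto
    then show False
      using id assms(1-4) mult_pos_neg[of "\<sigma> * orient j k l" "orient x y i"]
        mult_pos_neg[of "\<sigma> * orient i j l" "orient x y k"]
        mult_pos_pos[of "\<sigma> * orient i k l" "orient x y j"]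
        mult_pos_pos[of "\<sigma> * orient i j k" "orient x y l"]
      by linarith
  qed
qed

text \<open>At a change, one of the two indices has the value wanted. Three changes thus give four
  increasing indices with alternating values.\<close>

lemma card_sign_changes_le_2:
  fixes b :: "nat \<Rightarrow> bool"
  assumes "\<And>i j k l. i < j \<Longrightarrow> j < k \<Longrightarrow> k < l \<Longrightarrow> l \<le> C \<Longrightarrow> b j \<noteq> b i \<Longrightarrow> b k = b i \<Longrightarrow> b l \<noteq> b i \<Longrightarrow> False"
  shows "card {i \<in> {..<C}. b i \<noteq> b (Suc i)} \<le> 2"
proof (rule ccontr)
  let ?S = "{i \<in> {..<C}. b i \<noteq> b (Suc i)}"
  assume "\<not> card ?S \<le> 2"
  then obtain T where "T \<subseteq> ?S" "card T = 3" "finite T"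
    using obtain_subset_with_card_n[of 3 ?S] by auto
  then have "T \<in> nsets ?S 3" by (simp add: nsets_def)
  then obtain x y z where xyz: "x \<in> ?S" "y \<in> ?S" "z \<in> ?S" "x < y" "y < z"
    unfolding ordered_nsets_3_eq by blast
  define k where "k = (if b y = b x then y else Suc y)"
  define l where "l = (if b z \<noteq> b x then z else Suc z)"
  have k: "b k = b x" "Suc x < k" "k \<le> Suc y"
    using xyz by (auto simp: k_def le_less_Suc_eq intro: Suc_lessI)
  have "b l \<noteq> b x" "k < l" "l \<le> C"
    using xyz k by (auto simp: l_def le_less intro: Suc_lessI)
  then show False
    using assms[of x "Suc x" k l] k xyz by auto
qed

text \<open>The Erdos-Szekeres theorem via Ramsey: triples are coloured by orientation along an
  arbitrary enumeration of \<open>U\<close>. A homogeneous set is a convex chain, and \<sigma>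
  records its colour as a sign.\<close>

lemma obtain_convex_chain:
  fixes C :: nat
  obtains N where "\<And>U. finite U \<Longrightarrow> general_position U \<Longrightarrow> N \<le> card U \<Longrightarrow>
    \<exists>h \<sigma>. h ` {..C} \<subseteq> U \<and> inj_on h {..C} \<and>
      (\<forall>i j k. i < j \<longrightarrow> j < k \<longrightarrow> k \<le> C \<longrightarrow> 0 < \<sigma> * orient (h i) (h j) (h k))"
proof -
  obtain N :: nat where N: "partn_lst {..<N} [Suc C, Suc C] 3"
    using ramsey_full by blast
  show ?thesis
  proof (rule that)
    fix U :: "point set" assume U: "finite U" "general_position U" "N \<le> card U"
    obtain f where f: "bij_betw f {0..<card U} U"
      using ex_bij_betw_nat_finite[OF U(1)] by blast
    define col :: "nat set \<Rightarrow> nat" where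
      "col = (\<lambda>e. let s = sorted_list_of_set e in
         if 0 < orient (f (s!0)) (f (s!1)) (f (s!2)) then 0 else 1)"
    have col: "col {i, j, k} = (if 0 < orient (f i) (f j) (f k) then 0 else 1)" if "i < j" "j < k" for i j k
    proof -
      have "sorted_list_of_set {i, j, k} = [i, j, k]"
        using that by simp
      then show ?thesis by (simp add: col_def)
    qed
    have "col \<in> nsets {..<N} 3 \<rightarrow> {..<2}"
      by (auto simp: col_def Let_def)
    moreover have "length [Suc C, Suc C] = 2" by simp
    ultimately obtain c H where "c < 2" "H \<in> nsets {..<N} ([Suc C, Suc C] ! c)"
      and col_H: "col ` nsets H 3 \<subseteq> {c}"
      using partn_lstE[OF N, of col 2] by metis
    then have H: "H \<in> nsets {..<N} (Suc C)" "col ` nsets H 3 \<subseteq> {c}"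
      by (auto simp: less_2_cases_iff)
    have Hp: "finite H" "card H = Suc C" "H \<subseteq> {..<N}"
      using H(1) by (auto simp: nsets_def)
    define g where "g = (\<lambda>i. sorted_list_of_set H ! i)"
    have g: "g i \<in> H" if "i \<le> C" for i
      using that Hp nth_mem[of i "sorted_list_of_set H"] by (simp add: g_def)
    have g_mono: "g i < g j" if "i < j" "j \<le> C" for i j
      using that Hp strict_sorted_list_of_set[of H] by (simp add: g_def sorted_wrt_nth_less)
    define \<sigma> :: real where "\<sigma> = (if c = 0 then 1 else - 1)"
    have "0 < \<sigma> * orient (f (g i)) (f (g j)) (f (g k))" if "i < j" "j < k" "k \<le> C" for i j k
    proof -
      have lt: "g i < g j" "g j < g k" and "g i \<in> H" "g j \<in> H" "g k \<in> H"
        using g g_mono that by auto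
      then have "{g i, g j, g k} \<in> nsets H 3"
        by (auto simp: nsets_def)
      then have "col {g i, g j, g k} = c"
        using H(2) by blast
      moreover have "orient (f (g i)) (f (g j)) (f (g k)) \<noteq> 0"
      proof -
        have "g i < card U" "g j < card U" "g k < card U"
          using \<open>g i \<in> H\<close> \<open>g j \<in> H\<close> \<open>g k \<in> H\<close> Hp(3) U(3) by auto
        then have "f (g i) \<in> U" "f (g j) \<in> U" "f (g k) \<in> U"
            "f (g i) \<noteq> f (g j)" "f (g i) \<noteq> f (g k)" "f (g j) \<noteq> f (g k)"
          using lt bij_betwE[OF f] inj_on_eq_iff[OF bij_betw_imp_inj_on[OF f]] by auto
        then show ?thesis
          using general_position_orient[OF U(2)] by blast
      qed
      ultimately show ?thesis
        using col[OF lt] by (auto simp: \<sigma>_def split: if_splits)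
    qed
    moreover have "(f \<circ> g) ` {..C} \<subseteq> U"
      using f g Hp(3) U(3) by (fastforce simp: bij_betw_def)
    moreover have "inj_on (f \<circ> g) {..C}"
    proof (rule comp_inj_on)
      show "inj_on g {..C}"
        using g_mono by (metis atMost_iff inj_onI linorder_neqE_nat less_irrefl)
      show "inj_on f (g ` {..C})"
      proof (rule inj_on_subset[OF bij_betw_imp_inj_on[OF f]])
        have "g i < card U" if "i \<le> C" for i
          using g[OF that] Hp(3) U(3) by auto
        then show "g ` {..C} \<subseteq> {0..<card U}" by auto
      qed
    qed
    ultimately show "\<exists>h \<sigma>. h ` {..C} \<subseteq> U \<and> inj_on h {..C} \<and>
      (\<forall>i j k. i < j \<longrightarrow> j < k \<longrightarrow> k \<le> C \<longrightarrow> 0 < \<sigma> * orient (h i) (h j) (h k))"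
      by (intro exI[of _ "f \<circ> g"] exI[of _ \<sigma>]) auto
  qed
qed

text \<open>
  A line meets a convex chain in at most two edges, so the endpoints of some edge of a long chain
  are separated by few of the lines spanned by \<open>V\<close>.
\<close>

lemma sum_card_cuts_chain:
  assumes V: "finite V" "general_position V" and h: "h ` {..C} \<subseteq> V" "inj_on h {..C}"
    and chain: "\<And>i j k. i < j \<Longrightarrow> j < k \<Longrightarrow> k \<le> C \<Longrightarrow> 0 < \<sigma> * orient (h i) (h j) (h k)"
  shows "(\<Sum>i<C. card (cuts V (h i) (h (Suc i)))) \<le> 2 * card V ^ 2 + C * ((2 * C + 3) * card V)"
proof -
  \<comment> \<open>Pairs that are degenerate or meet the chain may be counted for every edge of the
    chain, but there are only linearly many of them.\<close>
  define E where "E = {(x, y) \<in> V \<times> V. x = y \<or> x \<in> h ` {..C} \<or> y \<in> h ` {..C}}"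
  have bound: "card {i \<in> {..<C}. z \<in> cuts V (h i) (h (Suc i))} \<le> 2 + C * of_bool (z \<in> E)"
    if "z \<in> V \<times> V" for z
  proof (cases "z \<in> E")
    case True
    have "card {i \<in> {..<C}. z \<in> cuts V (h i) (h (Suc i))} \<le> card {..<C}"
      by (rule card_mono) auto
    then show ?thesis using True by simp
  next
    case False
    obtain x y where z: "z = (x, y)" by (cases z)
    have xy: "x \<in> V" "y \<in> V" "x \<noteq> y" "x \<notin> h ` {..C}" "y \<notin> h ` {..C}"
      using False \<open>z \<in> V \<times> V\<close> by (auto simp: E_def z)
    have ne: "orient x y (h i) \<noteq> 0" if "i \<le> C" for i
    proof (rule general_position_orient[OF V(2) xy(1,2) _ xy(3)])
      have "h i \<in> h ` {..C}" using that by simp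
      then show "h i \<in> V" "x \<noteq> h i" "y \<noteq> h i"
        using h(1) xy(4,5) by auto
    qed
    have "z \<in> cuts V (h i) (h (Suc i)) \<longleftrightarrow> (0 < orient x y (h i)) \<noteq> (0 < orient x y (h (Suc i)))"
      if "i < C" for i
      using ne[of i] ne[of "Suc i"] that xy(1,2) by (auto simp: cuts_def z zero_less_mult_iff)
    then have "{i \<in> {..<C}. z \<in> cuts V (h i) (h (Suc i))}
        = {i \<in> {..<C}. (0 < orient x y (h i)) \<noteq> (0 < orient x y (h (Suc i)))}"
      by auto
    moreover have "card {i \<in> {..<C}. (0 < orient x y (h i)) \<noteq> (0 < orient x y (h (Suc i)))} \<le> 2"
    proof (rule card_sign_changes_le_2)
      fix i j k l assume *: "i < j" "j < k" "k < l" "l \<le> C"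
        "(0 < orient x y (h j)) \<noteq> (0 < orient x y (h i))" "(0 < orient x y (h k)) = (0 < orient x y (h i))"
        "(0 < orient x y (h l)) \<noteq> (0 < orient x y (h i))"
      show False
        by (rule convex_quadrilateral_not_alternating[of \<sigma> "h i" "h j" "h k" "h l" x y "0 < orient x y (h i)"])
          (use * chain ne in auto)
    qed
    ultimately show ?thesis by simp
  qed
  have fin: "finite (V \<times> V)" using V by simp
  have cuts_eq: "card (cuts V u v) = (\<Sum>z\<in>V \<times> V. of_bool (z \<in> cuts V u v))" for u v
  proof -
    have "V \<times> V \<inter> {z. z \<in> cuts V u v} = cuts V u v"
      by (auto simp: cuts_def)
    then show ?thesis using fin by (simp add: sum_of_bool_eq)
  qed
  have "card E \<le> (2 * C + 3) * card V"
  proof -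
    have "E \<subseteq> (\<lambda>x. (x, x)) ` V \<union> (h ` {..C} \<times> V \<union> V \<times> h ` {..C})"
      by (auto simp: E_def)
    then have "card E \<le> card ((\<lambda>x. (x, x)) ` V \<union> (h ` {..C} \<times> V \<union> V \<times> h ` {..C}))"
      using V by (intro card_mono) auto
    also have "\<dots> \<le> card ((\<lambda>x. (x, x)) ` V) + (card (h ` {..C} \<times> V) + card (V \<times> h ` {..C}))"
      by (meson add_le_mono card_Un_le le_refl le_trans)
    also have "\<dots> \<le> card V + (Suc C * card V + card V * Suc C)"
      using h(2) V by (intro add_mono) (auto simp: card_cartesian_product card_image card_image_le)
    also have "\<dots> = (2 * C + 3) * card V"
      by (simp add: algebra_simps)
    finally show ?thesis .
  qed
  have "(\<Sum>i<C. card (cuts V (h i) (h (Suc i)))) =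
      (\<Sum>z\<in>V \<times> V. \<Sum>i<C. of_bool (z \<in> cuts V (h i) (h (Suc i))))"
    unfolding cuts_eq by (rule sum.swap)
  also have "\<dots> = (\<Sum>z\<in>V \<times> V. card {i \<in> {..<C}. z \<in> cuts V (h i) (h (Suc i))})"
    by (intro sum.cong refl) (simp add: sum_of_bool_eq Collect_conj_eq lessThan_def)
  also have "\<dots> \<le> (\<Sum>z\<in>V \<times> V. 2 + C * of_bool (z \<in> E))"
    using bound by (rule sum_mono)
  also have "\<dots> = 2 * card V ^ 2 + C * card E"
  proof -
    have "V \<times> V \<inter> {z. z \<in> E} = E" by (auto simp: E_def)
    then have *: "(\<Sum>z\<in>V \<times> V. of_bool (z \<in> E)) = card E"
      using fin by (simp add: sum_of_bool_eq)
    show ?thesis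
      unfolding sum.distrib sum_distrib_left[symmetric] *
      by (simp add: card_cartesian_product power2_eq_square)
  qed
  also have "\<dots> \<le> 2 * card V ^ 2 + C * ((2 * C + 3) * card V)"
    using \<open>card E \<le> (2 * C + 3) * card V\<close> by simp
  finally show ?thesis .
qed

text \<open>The cuts of the \<open>C\<close> edges of a chain sum to 2 n^2 up to a linear term, so
  for C > 4 / \<epsilon> some edge has few cuts. The twins come from any \<open>U\<close> with
  \<open>N\<close> points while cuts are counted in all of \<open>V\<close>, as a greedy choice
  requires.\<close>

lemma exists_twins:
  assumes "\<epsilon> > 0"
  obtains N n0 where "\<And>V U. finite V \<Longrightarrow> general_position V \<Longrightarrow> n0 \<le> card V \<Longrightarrow> U \<subseteq> V \<Longrightarrow> N \<le> card U \<Longrightarrow>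
    \<exists>u\<in>U. \<exists>v\<in>U. u \<noteq> v \<and> real (card (cuts V u v)) \<le> \<epsilon> * real (card V)^2"
proof -
  obtain C :: nat where C: "4 / \<epsilon> < real C"
    using reals_Archimedean2 by blast
  have "C > 0" using C assms by (metis divide_pos_pos less_trans of_nat_0_less_iff zero_less_numeral)
  have C4: "4 \<le> real C * \<epsilon>" using C assms by (simp add: divide_less_eq)
  obtain N where N: "\<And>U. finite U \<Longrightarrow> general_position U \<Longrightarrow> N \<le> card U \<Longrightarrow>
    \<exists>h \<sigma>. h ` {..C} \<subseteq> U \<and> inj_on h {..C} \<and>
      (\<forall>i j k. i < j \<longrightarrow> j < k \<longrightarrow> k \<le> C \<longrightarrow> 0 < \<sigma> * orient (h i) (h j) (h k))"
    using obtain_convex_chain[of C] by metis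
  show ?thesis
  \<comment> \<open>For n > C (2 C + 3) the linear term is below n^2, which keeps the total below 4
    n^2.\<close>
  proof (rule that[of "Suc (C * (2 * C + 3))" N])
    fix V U :: "point set"
    assume V: "finite V" "general_position V" "Suc (C * (2 * C + 3)) \<le> card V" and U: "U \<subseteq> V" "N \<le> card U"
    have "\<exists>h \<sigma>. h ` {..C} \<subseteq> U \<and> inj_on h {..C} \<and>
      (\<forall>i j k. i < j \<longrightarrow> j < k \<longrightarrow> k \<le> C \<longrightarrow> 0 < \<sigma> * orient (h i) (h j) (h k))"
      using N[of U] finite_subset[OF U(1) V(1)] general_position_subset[OF V(2) U(1)] U(2) by blast
    then obtain h \<sigma> where h: "h ` {..C} \<subseteq> U" "inj_on h {..C}"
      and chain: "\<And>i j k. i < j \<Longrightarrow> j < k \<Longrightarrow> k \<le> C \<Longrightarrow> 0 < \<sigma> * orient (h i) (h j) (h k)"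
      by metis
    let ?n = "real (card V)"
    have "\<exists>i<C. real (card (cuts V (h i) (h (Suc i)))) \<le> \<epsilon> * ?n^2"
    proof (rule ccontr)
      assume "\<not> ?thesis"
      then have "real C * (\<epsilon> * ?n^2) \<le> (\<Sum>i<C. real (card (cuts V (h i) (h (Suc i)))))"
        using sum_mono[of "{..<C}" "\<lambda>_. \<epsilon> * ?n^2" "\<lambda>i. real (card (cuts V (h i) (h (Suc i))))"] by force
      also have "\<dots> = real (\<Sum>i<C. card (cuts V (h i) (h (Suc i))))"
        by simp
      also have "\<dots> \<le> real (2 * card V ^ 2 + C * ((2 * C + 3) * card V))"
        by (intro of_nat_mono sum_card_cuts_chain[OF V(1,2) order_trans[OF h(1) U(1)] h(2) chain])
      also have "\<dots> = 2 * ?n^2 + real (C * (2 * C + 3)) * ?n"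
        by (simp add: algebra_simps)
      also have "\<dots> < 2 * ?n^2 + ?n * ?n"
      proof -
        have "real (C * (2 * C + 3)) < ?n" "0 < ?n"
          unfolding of_nat_less_iff using V(3) by simp_all
        then show ?thesis
          by (intro add_strict_left_mono mult_strict_right_mono)
      qed
      also have "\<dots> \<le> 4 * ?n^2"
        by (simp add: power2_eq_square)
      also have "\<dots> \<le> real C * \<epsilon> * ?n^2"
        using C4 by (intro mult_right_mono) auto
      finally show False by simp
    qed
    then obtain i where "i < C" "real (card (cuts V (h i) (h (Suc i)))) \<le> \<epsilon> * ?n^2" by blast
    moreover have "h i \<noteq> h (Suc i)"
      using inj_onD[OF h(2), of i "Suc i"] \<open>i < C\<close> by auto
    moreover have "h i \<in> U" "h (Suc i) \<in> U"
      using h(1) \<open>i < C\<close> by auto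
    ultimately show "\<exists>u\<in>U. \<exists>v\<in>U. u \<noteq> v \<and> real (card (cuts V u v)) \<le> \<epsilon> * ?n^2"
      by blast
  qed
qed

text \<open>Greedy choice: as long as \<open>N\<close> points are left, a further pair exists among
  them. Since \<open>R\<close> stays fixed, removing points does not spoil earlier pairs.\<close>

lemma exists_twin_pairs:
  assumes V: "finite V" and N: "\<And>U. U \<subseteq> V \<Longrightarrow> N \<le> card U \<Longrightarrow> \<exists>u\<in>U. \<exists>v\<in>U. u \<noteq> v \<and> R u v"
    and "2 * M + N \<le> card V"
  shows "\<exists>u::nat \<Rightarrow> nat \<Rightarrow> 'b. (\<forall>i<M. \<forall>s<2. u i s \<in> V) \<and>
    (\<forall>i<M. \<forall>s<2. \<forall>j<M. \<forall>t<2. u i s = u j t \<longleftrightarrow> i = j \<and> s = t) \<and> (\<forall>i<M. R (u i 0) (u i 1))"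
  using assms(3)
proof (induction M)
  case 0
  then show ?case by simp
next
  case (Suc M)
  then have "2 * M + N \<le> card V" by simp
  from Suc.IH[OF this] obtain u :: "nat \<Rightarrow> nat \<Rightarrow> 'b" where "\<forall>i<M. \<forall>s<2. u i s \<in> V"
    "\<forall>i<M. \<forall>s<2. \<forall>j<M. \<forall>t<2. u i s = u j t \<longleftrightarrow> i = j \<and> s = t" "\<forall>i<M. R (u i 0) (u i 1)"
    by (elim exE conjE)
  note u = this[rule_format]
  define A where "A = (\<lambda>(i, s). u i s) ` ({..<M} \<times> {..<2})"
  have "card A \<le> 2 * M"
    unfolding A_def using card_image_le[of "{..<M} \<times> {..<2::nat}" "\<lambda>(i, s). u i s"]
    by (simp add: card_cartesian_product)
  moreover have "card V - card A \<le> card (V - A)"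
    by (rule diff_card_le_card_Diff) (simp add: A_def)
  ultimately have "N \<le> card (V - A)"
    using Suc.prems by simp
  then obtain p q where pq: "p \<in> V - A" "q \<in> V - A" "p \<noteq> q" "R p q"
    using N[of "V - A"] by blast
  define u' where "u' = (\<lambda>i s. if i = M then (if s = 0 then p else q) else u i s)"
  have notA: "u i s \<noteq> p" "u i s \<noteq> q" if "i < M" "s < 2" for i s
  proof -
    have "u i s \<in> A" using that by (force simp: A_def)
    then show "u i s \<noteq> p" "u i s \<noteq> q" using pq by auto
  qed
  show ?case
  proof (intro exI[of _ u'] conjI allI impI)
    fix i s assume "i < Suc M" "s < (2::nat)"
    then show "u' i s \<in> V"
      using u(1)[of i s] pq by (auto simp: u'_def less_Suc_eq)
  next
    fix i s j t assume "i < Suc M" "s < (2::nat)" "j < Suc M" "t < (2::nat)"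
    then show "u' i s = u' j t \<longleftrightarrow> i = j \<and> s = t"
      using u(2)[of i s j t] pq(3) notA[of i s] notA[of j t]
      by (auto simp: u'_def less_Suc_eq less_2_cases_iff)
  next
    fix i assume "i < Suc M"
    then show "R (u' i 0) (u' i 1)"
      using u(3)[of i] pq(4) by (auto simp: u'_def less_Suc_eq)
  qed
qed

section \<open>The four-cycle with a chord\<close>

lemma tiling_UN:
  assumes "finite I" "\<And>i. i \<in> I \<Longrightarrow> tiling \<G> V (S i)" "\<And>F. F \<in> \<G> \<Longrightarrow> edges F \<noteq> {}"
    and disj: "\<And>i j F F' e. i \<in> I \<Longrightarrow> j \<in> I \<Longrightarrow> F \<in> S i \<Longrightarrow> F' \<in> S j \<Longrightarrow> e \<in> edges F \<Longrightarrow>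
      e \<in> edges F' \<Longrightarrow> i = j"
  shows "tiling \<G> V (\<Union>i\<in>I. S i) \<and> card (\<Union>i\<in>I. S i) = (\<Sum>i\<in>I. card (S i))"
proof
  show "tiling \<G> V (\<Union>i\<in>I. S i)"
    unfolding tiling_def
  proof (intro conjI)
    show "pairwise (\<lambda>F F'. disjnt (edges F) (edges F')) (\<Union>i\<in>I. S i)"
    proof (rule pairwiseI)
      fix F F' assume "F \<in> (\<Union>i\<in>I. S i)" "F' \<in> (\<Union>i\<in>I. S i)" and ne: "F \<noteq> F'"
      then obtain i j where ij: "i \<in> I" "j \<in> I" "F \<in> S i" "F' \<in> S j" by blast
      show "disjnt (edges F) (edges F')"
      proof (cases "i = j")
        case True
        then show ?thesis
          using assms(2)[OF ij(1)] ij ne by (auto simp: tiling_def pairwise_def)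
      next
        case False
        then show ?thesis
          using disj[OF ij] by (auto simp: disjnt_iff)
      qed
    qed
  qed (use assms(1,2) in \<open>auto simp: tiling_def\<close>)
  show "card (\<Union>i\<in>I. S i) = (\<Sum>i\<in>I. card (S i))"
  proof (rule card_UN_disjoint[OF assms(1)])
    show "\<forall>i\<in>I. finite (S i)"
      using assms(2) by (auto simp: tiling_def)
    show "\<forall>i\<in>I. \<forall>j\<in>I. i \<noteq> j \<longrightarrow> S i \<inter> S j = {}"
    proof (intro ballI impI, rule ccontr)
      fix i j assume ij: "i \<in> I" "j \<in> I" "i \<noteq> j" "S i \<inter> S j \<noteq> {}"
      then obtain F where F: "F \<in> S i" "F \<in> S j" by blast
      then have "F \<in> \<G>" using assms(2)[OF ij(1)] by (auto simp: tiling_def)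
      then obtain e where "e \<in> edges F" using assms(3) by blast
      then show False using disj[OF ij(1,2) F] ij(3) by blast
    qed
  qed
qed

section \<open>Quadratic polynomials modulo m as blocks of transversal designs\<close>

text \<open>60 is the least common multiple of 1, ..., 5, so every difference of two column indices
  becomes a unit modulo \<open>m\<close>.\<close>

lemma coprime_60_diff:
  fixes m i j :: int
  assumes "coprime m 60" "i \<in> {0..5}" "j \<in> {0..5}" "i \<noteq> j"
  shows "coprime m (i - j)"
proof -
  define d where "d = i - j"
  have "-5 \<le> d" "d \<le> 5" "d \<noteq> 0"
    using assms by (auto simp: d_def)
  then have "d = -5 \<or> d = -4 \<or> d = -3 \<or> d = -2 \<or> d = -1 \<or> d = 1 \<or> d = 2 \<or> d = 3 \<or> d = 4 \<or> d = 5"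
    by presburger
  then have "(i - j) dvd 60"
    unfolding d_def[symmetric] by auto
  then show ?thesis
    using assms(1) coprime_divisors[of m m "i - j" 60] by simp
qed

text \<open>Newton's divided differences: a quadratic polynomial with three zeros modulo
  \<open>m\<close> whose differences are units has only zero coefficients modulo
  \<open>m\<close>.\<close>

lemma dvd_quadratic:
  fixes m A B C i j k :: int
  assumes "coprime m 60" "{i, j, k} \<subseteq> {0..5}" "i \<noteq> j" "i \<noteq> k" "j \<noteq> k"
    and "m dvd A + i * B + i * i * C" "m dvd A + j * B + j * j * C" "m dvd A + k * B + k * k * C"
  shows "m dvd A \<and> m dvd B \<and> m dvd C"
proof -
  have cop: "coprime m (i - j)" "coprime m (i - k)" "coprime m (j - k)"
    using coprime_60_diff assms(1-5) by auto
  have "m dvd (i - j) * (B + (i + j) * C)"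
    using dvd_diff[OF assms(6,7)] by (simp add: algebra_simps)
  then have 1: "m dvd B + (i + j) * C"
    using cop(1) by (simp add: coprime_dvd_mult_right_iff)
  have "m dvd (i - k) * (B + (i + k) * C)"
    using dvd_diff[OF assms(6,8)] by (simp add: algebra_simps)
  then have 2: "m dvd B + (i + k) * C"
    using cop(2) by (simp add: coprime_dvd_mult_right_iff)
  have "m dvd (j - k) * C"
    using dvd_diff[OF 1 2] by (simp add: algebra_simps)
  then have C: "m dvd C"
    using cop(3) by (simp add: coprime_dvd_mult_right_iff)
  have B: "m dvd B"
    using dvd_diff[OF 1 dvd_mult[OF C, of "i + j"]] by simp
  have "m dvd A + i * B"
    using dvd_diff[OF assms(6) dvd_mult[OF C, of "i * i"]] by simp
  then have "m dvd A"
    using dvd_diff[OF _ dvd_mult[OF B, of i], of "A + i * B"] by simp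
  then show ?thesis using B C by blast
qed

text \<open>Here \<open>c\<close> selects a design, \<open>(a, b)\<close> a block of it, and the
  value is the entry of that block in column \<open>i\<close>.\<close>

definition curve :: "nat \<Rightarrow> nat \<Rightarrow> nat \<Rightarrow> nat \<Rightarrow> nat \<Rightarrow> nat" where
  "curve m c a b i = (a + i * b + i * i * c) mod m"

lemma curve_eq_dvd:
  assumes "curve m c a b i = curve m c' a' b' i"
  shows "int m dvd (int a - int a') + int i * (int b - int b') + int i * int i * (int c - int c')"
proof -
  have "int (a + i * b + i * i * c) mod int m = int (a' + i * b' + i * i * c') mod int m"
    using assms unfolding curve_def by (metis zmod_int)
  then show ?thesis
    by (simp add: mod_eq_dvd_iff algebra_simps)
qed

lemma int_dvd_diff_eq:
  assumes "int m dvd int a - int b" "a < m" "b < m"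
  shows "a = b"
proof -
  have "int a mod int m = int b mod int m"
    using assms(1) by (simp add: mod_eq_dvd_iff)
  then show ?thesis using assms(2,3) by simp
qed

text \<open>For equal \<open>c\<close> the difference of two polynomials is linear in the column.
  This is the design property that two entries in different columns lie in at most one
  block.\<close>

lemma curve_determined_by_two:
  assumes "coprime m 60" "i < 6" "j < 6" "i \<noteq> j" "a < m" "b < m" "a' < m" "b' < m"
    and "curve m c a b i = curve m c a' b' i" "curve m c a b j = curve m c a' b' j"
  shows "a = a' \<and> b = b'"
proof -
  let ?A = "int a - int a'" and ?B = "int b - int b'"
  have 1: "int m dvd ?A + int i * ?B" "int m dvd ?A + int j * ?B"
    using curve_eq_dvd[OF assms(9)] curve_eq_dvd[OF assms(10)] by simp_all
  have "int m dvd (int i - int j) * ?B"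
    using dvd_diff[OF 1] by (simp add: algebra_simps)
  moreover have "coprime (int m) (int i - int j)"
    using assms(1-4) by (intro coprime_60_diff) (auto simp: coprime_int_iff[of m 60, simplified])
  ultimately have B: "int m dvd ?B"
    by (simp add: coprime_dvd_mult_right_iff)
  have "int m dvd ?A"
    using dvd_diff[OF 1(1) dvd_mult[OF B, of "int i"]] by simp
  then show ?thesis
    using B int_dvd_diff_eq assms by blast
qed

lemma curve_determined_by_three:
  assumes "coprime m 60" "i < 6" "j < 6" "k < 6" "i \<noteq> j" "i \<noteq> k" "j \<noteq> k"
    and "a < m" "b < m" "c < m" "a' < m" "b' < m" "c' < m"
    and "curve m c a b i = curve m c' a' b' i" "curve m c a b j = curve m c' a' b' j"
      "curve m c a b k = curve m c' a' b' k"
  shows "a = a' \<and> b = b' \<and> c = c'"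
proof -
  have "coprime (int m) 60"
    using assms(1) by (simp add: coprime_int_iff[of m 60, simplified])
  then have "int m dvd int a - int a' \<and> int m dvd int b - int b' \<and> int m dvd int c - int c'"
    using assms(2-7) curve_eq_dvd[OF assms(14)] curve_eq_dvd[OF assms(15)] curve_eq_dvd[OF assms(16)]
    by (intro dvd_quadratic[of "int m" "int i" "int j" "int k"]) auto
  then show ?thesis
    using int_dvd_diff_eq assms by blast
qed

text \<open>
  The blocks \<open>{(i, a + b i + c i\<^sup>2) | i < 6}\<close> with fixed \<open>c\<close> form a transversal design.
  Three points determine \<open>(a, b, c)\<close>, so a set of few bad triples spoils few blocks for some \<open>c\<close>.
\<close>

lemma exists_good_transversal_design:
  fixes bad :: "nat \<Rightarrow> nat \<Rightarrow> nat \<Rightarrow> nat \<Rightarrow> nat \<Rightarrow> nat \<Rightarrow> bool"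
  assumes m: "coprime m 60" "0 < m"
    and bad: "\<And>i j k. i < 6 \<Longrightarrow> j < 6 \<Longrightarrow> k < 6 \<Longrightarrow>
      card {(x, y, z) \<in> {..<m} \<times> {..<m} \<times> {..<m}. bad i j k x y z} \<le> K"
  shows "\<exists>c<m. m * card {(a, b) \<in> {..<m} \<times> {..<m}. \<exists>i j k. i < 6 \<and> j < 6 \<and> k < 6 \<and>
      i \<noteq> j \<and> i \<noteq> k \<and> j \<noteq> k \<and> bad i j k (curve m c a b i) (curve m c a b j) (curve m c a b k)} \<le> 216 * K"
proof -
  \<comment> \<open>The factor 216 is the crude bound 6^3 for the number of these column
    triples.\<close>
  define Q :: "(nat \<times> nat \<times> nat) set" where
    "Q = {(i, j, k). i < 6 \<and> j < 6 \<and> k < 6 \<and> i \<noteq> j \<and> i \<noteq> k \<and> j \<noteq> k}"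
  define Z where "Z = (\<lambda>(i, j, k). {(c, a, b) \<in> {..<m} \<times> {..<m} \<times> {..<m}.
    bad i j k (curve m c a b i) (curve m c a b j) (curve m c a b k)})"
  define B where "B = (\<lambda>c. {(a, b) \<in> {..<m} \<times> {..<m}. \<exists>i j k. i < 6 \<and> j < 6 \<and> k < 6 \<and>
      i \<noteq> j \<and> i \<noteq> k \<and> j \<noteq> k \<and> bad i j k (curve m c a b i) (curve m c a b j) (curve m c a b k)})"
  have Qsub: "Q \<subseteq> {..<6} \<times> {..<6} \<times> {..<6}" by (auto simp: Q_def)
  then have Q: "finite Q" "card Q \<le> 216"
    using card_mono[OF _ Qsub] finite_subset[OF Qsub] by (simp_all add: card_cartesian_product)
  have "card (Z q) \<le> K" if "q \<in> Q" for q
  proof -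
    obtain i j k where q: "q = (i, j, k)" "i < 6" "j < 6" "k < 6" "i \<noteq> j" "i \<noteq> k" "j \<noteq> k"
      using \<open>q \<in> Q\<close> by (auto simp: Q_def)
    let ?f = "\<lambda>(c, a, b). (curve m c a b i, curve m c a b j, curve m c a b k)"
    have "inj_on ?f (Z q)"
    proof (rule inj_onI)
      fix \<tau> \<tau>' assume *: "\<tau> \<in> Z q" "\<tau>' \<in> Z q" "?f \<tau> = ?f \<tau>'"
      obtain c a b c' a' b' where \<tau>: "\<tau> = (c, a, b)" "\<tau>' = (c', a', b')"
        by (metis surj_pair)
      then have "a < m" "b < m" "c < m" "a' < m" "b' < m" "c' < m"
        using *(1,2) by (simp_all add: Z_def q(1))
      then show "\<tau> = \<tau>'"
        using curve_determined_by_three[OF m(1) q(2-7), of a b c a' b' c'] *(3) by (simp add: \<tau>)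
    qed
    moreover have "?f ` Z q \<subseteq> {(x, y, z) \<in> {..<m} \<times> {..<m} \<times> {..<m}. bad i j k x y z}"
      using m(2) by (auto simp: Z_def q(1) curve_def)
    moreover have "finite {(x, y, z) \<in> {..<m} \<times> {..<m} \<times> {..<m}. bad i j k x y z}"
      by (rule finite_subset[of _ "{..<m} \<times> {..<m} \<times> {..<m}"]) auto
    ultimately have "card (Z q) \<le> card {(x, y, z) \<in> {..<m} \<times> {..<m} \<times> {..<m}. bad i j k x y z}"
      by (rule card_inj_on_le)
    then show ?thesis using bad[OF q(2-4)] by simp
  qed
  have finB: "finite (B c)" for c
    by (rule finite_subset[of _ "{..<m} \<times> {..<m}"]) (auto simp: B_def)
  have finZ: "finite (Z q)" for q
    by (rule finite_subset[of _ "{..<m} \<times> {..<m} \<times> {..<m}"]) (auto simp: Z_def split: prod.splits)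
  have "(\<Sum>c<m. card (B c)) = card (SIGMA c:{..<m}. B c)"
    using finB by simp
  also have "\<dots> \<le> card (\<Union>q\<in>Q. Z q)"
  proof (rule card_mono)
    show "finite (\<Union>q\<in>Q. Z q)" using Q finZ by blast
    show "(SIGMA c:{..<m}. B c) \<subseteq> (\<Union>q\<in>Q. Z q)"
      by (fastforce simp: B_def Z_def Q_def)
  qed
  also have "\<dots> \<le> (\<Sum>q\<in>Q. card (Z q))"
    by (rule card_UN_le[OF Q(1)])
  also have "\<dots> \<le> (\<Sum>q\<in>Q. K)"
    using \<open>\<And>q. q \<in> Q \<Longrightarrow> card (Z q) \<le> K\<close> by (rule sum_mono)
  also have "\<dots> \<le> 216 * K"
    using Q(2) by simp
  finally have total: "(\<Sum>c<m. card (B c)) \<le> 216 * K" .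
  \<comment> \<open>Averaging over the \<open>m\<close> values of \<open>c\<close>.\<close>
  have "\<exists>c<m. m * card (B c) \<le> 216 * K"
  proof (rule ccontr)
    assume "\<not> ?thesis"
    then have "\<And>c. c < m \<Longrightarrow> 216 * K < m * card (B c)" by auto
    then have "(\<Sum>c<m. 216 * K) < (\<Sum>c<m. m * card (B c))"
      using m(2) by (intro sum_strict_mono) auto
    then have "m * (216 * K) < m * (\<Sum>c<m. card (B c))"
      by (simp add: sum_distrib_left)
    then show False using total by simp
  qed
  then show ?thesis by (simp add: B_def)
qed

section \<open>Plane copies of \<open>Theta1\<close> from a design on twin pairs\<close>

text \<open>The entries of the design are twin pairs. A triple of entries is bad if one of the four
  lines through copies of the first two fails to have the third pair on one side. Bad triples are
  few, because every pair has at most \<open>K\<close> cuts, and each block without them carries 12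
  copies.\<close>

lemma cross_tiling_of_twins:
  fixes V :: "point set" and P :: "nat \<Rightarrow> nat \<Rightarrow> nat \<Rightarrow> point"
  assumes V: "finite V" "general_position V" and m: "coprime m 60" "0 < m"
    and PV: "\<And>i x s. i < 6 \<Longrightarrow> x < m \<Longrightarrow> s < 2 \<Longrightarrow> P i x s \<in> V"
    and Pinj: "\<And>i x s j y t. i < 6 \<Longrightarrow> x < m \<Longrightarrow> s < 2 \<Longrightarrow> j < 6 \<Longrightarrow> y < m \<Longrightarrow> t < 2 \<Longrightarrow>
      P i x s = P j y t \<longleftrightarrow> i = j \<and> x = y \<and> s = t"
    and K: "\<And>i x. i < 6 \<Longrightarrow> x < m \<Longrightarrow> card (cuts V (P i x 0) (P i x 1)) \<le> K"
    and G: "simple_graph G" "isomorphic Theta1 G" "num_edges G > 0"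
  shows "\<exists>S. tiling (plane_drawings G) V S \<and> 12 * m * m \<le> card S + 12 * (216 * K) \<and>
    (\<forall>F\<in>S. \<forall>e\<in>edges F. \<exists>i<6. \<exists>j<6. \<exists>x<m. \<exists>y<m. \<exists>s<2. \<exists>t<2. i \<noteq> j \<and> e = {P i x s, P j y t})"
proof -
  define bad where "bad = (\<lambda>i j k x y z. \<exists>s<2. \<exists>t<2.
    \<not> 0 < orient (P i x s) (P j y t) (P k z 0) * orient (P i x s) (P j y t) (P k z 1))"
  \<comment> \<open>Recovers the row of a point. A cut together with the index of the cut pair then
    determines the bad triple it causes, so there are at most as many bad triples as cuts.\<close>
  define ind where "ind = (\<lambda>p. SOME x. \<exists>i s. i < 6 \<and> x < m \<and> s < 2 \<and> p = P i x s)"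
  have ind: "ind (P i x s) = x" if "i < 6" "x < m" "s < 2" for i x s
    unfolding ind_def using that Pinj by (intro some_equality) blast+
  have bad_le: "card {(x, y, z) \<in> {..<m} \<times> {..<m} \<times> {..<m}. bad i j k x y z} \<le> m * K"
    if "i < 6" "j < 6" "k < 6" for i j k
  proof -
    let ?C = "SIGMA z:{..<m}. cuts V (P k z 0) (P k z 1)"
    have fin: "finite (cuts V u v)" for u v
      by (rule finite_subset[of _ "V \<times> V"]) (use V in \<open>auto simp: cuts_def\<close>)
    have "{(x, y, z) \<in> {..<m} \<times> {..<m} \<times> {..<m}. bad i j k x y z}
        \<subseteq> (\<lambda>(z, p, q). (ind p, ind q, z)) ` ?C"
    proof
      fix \<tau> assume "\<tau> \<in> {(x, y, z) \<in> {..<m} \<times> {..<m} \<times> {..<m}. bad i j k x y z}"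
      then obtain x y z where \<tau>: "\<tau> = (x, y, z)" "x < m" "y < m" "z < m" "bad i j k x y z" by auto
      then obtain s t where st: "s < 2" "t < 2"
        "\<not> 0 < orient (P i x s) (P j y t) (P k z 0) * orient (P i x s) (P j y t) (P k z 1)"
        unfolding bad_def by blast
      have "(z, P i x s, P j y t) \<in> ?C"
        using st \<tau> PV that by (simp add: cuts_def)
      moreover have "\<tau> = (\<lambda>(z, p, q). (ind p, ind q, z)) (z, P i x s, P j y t)"
        using ind that st \<tau> by simp
      ultimately show "\<tau> \<in> (\<lambda>(z, p, q). (ind p, ind q, z)) ` ?C" by blast
    qed
    then have "card {(x, y, z) \<in> {..<m} \<times> {..<m} \<times> {..<m}. bad i j k x y z} \<le> card ?C"
      using fin by (intro surj_card_le) auto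
    also have "\<dots> = (\<Sum>z<m. card (cuts V (P k z 0) (P k z 1)))"
      using fin by simp
    also have "\<dots> \<le> (\<Sum>z<m. K)"
      using K that by (intro sum_mono) auto
    finally show ?thesis by simp
  qed
  have "\<exists>c<m. m * card {(a, b) \<in> {..<m} \<times> {..<m}. \<exists>i j k. i < 6 \<and> j < 6 \<and> k < 6 \<and>
      i \<noteq> j \<and> i \<noteq> k \<and> j \<noteq> k \<and> bad i j k (curve m c a b i) (curve m c a b j) (curve m c a b k)}
      \<le> 216 * (m * K)"
    by (rule exists_good_transversal_design[OF m, of bad "m * K"]) (rule bad_le)
  then obtain c where c: "c < m" "m * card {(a, b) \<in> {..<m} \<times> {..<m}. \<exists>i j k. i < 6 \<and> j < 6 \<and> k < 6 \<and>
      i \<noteq> j \<and> i \<noteq> k \<and> j \<noteq> k \<and> bad i j k (curve m c a b i) (curve m c a b j) (curve m c a b k)}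
      \<le> 216 * (m * K)"
    by (elim exE conjE)
  define B where "B = {(a, b) \<in> {..<m} \<times> {..<m}. \<exists>i j k. i < 6 \<and> j < 6 \<and> k < 6 \<and>
      i \<noteq> j \<and> i \<noteq> k \<and> j \<noteq> k \<and> bad i j k (curve m c a b i) (curve m c a b j) (curve m c a b k)}"
  have "m * card B \<le> m * (216 * K)"
    using c(2) by (simp add: B_def mult_ac)
  then have B: "card B \<le> 216 * K" using m(2) by simp
  define I where "I = {..<m} \<times> {..<m} - B"
  define Y where "Y = (\<lambda>(a, b) i s. P i (curve m c a b i) s)"
  have cm: "curve m c a b i < m" for a b i
    using m(2) by (simp add: curve_def)
  have "\<exists>S. tiling (plane_drawings G) V S \<and> card S = 12 \<and> (\<forall>F\<in>S. \<forall>e\<in>edges F.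
      \<exists>i<6. \<exists>j<6. \<exists>s<2. \<exists>t<2. i \<noteq> j \<and> e = {Y ab i s, Y ab j t})" if "ab \<in> I" for ab
  proof -
    obtain a b where ab: "ab = (a, b)" by (cases ab)
    have good: "\<not> bad i j k (curve m c a b i) (curve m c a b j) (curve m c a b k)"
      if "i < 6" "j < 6" "k < 6" "i \<noteq> j" "i \<noteq> k" "j \<noteq> k" for i j k
      using \<open>ab \<in> I\<close> that unfolding I_def B_def ab by blast
    obtain S where "tiling (plane_drawings G) V S" "card S = 12"
      "\<And>F e. F \<in> S \<Longrightarrow> e \<in> edges F \<Longrightarrow> \<exists>i<6. \<exists>j<6. \<exists>s<2. \<exists>t<2. i \<noteq> j \<and> e = {Y ab i s, Y ab j t}"
    proof (rule tiling_of_twin_sextuple[OF V(2), of "Y ab" G])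
      show "Y ab i s \<in> V" if "i < 6" "s < 2" for i s
        using PV cm that by (simp add: Y_def ab)
      show "Y ab i s = Y ab j t \<longleftrightarrow> i = j \<and> s = t" if "i < 6" "s < 2" "j < 6" "t < 2" for i s j t
        using Pinj cm that by (auto simp: Y_def ab)
      show "0 < orient (Y ab i s) (Y ab j t) (Y ab k 0) * orient (Y ab i s) (Y ab j t) (Y ab k 1)"
        if "i < 6" "j < 6" "k < 6" "i \<noteq> j" "i \<noteq> k" "j \<noteq> k" "s < 2" "t < 2" for i j k s t
        using good[OF that(1-6)] that(7,8) unfolding bad_def Y_def ab by auto
      show "isomorphic Theta1 G" by (rule G(2))
    qed blast
    then show ?thesis by blast
  qed
  then obtain S where S: "\<And>ab. ab \<in> I \<Longrightarrow> tiling (plane_drawings G) V (S ab)"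
    "\<And>ab. ab \<in> I \<Longrightarrow> card (S ab) = 12"
    and edges_S: "\<And>ab F e. ab \<in> I \<Longrightarrow> F \<in> S ab \<Longrightarrow> e \<in> edges F \<Longrightarrow>
      \<exists>i<6. \<exists>j<6. \<exists>s<2. \<exists>t<2. i \<noteq> j \<and> e = {Y ab i s, Y ab j t}"
    by metis
  have finI: "finite I" by (simp add: I_def)
  have un: "tiling (plane_drawings G) V (\<Union>ab\<in>I. S ab) \<and> card (\<Union>ab\<in>I. S ab) = (\<Sum>ab\<in>I. card (S ab))"
  proof (rule tiling_UN[OF finI S(1)])
    show "edges F \<noteq> {}" if "F \<in> plane_drawings G" for F
      using plane_drawings_edges[OF G(1,3) that] by simp
    fix ab ab' F F' e
    assume *: "ab \<in> I" "ab' \<in> I" "F \<in> S ab" "F' \<in> S ab'" "e \<in> edges F" "e \<in> edges F'"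
    obtain a b a' b' where ab: "ab = (a, b)" "ab' = (a', b')" by (cases ab, cases ab')
    obtain i j s t where e: "i < 6" "j < 6" "s < 2" "t < 2" "i \<noteq> j" "e = {Y ab i s, Y ab j t}"
      using edges_S[OF *(1,3,5)] by blast
    obtain i' j' s' t' where e': "i' < 6" "j' < 6" "s' < 2" "t' < 2" "i' \<noteq> j'" "e = {Y ab' i' s', Y ab' j' t'}"
      using edges_S[OF *(2,4,6)] by blast
    have "{Y ab i s, Y ab j t} = {Y ab' i' s', Y ab' j' t'}"
      using e(6) e'(6) by simp
    then have "Y ab i s = Y ab' i' s' \<and> Y ab j t = Y ab' j' t' \<or> Y ab i s = Y ab' j' t' \<and> Y ab j t = Y ab' i' s'"
      by (rule iffD1[OF doubleton_eq_iff])
    \<comment> \<open>A point determines its column and row, so in either case the two blocks agree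
      in the columns \<open>i\<close> and \<open>j\<close>.\<close>
    then have "curve m c a b i = curve m c a' b' i \<and> curve m c a b j = curve m c a' b' j"
      using Pinj cm e(1-4) e'(1-4) unfolding ab Y_def prod.case by metis
    moreover have "a < m" "b < m" "a' < m" "b' < m"
      using *(1,2) by (auto simp: I_def ab)
    ultimately have "a = a' \<and> b = b'"
      using curve_determined_by_two[OF m(1) e(1,2,5), of a b a' b' c] by blast
    then show "ab = ab'" by (simp add: ab)
  qed
  show ?thesis
  proof (intro exI[of _ "\<Union>ab\<in>I. S ab"] conjI ballI)
    show "tiling (plane_drawings G) V (\<Union>ab\<in>I. S ab)" using un by blast
    have "card (\<Union>ab\<in>I. S ab) = 12 * card I"
      using un S(2) by simp
    moreover have "m * m - card B \<le> card I"
    proof -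
      have "finite B"
        by (rule finite_subset[of _ "{..<m} \<times> {..<m}"]) (auto simp: B_def)
      from diff_card_le_card_Diff[OF this, of "{..<m} \<times> {..<m}"] show ?thesis
        by (simp add: I_def card_cartesian_product)
    qed
    ultimately show "12 * m * m \<le> card (\<Union>ab\<in>I. S ab) + 12 * (216 * K)"
      using B by linarith
    fix F e assume "F \<in> (\<Union>ab\<in>I. S ab)" "e \<in> edges F"
    then obtain ab where "ab \<in> I" "F \<in> S ab" by blast
    from edges_S[OF this \<open>e \<in> edges F\<close>] obtain i j s t where
      *: "i < 6" "j < 6" "s < 2" "t < 2" "i \<noteq> j" "e = {Y ab i s, Y ab j t}" by blast
    obtain a b where "ab = (a, b)" by (cases ab)
    then have "e = {P i (curve m c a b i) s, P j (curve m c a b j) t}"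
      using *(6) by (simp add: Y_def)
    then show "\<exists>i<6. \<exists>j<6. \<exists>x<m. \<exists>y<m. \<exists>s<2. \<exists>t<2. i \<noteq> j \<and> e = {P i x s, P j y t}"
      using *(1-5) cm[of a b i] cm[of a b j] by blast
  qed
qed

lemma tileable_Theta1:
  assumes G: "simple_graph G" "isomorphic Theta1 G" "num_edges G = 5" and "\<alpha> < 1"
  shows "tileable (plane_drawings G) 5 \<alpha>"
proof (rule cross_tileable_imp_tileable[OF _ _ _ \<open>\<alpha> < 1\<close>])
  show "simple_graph F \<and> edges F \<noteq> {}" if "F \<in> plane_drawings G" for F
    using plane_drawings_edges[OF G(1) _ that] G(3) by simp
  show "(2::nat) \<le> 6" by simp
  fix \<eta> :: real assume \<eta>: "0 < \<eta>" "\<eta> < 1"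
  \<comment> \<open>36504 = 216 * 13^2: with n \<le> 13 m, the at most 216 K spoilt blocks are at
    most the fraction \<eta> of all m^2 blocks.\<close>
  define \<epsilon> where "\<epsilon> = \<eta> / 36504"
  have "\<epsilon> > 0" using \<eta> by (simp add: \<epsilon>_def)
  then obtain N n0 where twins: "\<And>V U. finite V \<Longrightarrow> general_position V \<Longrightarrow> n0 \<le> card V \<Longrightarrow> U \<subseteq> V \<Longrightarrow>
    N \<le> card U \<Longrightarrow> \<exists>u\<in>U. \<exists>v\<in>U. u \<noteq> v \<and> real (card (cuts V u v)) \<le> \<epsilon> * real (card V)^2"
    using exists_twins by metis
  obtain n1 :: nat where n1: "real (N + 732) / \<eta> < real n1"
    using reals_Archimedean2 by blast
  show "cross_tileable (plane_drawings G) 5 6 \<eta>"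
    unfolding cross_tileable_def
  proof (intro exI[of _ "max n0 (max n1 (13 * (N + 732)))"] allI impI)
    fix V :: "point set"
    assume *: "finite V \<and> general_position V \<and> max n0 (max n1 (13 * (N + 732))) \<le> card V"
    define n where "n = card V"
    have V: "finite V" "general_position V" "n0 \<le> card V" and n: "n1 \<le> n" "13 * (N + 732) \<le> n"
      using * by (auto simp: n_def)
    \<comment> \<open>The largest number congruent to 1 modulo 60, hence coprime to 60, for which 6
      m twin pairs leave \<open>N\<close> points over. The two roundings cost at most 12 * 60 + 12 =
      732 further points.\<close>
    define m where "m = 60 * (((n - N) div 12 - 1) div 60) + 1"
    have m_le: "12 * m + N \<le> n" and m_ge: "n \<le> 12 * m + (N + 732)"
    proof -
      define k where "k = (n - N) div 12"
      have k: "12 * k \<le> n - N" "n - N < 12 * k + 12" "1 \<le> k"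
        using n(2) by (auto simp: k_def)
      have "m \<le> k" "k \<le> m + 60"
        using k(3) unfolding m_def k_def[symmetric] by linarith+
      then show "12 * m + N \<le> n" "n \<le> 12 * m + (N + 732)"
        using k n(2) by linarith+
    qed
    \<comment> \<open>The points outside the twin pairs are at most a thirteenth of
      \<open>V\<close>, so 12 n / 13 \<le> 12 m.\<close>
    have m13: "n \<le> 13 * m"
    proof -
      have "12 * n \<le> 12 * (13 * m)" if "n \<le> 12 * m + r" "13 * r \<le> n" for r
        using that by linarith
      from this[OF m_ge n(2)] show ?thesis by simp
    qed
    have m: "coprime m 60" "0 < m"
    proof -
      have "coprime (60 * l + 1) (60::nat)" for l
      proof (rule coprimeI)
        fix d assume d: "d dvd 60 * l + 1" "d dvd (60::nat)"
        have "d dvd 60 * l" using d(2) by (rule dvd_mult2)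
        then show "is_unit d" using d(1) by (metis dvd_add_right_iff)
      qed
      then show "coprime m 60" by (simp add: m_def)
    qed (simp add: m_def)
    define K where "K = nat \<lfloor>\<epsilon> * real n^2\<rfloor>"
    have "\<exists>u\<in>U. \<exists>v\<in>U. u \<noteq> v \<and> card (cuts V u v) \<le> K" if "U \<subseteq> V" "N \<le> card U" for U
      using twins[OF V that] unfolding K_def n_def by (metis le_nat_floor)
    then obtain u :: "nat \<Rightarrow> nat \<Rightarrow> point" where "\<forall>i<6 * m. \<forall>s<2. u i s \<in> V"
      "\<forall>i<6 * m. \<forall>s<2. \<forall>j<6 * m. \<forall>t<2. u i s = u j t \<longleftrightarrow> i = j \<and> s = t"
      "\<forall>i<6 * m. card (cuts V (u i 0) (u i 1)) \<le> K"
      using exists_twin_pairs[OF V(1), of N "\<lambda>u v. card (cuts V u v) \<le> K" "6 * m"] m_le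
      unfolding n_def by auto
    note u = this[rule_format]
    define P where "P = (\<lambda>i x. u (i * m + x))"
    have idx: "i * m + x < 6 * m" if "i < 6" "x < m" for i x
    proof -
      have "i * m \<le> 5 * m" using that by (intro mult_le_mono1) simp
      then show ?thesis using that by linarith
    qed
    have idx_inj: "i * m + x = j * m + y \<longleftrightarrow> i = j \<and> x = y" if "x < m" "y < m" for i x j y
    proof
      assume eq: "i * m + x = j * m + y"
      have "(i * m + x) div m = i \<and> (i * m + x) mod m = x" "(j * m + y) div m = j \<and> (j * m + y) mod m = y"
        using that by simp_all
      then show "i = j \<and> x = y" using eq by metis
    qed simp
    have PV: "P i x s \<in> V" if "i < 6" "x < m" "s < 2" for i x s
      using u(1) idx that by (simp add: P_def)
    have Pinj: "P i x s = P j y t \<longleftrightarrow> i = j \<and> x = y \<and> s = t"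
      if "i < 6" "x < m" "s < 2" "j < 6" "y < m" "t < 2" for i x s j y t
      unfolding P_def using u(2)[OF idx[OF that(1,2)] that(3) idx[OF that(4,5)] that(6)] idx_inj that by auto
    have PK: "card (cuts V (P i x 0) (P i x 1)) \<le> K" if "i < 6" "x < m" for i x
      using u(3) idx that by (simp add: P_def)
    have "num_edges G > 0" using G(3) by simp
    have "\<exists>S. tiling (plane_drawings G) V S \<and> 12 * m * m \<le> card S + 12 * (216 * K) \<and>
      (\<forall>F\<in>S. \<forall>e\<in>edges F. \<exists>i<6. \<exists>j<6. \<exists>x<m. \<exists>y<m. \<exists>s<2. \<exists>t<2. i \<noteq> j \<and> e = {P i x s, P j y t})"
      by (rule cross_tiling_of_twins[OF V(1,2) m _ _ _ G(1,2) \<open>num_edges G > 0\<close>])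
        (rule PV Pinj PK; assumption)+
    then obtain S where S: "tiling (plane_drawings G) V S" "12 * m * m \<le> card S + 12 * (216 * K)"
      and S_edges: "\<forall>F\<in>S. \<forall>e\<in>edges F.
        \<exists>i<6. \<exists>j<6. \<exists>x<m. \<exists>y<m. \<exists>s<2. \<exists>t<2. i \<noteq> j \<and> e = {P i x s, P j y t}"
      by (elim exE conjE)
    note edges_S = S_edges[rule_format]
    define W where "W = (\<lambda>i. (\<lambda>(x, s). P i x s) ` ({..<m} \<times> {..<2}))"
    have W: "P i x s \<in> W j \<longleftrightarrow> i = j" if "i < 6" "x < m" "s < 2" "j < 6" for i x s j
      using that Pinj by (auto simp: W_def)
    \<comment> \<open>Six columns of 2 m points have 15 * 4 m^2 = 60 m^2 cross edges; m^2 blocks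
      with 12 copies of five edges would use them all.\<close>
    have "cross_tiling (plane_drawings G) 5 6 \<eta> V W (2 * m) S"
      unfolding cross_tiling_def
    proof (intro conjI allI impI ballI)
      fix i :: nat assume i: "i < 6"
      show "W i \<subseteq> V" using PV i by (auto simp: W_def)
      have "inj_on (\<lambda>(x, s). P i x s) ({..<m} \<times> {..<2})"
        using Pinj i by (auto simp: inj_on_def)
      then show "card (W i) = 2 * m"
        by (simp add: W_def card_image card_cartesian_product)
      fix j :: nat assume j: "j < 6" "i \<noteq> j"
      show "W i \<inter> W j = {}"
        using Pinj i j by (auto simp: W_def)
    next
      have "real (N + 732) \<le> \<eta> * real n"
      proof -
        have "real (N + 732) < \<eta> * real n1"
          using n1 \<eta> by (simp add: divide_less_eq mult.commute)
        also have "\<dots> \<le> \<eta> * real n" using n(1) \<eta> by simp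
        finally show ?thesis by simp
      qed
      moreover have "real n \<le> 12 * real m + real (N + 732)"
        using m_ge by linarith
      ultimately show "(1 - \<eta>) * real (card V) \<le> real (6 * (2 * m))"
        by (simp add: n_def algebra_simps)
    next
      fix F d i assume *: "F \<in> S" "d \<in> edges F" and i: "i < (6::nat)"
      obtain a b x y s t where d: "a < 6" "b < 6" "x < m" "y < m" "s < 2" "t < 2" "a \<noteq> b"
        "d = {P a x s, P b y t}"
        using edges_S[OF *] by blast
      show "\<not> d \<subseteq> W i"
        using W[OF d(1,3,5) i] W[OF d(2,4,6) i] d(7) unfolding d(8) by auto
    next
      have "real K \<le> \<epsilon> * real n^2"
        using \<open>\<epsilon> > 0\<close> by (simp add: K_def)
      also have "\<dots> \<le> \<epsilon> * (13 * real m)^2"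
        using m13 \<open>\<epsilon> > 0\<close> by (intro mult_left_mono power_mono) linarith+
      also have "\<dots> = \<eta> * real m^2 / 216"
        by (simp add: \<epsilon>_def power_mult_distrib)
      finally have "216 * real K \<le> \<eta> * real m^2" by simp
      moreover have "real (12 * m * m) \<le> real (card S + 12 * (216 * K))"
        using S(2) by (rule of_nat_mono)
      ultimately have "12 * real m^2 - 12 * (\<eta> * real m^2) \<le> real (card S)"
        by (simp add: power2_eq_square)
      then show "(1 - \<eta>) * (real 6 * (real 6 - 1) / 2 * real (2 * m)^2) \<le> real (5 * card S)"
        by (simp add: power_mult_distrib algebra_simps)
    qed (rule S(1))
    then show "\<exists>W w S. cross_tiling (plane_drawings G) 5 6 \<eta> V W w S" by blast
  qed
qed

section \<open>Plane drawings on a parabola\<close>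

definition parabola :: "nat \<Rightarrow> point" where
  "parabola i = vector [real i, (real i)^2]"

text \<open>A Vandermonde determinant. Increasing indices are thus counterclockwise, and the points
  are in convex position in the order of their indices.\<close>

lemma orient_parabola:
  "orient (parabola i) (parabola j) (parabola k)
     = (real j - real i) * (real k - real i) * (real k - real j)"
  by (simp add: orient_def parabola_def power2_eq_square algebra_simps)

lemma inj_parabola: "inj parabola"
proof (rule injI)
  fix i j assume "parabola i = parabola j"
  then have "parabola i $ 1 = parabola j $ 1" by simp
  then show "i = j" by (simp add: parabola_def)
qed

lemma parabola_eq_iff [simp]: "parabola i = parabola j \<longleftrightarrow> i = j"
  using inj_parabola by (auto simp: inj_def)

lemma general_position_parabola: "general_position (parabola ` I)"
  unfolding general_position_iff by (auto simp: orient_parabola)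

lemma complete_drawing_parabola:
  "complete_drawing n (Graph (parabola ` {..<n}) (nsets (parabola ` {..<n}) 2))"
proof -
  have "card (parabola ` {..<n}) = n"
    using card_image[OF inj_on_subset[OF inj_parabola subset_UNIV], of "{..<n}"] by simp
  then show ?thesis
    by (simp add: complete_drawing_def geometric_graph_def simple_graph_def num_verts_def
        general_position_parabola)
qed

text \<open>In the affine dependence of the four points both diagonals have the same total weight,
  positive at each end. Dividing by it gives a point inside both diagonals.\<close>

lemma convex_quadrilateral_crossing:
  assumes "0 < orient i j k" "0 < orient i j l" "0 < orient i k l" "0 < orient j k l"
  shows "crossing {i, k} {j, l}"
proof -
  define A B C D s where "A = orient j k l" and "B = orient i j l" and "C = orient i k l"
    and "D = orient i j k" and "s = A + B"
  have pos: "0 < A" "0 < B" "0 < C" "0 < D" "0 < s"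
    using assms by (simp_all add: A_def B_def C_def D_def s_def)
  have s: "s = C + D"
    by (simp add: s_def A_def B_def C_def D_def orient_def algebra_simps)
  have eq: "A *\<^sub>R i + B *\<^sub>R k = C *\<^sub>R j + D *\<^sub>R l"
    by (simp add: vec_eq_iff forall_2 A_def B_def C_def D_def orient_def algebra_simps)
  define z where "z = (1 / s) *\<^sub>R (A *\<^sub>R i + B *\<^sub>R k)"
  have "i \<noteq> k" "j \<noteq> l"
    using assms by auto
  have "z = (1 - B / s) *\<^sub>R i + (B / s) *\<^sub>R k"
  proof -
    have "1 - B / s = A / s"
      using pos(5) by (simp add: field_simps s_def)
    then show ?thesis by (simp add: z_def scaleR_add_right)
  qed
  moreover have "0 < B / s" "B / s < 1"
    using pos by (simp_all add: s_def)
  ultimately have "z \<in> open_segment i k"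
    using \<open>i \<noteq> k\<close> unfolding in_segment by blast
  moreover have "z \<in> open_segment j l"
  proof -
    have "1 - D / s = C / s"
      using pos(5) by (simp add: field_simps s)
    then have "z = (1 - D / s) *\<^sub>R j + (D / s) *\<^sub>R l"
      by (simp add: z_def eq scaleR_add_right)
    moreover have "0 < D / s" "D / s < 1"
      using pos by (simp_all add: s)
    ultimately show ?thesis
      using \<open>j \<noteq> l\<close> unfolding in_segment by blast
  qed
  ultimately show ?thesis by (rule crossingI)
qed

text \<open>In convex position two chords cross exactly when their ends interleave, so planarity
  becomes a condition on indices.\<close>

definition noncrossing :: "nat set set \<Rightarrow> bool" where
  "noncrossing C \<longleftrightarrow> (\<forall>a b c d. a < b \<longrightarrow> b < c \<longrightarrow> c < d \<longrightarrow> {a, c} \<in> C \<longrightarrow> {b, d} \<notin> C)"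

lemma noncrossing_subset: "noncrossing C \<Longrightarrow> C' \<subseteq> C \<Longrightarrow> noncrossing C'"
  unfolding noncrossing_def by blast

text \<open>Split at the largest neighbour of \<open>a\<close> below \<open>b\<close>.\<close>

lemma card_noncrossing_le:
  assumes "a < b" "C \<subseteq> nsets {a..b} 2" "noncrossing C"
  shows "card C + 1 \<le> 2 * (b - a)"
  using assms
proof (induction "b - a" arbitrary: a b C rule: less_induct)
  case less
  have fin: "finite (nsets {x..y} 2)" for x y :: nat
    by (simp add: finite_imp_finite_nsets)
  show ?case
  proof (cases "b = Suc a")
    case True
    have "{a..b} = {a, b}" using True by auto
    then have "C \<subseteq> {{a, b}}"
      using less.prems(1,2) by (simp add: nsets_doubleton_2_eq)
    then have "card C \<le> 1"
      using card_mono[of "{{a, b}}" C] by simp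
    then show ?thesis using True by simp
  next
    case False
    \<comment> \<open>Admitting \<open>Suc a\<close> even without an edge guarantees a splitting
      vertex strictly between \<open>a\<close> and \<open>b\<close>.\<close>
    define A where "A = {c. a < c \<and> c < b \<and> ({a, c} \<in> C \<or> c = Suc a)}"
    have A: "finite A" "Suc a \<in> A"
      using False less.prems(1) by (auto simp: A_def)
    define c where "c = Max A"
    have "A \<noteq> {}" using A(2) by blast
    then have c: "c \<in> A" "\<And>x. x \<in> A \<Longrightarrow> x \<le> c"
      using A(1) Max_in[of A] Max_ge[of A] by (auto simp: c_def)
    have ac: "a < c" "c < b" using c(1) by (auto simp: A_def)
    have sub: "C \<subseteq> insert {a, b} ((C \<inter> nsets {a..c} 2) \<union> (C \<inter> nsets {c..b} 2))"
    proof
      fix e assume e: "e \<in> C"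
      then obtain i j where ij: "e = {i, j}" "a \<le> i" "i < j" "j \<le> b"
        using less.prems(2) unfolding ordered_nsets_2_eq by auto
      show "e \<in> insert {a, b} ((C \<inter> nsets {a..c} 2) \<union> (C \<inter> nsets {c..b} 2))"
      proof (cases "j \<le> c \<or> c \<le> i")
        case True
        then show ?thesis
          using e ij by auto
      next
        case False
        \<comment> \<open>An edge that spans \<open>c\<close> from another start would interleave
          with {a, c}; one from \<open>a\<close> must end in \<open>b\<close> by maximality of
          \<open>c\<close>.\<close>
        have "i = a"
        proof (rule ccontr)
          assume "i \<noteq> a"
          then have "a < i" "i < c" "c < j" using ij False by auto
          then have "c \<noteq> Suc a" by auto
          then have "{a, c} \<in> C" using c(1) by (auto simp: A_def)
          then show False
            using less.prems(3) e \<open>a < i\<close> \<open>i < c\<close> \<open>c < j\<close> unfolding ij(1) noncrossing_def by blast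
        qed
        moreover have "j = b"
        proof (rule ccontr)
          assume "j \<noteq> b"
          then have "j \<in> A" using e ij \<open>i = a\<close> by (auto simp: A_def)
          then show False using c(2)[of j] False by simp
        qed
        ultimately show ?thesis using ij(1) by simp
      qed
    qed
    have "card C \<le> card (insert {a, b} ((C \<inter> nsets {a..c} 2) \<union> (C \<inter> nsets {c..b} 2)))"
      using sub fin by (intro card_mono) auto
    also have "\<dots> \<le> Suc (card (C \<inter> nsets {a..c} 2) + card (C \<inter> nsets {c..b} 2))"
    proof -
      have "card (insert x S) \<le> Suc (card S)" for x and S :: "nat set set"
        by (cases "finite S") (simp_all add: card_insert_if)
      from this[of "{a, b}" "C \<inter> nsets {a..c} 2 \<union> C \<inter> nsets {c..b} 2"]
        card_Un_le[of "C \<inter> nsets {a..c} 2" "C \<inter> nsets {c..b} 2"]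
      show ?thesis by linarith
    qed
    finally have "card C \<le> Suc (card (C \<inter> nsets {a..c} 2) + card (C \<inter> nsets {c..b} 2))" .
    moreover have "card (C \<inter> nsets {a..c} 2) + 1 \<le> 2 * (c - a)"
      using ac less.prems(3) by (intro less.hyps) (auto intro: noncrossing_subset)
    moreover have "card (C \<inter> nsets {c..b} 2) + 1 \<le> 2 * (b - c)"
      using ac less.prems(3) by (intro less.hyps) (auto intro: noncrossing_subset)
    ultimately show ?thesis using ac by linarith
  qed
qed

lemma cycle_edgeI: "j < length xs \<Longrightarrow> {xs ! j, xs ! (Suc j mod length xs)} \<in> cycle_edges xs"
  by (auto simp: cycle_edges_def)

lemma card_cycle_edges:
  assumes "distinct xs" "length xs \<ge> 3"
  shows "card (cycle_edges xs) = length xs"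
proof -
  let ?n = "length xs"
  have "inj_on (\<lambda>i. {xs ! i, xs ! (Suc i mod ?n)}) {..<?n}"
  proof (rule inj_onI)
    fix i j assume ij: "i \<in> {..<?n}" "j \<in> {..<?n}"
      and eq: "{xs ! i, xs ! (Suc i mod ?n)} = {xs ! j, xs ! (Suc j mod ?n)}"
    have "0 < ?n" using assms(2) by linarith
    then have lt: "i < ?n" "j < ?n" "Suc i mod ?n < ?n" "Suc j mod ?n < ?n"
      using ij by (auto intro: mod_less_divisor)
    have "i = j \<or> (i = Suc j mod ?n \<and> Suc i mod ?n = j)"
      using iffD1[OF doubleton_eq_iff eq] nth_eq_iff_index_eq[OF assms(1)] lt by auto
    moreover have "\<not> (i = Suc j mod ?n \<and> Suc i mod ?n = j)"
      using lt assms(2) by (auto simp: mod_Suc split: if_splits)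
    ultimately show "i = j" by blast
  qed
  then show ?thesis
    by (simp add: cycle_edges_image card_image)
qed

lemma cycle_edges_map: "cycle_edges (map f xs) = (`) f ` cycle_edges xs"
  unfolding cycle_edges_image image_image
proof (intro image_cong)
  fix i assume "i \<in> {..<length xs}"
  then have "i < length xs" "Suc i mod length xs < length xs"
    by (auto intro: mod_less_divisor)
  then show "{map f xs ! i, map f xs ! (Suc i mod length (map f xs))}
      = f ` {xs ! i, xs ! (Suc i mod length xs)}"
    by simp
qed simp

lemma hamiltonian_isomorphic:
  assumes "hamiltonian G" "isomorphic G H"
  shows "hamiltonian H"
proof -
  obtain xs where xs: "distinct xs" "length xs \<ge> 3" "set xs = verts G" "cycle_edges xs \<subseteq> edges G"
    using assms(1) unfolding hamiltonian_def by blast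
  obtain f where f: "inj_on f (verts G)" "H = graph_image f G"
    using assms(2) unfolding isomorphic_def by blast
  have "cycle_edges (map f xs) \<subseteq> edges H"
    using xs(4) by (auto simp: cycle_edges_map f(2) graph_image_def)
  then show ?thesis
    unfolding hamiltonian_def using xs f
    by (intro exI[of _ "map f xs"]) (simp add: distinct_map graph_image_def)
qed

text \<open>
  Removing an edge \<open>{u, v}\<close> from the cycle leaves a path which avoids \<open>u\<close> and \<open>v\<close> in its interior
  and hence stays on one side of \<open>{u, v}\<close>.
\<close>

lemma noncrossing_hamiltonian_cycle:
  assumes xs: "distinct xs" "set xs = {..<k}" "k \<ge> 3"
    and C: "cycle_edges xs \<subseteq> C" "noncrossing C"
  shows "cycle_edges xs = cycle_edges [0..<k]"
proof -
  have len: "length xs = k"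
    using xs distinct_card by fastforce
  have "{u, v} \<in> cycle_edges [0..<k]" if e: "{u, v} \<in> cycle_edges xs" and uv: "u < v" for u v
  proof -
    obtain i where i: "i < k" "{u, v} = {xs ! i, xs ! (Suc i mod k)}"
      using e unfolding cycle_edges_def len by blast
    \<comment> \<open>The rest of the cycle, traversed from one end of the edge to the
      other.\<close>
    define w where "w = (\<lambda>r. xs ! ((Suc i + r) mod k))"
    have w0: "w 0 = xs ! (Suc i mod k)" and wl: "w (k - 1) = xs ! i"
      using i(1) xs(3) by (simp_all add: w_def)
    have ends: "{w 0, w (k - 1)} = {u, v}"
      using i(2) w0 wl by auto
    have wends: "w 0 = u \<or> w 0 = v" "w (k - 1) = u \<or> w (k - 1) = v"
      using ends by blast+
    have step: "{w r, w (Suc r)} \<in> C" for r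
    proof -
      let ?j = "(Suc i + r) mod k"
      have "?j < k" using xs(3) by simp
      moreover have "w (Suc r) = xs ! (Suc ?j mod k)"
        by (simp add: w_def mod_Suc_eq)
      moreover have "w r = xs ! ?j" by (simp add: w_def)
      ultimately show ?thesis
        using cycle_edgeI[of ?j xs] len C(1) by auto
    qed
    have surj: "\<exists>r<k. w r = x" if x: "x < k" for x
    proof -
      obtain j where j: "j < k" "xs ! j = x"
        using x xs(2) len by (metis in_set_conv_nth lessThan_iff)
      let ?r = "(j + (k - Suc i)) mod k"
      have "(Suc i + ?r) mod k = (Suc i + (j + (k - Suc i))) mod k"
        by (rule mod_add_right_eq)
      also have "\<dots> = j" using i(1) j(1) by simp
      finally show ?thesis
        using j xs(3) by (intro exI[of _ ?r]) (simp add: w_def)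
    qed
    have kpos: "0 < k" using xs(3) by linarith
    have wne: "w r \<noteq> w s" if "(Suc i + r) mod k \<noteq> (Suc i + s) mod k" for r s
      unfolding w_def using nth_eq_iff_index_eq[OF xs(1)] that len kpos by simp
    have winj: "w r \<noteq> u \<and> w r \<noteq> v \<and> w r < k" if "0 < r" "r < k - 1" for r
    proof -
      have "(Suc i + r) mod k \<noteq> (Suc i + 0) mod k" "(Suc i + r) mod k \<noteq> (Suc i + (k - 1)) mod k"
      proof -
        have "r < k" "k - 1 < k" "r \<noteq> 0" "r \<noteq> k - 1" using that kpos by auto
        then show "(Suc i + r) mod k \<noteq> (Suc i + 0) mod k" "(Suc i + r) mod k \<noteq> (Suc i + (k - 1)) mod k"
          using mod_add_cancel_nat[of "Suc i" r k 0] mod_add_cancel_nat[of "Suc i" r k "k - 1"] kpos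
          by blast+
      qed
      then have "w r \<noteq> w 0" "w r \<noteq> w (k - 1)"
        using wne by blast+
      moreover have "w r \<in> set xs"
        unfolding w_def using kpos len by (intro nth_mem) simp
      ultimately show ?thesis using ends xs(2) by auto
    qed
    have uvC: "{u, v} \<in> C" using e C(1) by blast
    have same: "(u < w r \<and> w r < v) = (u < w (Suc r) \<and> w (Suc r) < v)"
      if "0 < r" "Suc r < k - 1" for r
    proof (rule ccontr)
      assume ne: "\<not> ?thesis"
      have cross: False if x: "u < x" "x < v" and y: "\<not> (u < y \<and> y < v)" "y \<noteq> u" "y \<noteq> v" "{x, y} \<in> C" for x y
      proof (cases "y < u")
        case True
        have "{y, x} \<in> C" using y(4) by (simp add: insert_commute)
        then show False
          using C(2) True x uvC unfolding noncrossing_def by blast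
      next
        case False
        then have "v < y" using y by auto
        then show False
          using C(2) x y(4) uvC unfolding noncrossing_def by blast
      qed
      have "{w (Suc r), w r} \<in> C" using step[of r] by (simp add: insert_commute)
      then show False
        using ne cross[of "w r" "w (Suc r)"] cross[of "w (Suc r)" "w r"] step[of r] winj that
          winj[of r] winj[of "Suc r"] by auto
    qed
    have const: "(u < w r \<and> w r < v) = (u < w 1 \<and> w 1 < v)" if "0 < r" "r < k - 1" for r
      using that
    proof (induction r)
      case (Suc r)
      then show ?case using same[of r] by (cases "r = 0") auto
    qed simp
    have pos: "\<exists>r. 0 < r \<and> r < k - 1 \<and> w r = x" if x: "x < k" "x \<noteq> u" "x \<noteq> v" for x
    proof -
      obtain r where r: "r < k" "w r = x" using surj[OF x(1)] by blast
      moreover have "r \<noteq> 0" "r \<noteq> k - 1"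
        using r(2) wends x(2,3) by metis+
      ultimately show ?thesis by (intro exI[of _ r]) auto
    qed
    have vk: "v < k"
    proof -
      have "Suc i mod k < k" using kpos by simp
      then have "xs ! i \<in> {..<k}" "xs ! (Suc i mod k) \<in> {..<k}"
        unfolding xs(2)[symmetric] using i(1) len by (auto intro: nth_mem)
      moreover have "v \<in> {xs ! i, xs ! (Suc i mod k)}"
        using i(2) by auto
      ultimately show ?thesis by auto
    qed
    \<comment> \<open>Otherwise some vertex lies strictly between \<open>u\<close> and
      \<open>v\<close> and another one outside, and the path would have to visit both.\<close>
    have "v = Suc u \<or> (u = 0 \<and> v = k - 1)"
    proof (rule ccontr)
      assume neg: "\<not> ?thesis"
      have "u < Suc u" "Suc u < v" using neg uv by auto
      then obtain r where r: "0 < r" "r < k - 1" "w r = Suc u"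
        using pos[of "Suc u"] vk by auto
      obtain y where y: "y < k" "y \<noteq> u" "y \<noteq> v" "\<not> (u < y \<and> y < v)"
      proof (cases "u = 0")
        case True
        then have "v \<noteq> k - 1" using neg by blast
        have "k - 1 < k" "k - 1 \<noteq> u" "k - 1 \<noteq> v" "\<not> k - 1 < v"
          using \<open>v \<noteq> k - 1\<close> vk uv kpos by linarith+
        then show ?thesis using that[of "k - 1"] by blast
      next
        case False
        then show ?thesis using that[of 0] uv vk by auto
      qed
      obtain r' where r': "0 < r'" "r' < k - 1" "w r' = y"
        using pos[OF y(1-3)] by blast
      show False
        using const[OF r(1,2)] const[OF r'(1,2)] r(3) r'(3) y(4) \<open>Suc u < v\<close> by auto
    qed
    then show ?thesis
    proof
      assume "v = Suc u"
      then show ?thesis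
        using cycle_edgeI[of u "[0..<k]"] vk uv by simp
    next
      assume *: "u = 0 \<and> v = k - 1"
      have "Suc (k - 1) mod k = 0" "k - 1 < k"
        using kpos by simp_all
      then have "{k - 1, 0} \<in> cycle_edges [0..<k]"
        using cycle_edgeI[of "k - 1" "[0..<k]"] kpos by simp
      then show ?thesis
        using * by (simp add: insert_commute)
    qed
  qed
  moreover have "\<exists>u v. e = {u, v} \<and> u < v" if "e \<in> cycle_edges xs" for e
  proof -
    obtain i where i: "i < k" "e = {xs ! i, xs ! (Suc i mod k)}"
      using \<open>e \<in> cycle_edges xs\<close> unfolding cycle_edges_def len by blast
    have "i \<noteq> Suc i mod k" using i(1) xs(3) by (auto simp: mod_Suc)
    moreover have "Suc i mod k < k" using xs(3) by simp
    ultimately have "xs ! i \<noteq> xs ! (Suc i mod k)"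
      using nth_eq_iff_index_eq[OF xs(1)] i(1) len by metis
    then show ?thesis
      unfolding i(2) by (metis insert_commute linorder_neqE_nat)
  qed
  ultimately have "cycle_edges xs \<subseteq> cycle_edges [0..<k]" by blast
  moreover have "card (cycle_edges xs) = k" "card (cycle_edges [0..<k]) = k"
    using card_cycle_edges[OF xs(1)] card_cycle_edges[of "[0..<k]"] len xs(3) by auto
  moreover have "finite (cycle_edges [0..<k])"
    by (simp add: cycle_edges_image)
  ultimately show ?thesis
    by (metis card_subset_eq)
qed

text \<open>An outerplane graph whose vertices are numbered along its bounding polygon.\<close>

definition outer_plane :: "nat \<Rightarrow> nat set set \<Rightarrow> bool" where
  "outer_plane k C \<longleftrightarrow> C \<subseteq> nsets {..<k} 2 \<and> noncrossing C \<and> cycle_edges [0..<k] \<subseteq> C"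

text \<open>The indices used are sorted into \<open>s\<close> and the edges renamed by rank.
  Interleaving edges would cross on the parabola, so the edge set is non-crossing and its
  Hamiltonian cycle must be the bounding polygon.\<close>

lemma plane_drawing_on_parabola:
  assumes G: "simple_graph G" "hamiltonian G"
    and F: "F \<in> plane_drawings G" "verts F \<subseteq> parabola ` {..<n}"
  obtains s C where "sorted_wrt (<) s" "set s \<subseteq> {..<n}" "length s = num_verts G" "length s \<ge> 3"
    "F = graph_image (\<lambda>r. parabola (s ! r)) (Graph {..<length s} C)"
    "outer_plane (length s) C" "isomorphic G (Graph {..<length s} C)"
proof -
  have Fp: "simple_graph F" "plane F" "isomorphic G F"
    using F(1) by (auto simp: plane_drawings_def geometric_graph_def)
  define I where "I = {i. parabola i \<in> verts F}"
  have I: "I \<subseteq> {..<n}" "parabola ` I = verts F"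
    using F(2) by (auto simp: I_def)
  then have finI: "finite I" using finite_subset by blast
  define s where "s = sorted_list_of_set I"
  define k where "k = length s"
  have s: "sorted_wrt (<) s" "set s = I" "distinct s"
    using finI by (simp_all add: s_def)
  define f where "f = (\<lambda>r. parabola (s ! r))"
  have f: "inj_on f {..<k}" "f ` {..<k} = verts F"
  proof -
    show "inj_on f {..<k}"
      using s(3) by (auto simp: f_def inj_on_def k_def nth_eq_iff_index_eq)
    have "f ` {..<k} = parabola ` set s"
      unfolding f_def k_def by (auto simp: set_conv_nth image_iff)
    then show "f ` {..<k} = verts F" using s(2) I(2) by simp
  qed
  define H where "H = graph_image (inv_into {..<k} f) F"
  have vH: "verts H = {..<k}"
    using inv_into_image_cancel[OF f(1), of "{..<k}"] by (simp add: H_def graph_image_def flip: f(2))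
  have inj_inv: "inj_on (inv_into {..<k} f) (verts F)"
    by (simp add: inj_on_inv_into flip: f(2))
  have FH: "F = graph_image f H"
    unfolding H_def graph_image_comp
    using graph_image_cong_id[OF Fp(1), of "f \<circ> inv_into {..<k} f"] f(2) by (simp add: f_inv_into_f)
  have "isomorphic F H"
    unfolding isomorphic_def H_def using inj_inv by blast
  then have GH: "isomorphic G H" and sH: "simple_graph H"
    using isomorphic_trans[OF Fp(3)] simple_graph_isomorphic[OF Fp(1)] by blast+
  have kG: "k = num_verts G"
  proof -
    obtain g where "inj_on g (verts G)" "H = graph_image g G"
      using GH unfolding isomorphic_def by blast
    then have "card (verts H) = card (verts G)"
      by (simp add: graph_image_def card_image)
    then show ?thesis by (simp add: vH num_verts_def)
  qed
  define C where "C = edges H"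
  have HC: "H = Graph {..<k} C"
    using vH by (cases H) (simp add: C_def)
  have C2: "C \<subseteq> nsets {..<k} 2"
    using sH vH by (simp add: C_def simple_graph_def)
  have nc: "noncrossing C"
    unfolding noncrossing_def
  proof (intro allI impI notI)
    fix a b c d assume *: "a < b" "b < c" "c < d" "{a, c} \<in> C" "{b, d} \<in> C"
    then have d: "d < k" using C2 by (auto simp: nsets_def)
    then have lt: "s ! a < s ! b" "s ! b < s ! c" "s ! c < s ! d"
      using * sorted_wrt_nth_less[OF s(1)] by (auto simp: k_def)
    have "crossing {f a, f c} {f b, f d}"
      unfolding f_def using lt
      by (intro convex_quadrilateral_crossing) (simp_all add: orient_parabola)
    then have cr: "crossing (f ` {a, c}) (f ` {b, d})"
      by (simp only: image_insert image_empty)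
    have mem: "f ` {a, c} \<in> edges F" "f ` {b, d} \<in> edges F"
      unfolding FH graph_image_def using *(4,5) by (simp_all only: graph.sel C_def[symmetric] imageI)
    have "f ` {a, c} \<noteq> f ` {b, d}"
      using lt by (auto simp: f_def doubleton_eq_iff)
    from Fp(2)[unfolded plane_def, rule_format, OF mem this] cr show False
      by contradiction
  qed
  obtain xs where xs: "distinct xs" "length xs \<ge> 3" "set xs = {..<k}" "cycle_edges xs \<subseteq> C"
    using hamiltonian_isomorphic[OF G(2) GH] unfolding hamiltonian_def C_def vH by blast
  have k3: "k \<ge> 3" using xs(1-3) distinct_card[OF xs(1)] by simp
  have "cycle_edges [0..<k] \<subseteq> C"
    using noncrossing_hamiltonian_cycle[OF xs(1,3) k3 xs(4) nc] xs(4) by simp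
  then have "outer_plane k C"
    using C2 nc by (simp add: outer_plane_def)
  then show ?thesis
    using that[of s C] s I(1) kG k3 FH GH unfolding HC k_def f_def by simp
qed

section \<open>Truncated cyclic lengths\<close>

text \<open>Distance on a cycle of \<open>n\<close> points, cut off at \<open>T\<close>;
  \<open>Max\<close> and \<open>Min\<close> recover the two ends from an unordered pair.\<close>

definition cyclic_length :: "nat \<Rightarrow> nat \<Rightarrow> nat set \<Rightarrow> nat" where
  "cyclic_length n T e = min (min (Max e - Min e) (n - (Max e - Min e))) T"

lemma cyclic_length_pair:
  "i < j \<Longrightarrow> cyclic_length n T {i, j} = min (min (j - i) (n - (j - i))) T"
  by (simp add: cyclic_length_def)

lemma sum_lessThan_add:
  fixes f :: "nat \<Rightarrow> nat"
  shows "(\<Sum>k<j + m. f k) = (\<Sum>k<j. f k) + (\<Sum>k<m. f (j + k))"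
  by (induction m) simp_all

text \<open>Raising the cutoff from T to T + 1 adds one for every distance that is at least T + 1
  both ways round, and there are n - 1 - 2 T of these.\<close>

lemma sum_truncated:
  "2 * T \<le> n \<Longrightarrow> (\<Sum>k<n - 1. min (min (Suc k) (n - Suc k)) T) = T * (n - T)"
proof (induction T)
  case (Suc T)
  have "(\<Sum>k<n - 1. min (min (Suc k) (n - Suc k)) (Suc T))
      = (\<Sum>k<n - 1. min (min (Suc k) (n - Suc k)) T + of_bool (T \<le> k \<and> k < n - Suc T))"
    by (intro sum.cong) auto
  also have "\<dots> = T * (n - T) + (\<Sum>k<n - 1. of_bool (T \<le> k \<and> k < n - Suc T))"
    using Suc by (simp add: sum.distrib)
  also have "(\<Sum>k<n - 1. of_bool (T \<le> k \<and> k < n - Suc T)) = card ({..<n - 1} \<inter> {k. T \<le> k \<and> k < n - Suc T})"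
    by (simp add: sum_of_bool_eq)
  also have "{..<n - 1} \<inter> {k. T \<le> k \<and> k < n - Suc T} = {T..<n - Suc T}"
    by auto
  also have "T * (n - T) + card {T..<n - Suc T} = Suc T * (n - Suc T)"
  proof -
    obtain m where "n = 2 * Suc T + m"
      using Suc.prems le_Suc_ex by blast
    then show ?thesis by (simp add: algebra_simps)
  qed
  finally show ?case .
qed simp

lemma sum_cyclic_length:
  assumes "2 * T \<le> n"
  shows "2 * (\<Sum>e\<in>nsets {..<n} 2. cyclic_length n T e) = n * (T * (n - T))"
proof -
  define l where "l = (\<lambda>d. min (min d (n - d)) T)"
  \<comment> \<open>\<open>B j\<close> and \<open>B (n - Suc j)\<close> are the weights of the edges
    from \<open>j\<close> to smaller and to larger indices. By the symmetry of \<open>l\<close>,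
    together they run over all distances 1, ..., n - 1.\<close>
  define B where "B = (\<lambda>j. \<Sum>k<j. l (Suc k))"
  have l_sym: "l (n - d) = l d" if "d \<le> n" for d
    using that by (simp add: l_def min.commute)
  let ?P = "SIGMA j:{..<n}. {..<j}"
  have img: "nsets {..<n} 2 = (\<lambda>(j, i). {i, j}) ` ?P"
    unfolding ordered_nsets_2_eq by (fastforce simp: image_iff)
  have "inj_on (\<lambda>(j, i). {i, j}) ?P"
    by (auto simp: inj_on_def doubleton_eq_iff)
  then have "(\<Sum>e\<in>nsets {..<n} 2. cyclic_length n T e) = (\<Sum>(j, i)\<in>?P. cyclic_length n T {i, j})"
    unfolding img by (subst sum.reindex) (auto intro!: sum.cong)
  also have "\<dots> = (\<Sum>j<n. \<Sum>i<j. cyclic_length n T {i, j})"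
    by (subst sum.Sigma) auto
  also have "\<dots> = (\<Sum>j<n. B j)"
  proof (intro sum.cong refl)
    fix j
    have "(\<Sum>i<j. cyclic_length n T {i, j}) = (\<Sum>i<j. l (Suc (j - Suc i)))"
      by (intro sum.cong refl) (simp add: cyclic_length_pair l_def Suc_diff_Suc)
    also have "\<dots> = B j"
      unfolding B_def by (rule sum.nat_diff_reindex)
    finally show "(\<Sum>i<j. cyclic_length n T {i, j}) = B j" .
  qed
  finally have A: "(\<Sum>e\<in>nsets {..<n} 2. cyclic_length n T e) = (\<Sum>j<n. B j)" .
  have "(\<Sum>j<n. B j) = (\<Sum>j<n. B (n - Suc j))"
    by (rule sum.nat_diff_reindex[symmetric])
  then have "2 * (\<Sum>j<n. B j) = (\<Sum>j<n. B j + B (n - Suc j))"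
    by (simp add: sum.distrib)
  also have "\<dots> = (\<Sum>j<n. T * (n - T))"
  proof (intro sum.cong refl)
    fix j assume "j \<in> {..<n}"
    then have j: "j < n" by simp
    have "B (n - Suc j) = (\<Sum>k<n - Suc j. l (Suc (n - Suc j - Suc k)))"
      unfolding B_def by (rule sum.nat_diff_reindex[symmetric])
    also have "\<dots> = (\<Sum>k<n - Suc j. l (Suc (j + k)))"
    proof (intro sum.cong refl)
      fix k assume "k \<in> {..<n - Suc j}"
      then have "Suc (n - Suc j - Suc k) = n - Suc (j + k)" "Suc (j + k) \<le> n"
        using j by auto
      then show "l (Suc (n - Suc j - Suc k)) = l (Suc (j + k))"
        using l_sym by metis
    qed
    finally have "B j + B (n - Suc j) = (\<Sum>k<j + (n - Suc j). l (Suc k))"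
      by (simp add: B_def sum_lessThan_add)
    also have "j + (n - Suc j) = n - 1" using j by simp
    also have "(\<Sum>k<n - 1. l (Suc k)) = T * (n - T)"
      unfolding l_def by (rule sum_truncated[OF assms])
    finally show "B j + B (n - Suc j) = T * (n - T)" .
  qed
  finally show ?thesis unfolding A by simp
qed

text \<open>The gaps between consecutive indices, including the one across the end, add up to
  \<open>n\<close>, and a truncated length never exceeds its gap.\<close>

lemma sum_cyclic_length_cycle:
  assumes s: "sorted_wrt (<) s" "set s \<subseteq> {..<n}" and k: "length s = Suc k" "k \<ge> 2"
  shows "(\<Sum>c\<in>cycle_edges [0..<Suc k]. cyclic_length n T ((!) s ` c)) \<le> n"
proof -
  have lt: "s ! i < s ! j" if "i < j" "j \<le> k" for i j
    using sorted_wrt_nth_less[OF s(1) that(1)] that(2) k by simp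
  have ltn: "s ! i < n" if "i \<le> k" for i
    using subsetD[OF s(2), of "s ! i"] nth_mem[of i s] that k by simp
  have le: "cyclic_length n T {s ! i, s ! Suc i} \<le> s ! Suc i - s ! i" if "i < k" for i
    using lt[of i "Suc i"] that by (simp add: cyclic_length_pair)
  have last: "cyclic_length n T {s ! k, s ! 0} \<le> n - (s ! k - s ! 0)"
    using lt[of 0 k] k by (simp add: cyclic_length_pair insert_commute)
  let ?g = "\<lambda>i. {[0..<Suc k] ! i, [0..<Suc k] ! (Suc i mod Suc k)}"
  have g: "?g i = {i, Suc i}" if "i < k" for i
    using that by (simp del: upt_Suc)
  have gk: "?g k = {k, 0}"
    by (simp del: upt_Suc)
  have "(\<Sum>c\<in>cycle_edges [0..<Suc k]. cyclic_length n T ((!) s ` c))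
      \<le> (\<Sum>i<Suc k. cyclic_length n T ((!) s ` ?g i))"
    unfolding cycle_edges_image length_upt
    using sum_image_le[of "{..<Suc k}" "\<lambda>c. cyclic_length n T ((!) s ` c)" ?g] by (simp del: upt_Suc)
  also have "\<dots> = (\<Sum>i<k. cyclic_length n T ((!) s ` ?g i)) + cyclic_length n T ((!) s ` ?g k)"
    by (rule sum.lessThan_Suc)
  also have "\<dots> = (\<Sum>i<k. cyclic_length n T {s ! i, s ! Suc i}) + cyclic_length n T {s ! k, s ! 0}"
    unfolding gk using g by (intro arg_cong2[where f = "(+)"] sum.cong) simp_all
  also have "\<dots> \<le> (\<Sum>i<k. s ! Suc i - s ! i) + (n - (s ! k - s ! 0))"
    using le last by (intro add_mono sum_mono) auto
  also have "(\<Sum>i<k. s ! Suc i - s ! i) = s ! k - s ! 0"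
  proof -
    have "(\<Sum>i<j. s ! Suc i - s ! i) = s ! j - s ! 0" if "j \<le> k" for j
      using that
    proof (induction j)
      case (Suc j)
      then show ?case
        using lt[of j "Suc j"] lt[of 0 j] by (cases "j = 0") auto
    qed simp
    then show ?thesis by simp
  qed
  also have "s ! k - s ! 0 + (n - (s ! k - s ! 0)) = n"
    using ltn[of k] by simp
  finally show ?thesis .
qed

section \<open>Weights of geometric edges and the packing inequality\<close>

definition point_length :: "nat \<Rightarrow> nat \<Rightarrow> point set \<Rightarrow> nat" where
  "point_length n T d = cyclic_length n T {i. parabola i \<in> d}"

lemma point_length_parabola: "point_length n T (parabola ` e) = cyclic_length n T e"
proof -
  have "{i. parabola i \<in> parabola ` e} = e" by auto
  then show ?thesis by (simp add: point_length_def)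
qed

lemma sum_point_length:
  assumes "2 * T \<le> n"
  shows "2 * (\<Sum>d\<in>nsets (parabola ` {..<n}) 2. point_length n T d) = n * (T * (n - T))"
proof -
  have "nsets (parabola ` {..<n}) 2 = (`) parabola ` nsets {..<n} 2"
  proof (intro equalityI subsetI)
    fix d assume "d \<in> nsets (parabola ` {..<n}) 2"
    then obtain i j where "i < n" "j < n" "i \<noteq> j" "d = {parabola i, parabola j}"
      by (auto simp: nsets_def card_2_iff)
    then show "d \<in> (`) parabola ` nsets {..<n} 2"
      by (intro image_eqI[of _ _ "{i, j}"]) auto
  next
    fix d assume "d \<in> (`) parabola ` nsets {..<n} 2"
    then show "d \<in> nsets (parabola ` {..<n}) 2"
      unfolding ordered_nsets_2_eq[of "{..<n}"] by auto
  qed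
  moreover have "inj_on ((`) parabola) (nsets {..<n} 2)"
    by (simp add: inj_on_def inj_image_eq_iff[OF inj_parabola])
  ultimately have "(\<Sum>d\<in>nsets (parabola ` {..<n}) 2. point_length n T d)
      = (\<Sum>e\<in>nsets {..<n} 2. cyclic_length n T e)"
    by (simp add: sum.reindex point_length_parabola)
  then show ?thesis using sum_cyclic_length[OF assms] by simp
qed

lemma sum_point_length_drawing:
  assumes s: "sorted_wrt (<) s" "set s \<subseteq> {..<n}" "length s = k" "k \<ge> 3"
    and C: "outer_plane k C" and F: "F = graph_image (\<lambda>r. parabola (s ! r)) (Graph {..<k} C)"
  shows "(\<Sum>d\<in>edges F. point_length n T d) \<le>
    n + (\<Sum>c\<in>C - cycle_edges [0..<k]. cyclic_length n T ((!) s ` c))"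
proof -
  have C2: "C \<subseteq> nsets {..<k} 2" and cyc: "cycle_edges [0..<k] \<subseteq> C"
    using C by (auto simp: outer_plane_def)
  have finC: "finite C"
    using C2 finite_imp_finite_nsets finite_subset by blast
  have img: "(\<lambda>r. parabola (s ! r)) ` c = parabola ` ((!) s ` c)" for c
    by (simp add: image_image)
  have E: "edges F = (\<lambda>c. parabola ` ((!) s ` c)) ` C"
    unfolding F graph_image_def by (simp add: img)
  have "inj_on (\<lambda>c. parabola ` ((!) s ` c)) C"
  proof (rule inj_onI)
    fix c c' assume "c \<in> C" "c' \<in> C" "parabola ` ((!) s ` c) = parabola ` ((!) s ` c')"
    moreover have "inj_on ((!) s) {..<k}"
      using s(1,3) by (auto simp: inj_on_def nth_eq_iff_index_eq strict_sorted_iff)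
    moreover have "c \<subseteq> {..<k}" "c' \<subseteq> {..<k}"
      using C2 \<open>c \<in> C\<close> \<open>c' \<in> C\<close> by (auto simp: nsets_def)
    ultimately show "c = c'"
      by (simp add: inj_image_eq_iff[OF inj_parabola] inj_on_image_eq_iff)
  qed
  then have "(\<Sum>d\<in>edges F. point_length n T d) = (\<Sum>c\<in>C. cyclic_length n T ((!) s ` c))"
    unfolding E by (simp add: sum.reindex point_length_parabola)
  also have "\<dots> = (\<Sum>c\<in>cycle_edges [0..<k]. cyclic_length n T ((!) s ` c))
      + (\<Sum>c\<in>C - cycle_edges [0..<k]. cyclic_length n T ((!) s ` c))"
    using sum.subset_diff[OF cyc finC] by (simp add: add.commute)
  also have "(\<Sum>c\<in>cycle_edges [0..<k]. cyclic_length n T ((!) s ` c)) \<le> n"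
    using sum_cyclic_length_cycle[OF s(1,2), of "k - 1"] s(3,4) by simp
  finally show ?thesis by simp
qed

text \<open>Put n = b N, T = a N and t = a / b. The complete graph weighs about t (1 - t) n^3 / 2,
  while about n^2 / 2e copies of weight at most B n cover all but a vanishing fraction of its
  edges.\<close>

lemma packable_length_bound:
  assumes G: "simple_graph G" "planar G" "geometric_packable (plane_drawings G)" "0 < num_edges G"
    and ab: "0 < b" "2 * a \<le> b" and B: "0 \<le> (B::real)"
    and len: "\<And>N F. N \<ge> 1 \<Longrightarrow> F \<in> plane_drawings G \<Longrightarrow> verts F \<subseteq> parabola ` {..<b * N} \<Longrightarrow>
      real (\<Sum>d\<in>edges F. point_length (b * N) (a * N) d) \<le> B * real (b * N)"
  shows "real (num_edges G) * (real a / real b * (1 - real a / real b)) \<le> B"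
proof -
  define e where "e = num_edges G"
  define t where "t = real a / real b"
  define D where "D = (\<lambda>n. Graph (parabola ` {..<n}) (nsets (parabola ` {..<n}) 2))"
  have D: "complete_drawing n (D n)" for n
    unfolding D_def by (rule complete_drawing_parabola)
  have e: "e > 0" using G(4) by (simp add: e_def)
  have t: "0 \<le> t" "t \<le> 1" using ab by (simp_all add: t_def divide_le_eq)
  define r where "r = (\<lambda>n. real (packing_number (D n) (plane_drawings G)) * real e / real (n choose 2))"
  have "r \<longlonglongrightarrow> 1"
    using G(3) D complete_drawingD(6)[OF D] common_num_edges_plane_drawings[OF G(1,2)]
    unfolding geometric_packable_def asymptotically_packed_def r_def e_def by (metis (no_types, lifting) ext)
  \<comment> \<open>The finite form of the estimate: \<open>r\<close> is the covered fraction of the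
    edges, and each uncovered edge is charged the maximal weight \<open>T\<close>.\<close>
  have claim: "t * (1 - t) \<le> r (b * N) * (B / real e) + t * (1 - r (b * N))" if N: "N \<ge> 2" for N
  proof -
    define n T q where "n = b * N" and "T = a * N" and "q = n choose 2"
    have "1 * 2 \<le> b * N" using ab(1) N by (intro mult_le_mono) auto
    then have n: "n \<ge> 2" by (simp add: n_def)
    have T: "2 * T \<le> n"
      using ab(2) mult_le_mono1[of "2 * a" b N] by (simp add: n_def T_def mult.assoc)
    have Tt: "real T = t * real n" using ab(1) by (simp add: n_def T_def t_def)
    obtain S where S: "packing (D n) (plane_drawings G) S" "packing_number (D n) (plane_drawings G) = card S"
      using packing_number_obtain[OF complete_drawingD(1)[OF D]] .
    note cnt = packing_edge_count[OF complete_drawingD(1)[OF D] S(1) G(1)]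
    have q: "q > 0" using n by (simp add: q_def zero_less_binomial)
    define E where "E = nsets (parabola ` {..<n}) 2"
    have E: "edges (D n) = E" "finite E" "card E = q"
      using complete_drawingD(5,6)[OF D, of n]
      by (simp_all add: D_def E_def num_edges_def q_def finite_imp_finite_nsets)
    define U where "U = (\<Union>F\<in>S. edges F)"
    have U: "U \<subseteq> E" "card U = e * card S"
      using S(1) cnt(3) E(1) by (auto simp: U_def packing_def subgraph_def e_def)
    have finF: "finite (edges F)" if "F \<in> S" for F
      using that U(1) E(2) finite_subset[of "edges F" E] by (auto simp: U_def)
    have "(\<Sum>d\<in>U. point_length n T d) = (\<Sum>F\<in>S. \<Sum>d\<in>edges F. point_length n T d)"
      unfolding U_def
    proof (rule sum.UNION_disjoint[OF cnt(1)])
      show "\<forall>F\<in>S. \<forall>F'\<in>S. F \<noteq> F' \<longrightarrow> edges F \<inter> edges F' = {}"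
        using S(1) unfolding packing_def pairwise_def disjnt_def by blast
    qed (use finF in blast)
    then have "real (\<Sum>d\<in>U. point_length n T d) = (\<Sum>F\<in>S. real (\<Sum>d\<in>edges F. point_length n T d))"
      by simp
    also have "\<dots> \<le> (\<Sum>F\<in>S. B * real n)"
    proof (rule sum_mono)
      fix F assume "F \<in> S"
      then obtain F' where F: "subgraph F (D n)" "F' \<in> plane_drawings G" "congruent F F'"
        using S(1) unfolding packing_def by blast
      then have v: "verts F \<subseteq> parabola ` {..<n}" "simple_graph F"
        by (auto simp: subgraph_def D_def)
      have "F \<in> plane_drawings G"
        using plane_drawings_congruent[OF G(1) F(2,3) v(2)] general_position_parabola
          general_position_subset[OF general_position_parabola v(1)] by blast
      then show "real (\<Sum>d\<in>edges F. point_length n T d) \<le> B * real n"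
        using len[of N F] N v(1) by (simp add: n_def T_def)
    qed
    finally have 1: "real (\<Sum>d\<in>U. point_length n T d) \<le> real (card S) * (B * real n)"
      by simp
    have "(\<Sum>d\<in>E - U. point_length n T d) \<le> (\<Sum>d\<in>E - U. T)"
      by (intro sum_mono) (simp add: point_length_def cyclic_length_def)
    also have "\<dots> = (q - e * card S) * T"
      using U E by (simp add: card_Diff_subset finite_subset)
    finally have "real (\<Sum>d\<in>E - U. point_length n T d) \<le> real ((q - e * card S) * T)"
      by (rule of_nat_mono)
    moreover have "e * card S \<le> q"
      using card_mono[OF E(2) U(1)] U(2) E(3) by simp
    ultimately have 2: "real (\<Sum>d\<in>E - U. point_length n T d) \<le> (real q - real e * real (card S)) * real T"
      by (simp add: of_nat_diff)
    have "(\<Sum>d\<in>E. point_length n T d) = (\<Sum>d\<in>E - U. point_length n T d) + (\<Sum>d\<in>U. point_length n T d)"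
      by (rule sum.subset_diff[OF U(1) E(2)])
    moreover have "2 * (\<Sum>d\<in>E. point_length n T d) = n * (T * (n - T))"
      unfolding E_def by (rule sum_point_length[OF T])
    ultimately have "n * (T * (n - T)) = 2 * ((\<Sum>d\<in>E - U. point_length n T d) + (\<Sum>d\<in>U. point_length n T d))"
      by simp
    then have "real (n * (T * (n - T)))
        = real (2 * ((\<Sum>d\<in>E - U. point_length n T d) + (\<Sum>d\<in>U. point_length n T d)))"
      by (rule arg_cong)
    moreover have "real (n - T) = real n - real T"
      using T by (intro of_nat_diff) simp
    ultimately have 3: "real n * (real T * (real n - real T))
        = 2 * (real (\<Sum>d\<in>E - U. point_length n T d) + real (\<Sum>d\<in>U. point_length n T d))"
      by (simp only: of_nat_mult of_nat_add of_nat_numeral)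
    define X where "X = r n * (B / real e) + t * (1 - r n)"
    have r: "real (card S) = r n * real q / real e"
      using q e by (simp add: r_def S(2) q_def)
    have "0 \<le> r n" "r n \<le> 1"
      using q \<open>e * card S \<le> q\<close> unfolding r_def S(2) q_def[symmetric]
      by (simp_all add: divide_le_eq mult.commute flip: of_nat_mult)
    then have X: "0 \<le> X" using B e t by (simp add: X_def)
    have "real n * (real T * (real n - real T)) \<le> 2 * (real (card S) * (B * real n) + (real q - real e * real (card S)) * real T)"
      using 1 2 3 by simp
    also have "\<dots> = 2 * real q * real n * X"
      using e by (simp add: r Tt X_def field_simps)
    also have "\<dots> \<le> real n * real n * real n * X"
    proof -
      have "2 * real q = real n * (real n - 1)"
        unfolding q_def using n
        by (cases n) (simp_all add: choose_two field_char_0_class.of_nat_div mod_eq_0_iff_dvd algebra_simps)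
      then have "2 * real q \<le> real n * real n"
        by (simp add: algebra_simps)
      then show ?thesis
        using X by (intro mult_right_mono) auto
    qed
    finally have "(real n * real n * real n) * (t * (1 - t)) \<le> (real n * real n * real n) * X"
      by (simp add: Tt algebra_simps)
    then have "t * (1 - t) \<le> X"
      using n by (simp add: mult_le_cancel_left_pos)
    then show ?thesis by (simp add: X_def n_def)
  qed
  \<comment> \<open>Restricting to multiples of \<open>b\<close> keeps \<open>T\<close> an
    integer.\<close>
  have "strict_mono (\<lambda>N. b * N)"
    using ab(1) by (intro strict_monoI) simp
  then have sub: "(\<lambda>N. r (b * N)) \<longlonglongrightarrow> 1"
    using LIMSEQ_subseq_LIMSEQ[OF \<open>r \<longlonglongrightarrow> 1\<close>] by (simp add: comp_def)
  have "(\<lambda>N. r (b * N) * (B / real e) + t * (1 - r (b * N))) \<longlonglongrightarrow> 1 * (B / real e) + t * (1 - 1)"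
    by (intro tendsto_intros sub)
  then have "t * (1 - t) \<le> 1 * (B / real e) + t * (1 - 1)"
    using claim by (intro LIMSEQ_le_const) blast+
  then have "t * (1 - t) \<le> B / real e"
    by simp
  then show ?thesis
    using e by (simp add: t_def e_def le_divide_eq mult.commute)
qed

section \<open>Outerplanar graphs on few vertices\<close>

definition edge_set :: "(nat \<times> nat) list \<Rightarrow> nat set set" where
  "edge_set L = (\<lambda>(x, y). {x, y}) ` set L"

lemma edge_set_sorted_inj:
  fixes L :: "(nat \<times> nat) list"
  assumes "\<And>x y. (x, y) \<in> set L \<Longrightarrow> x < y"
  shows "inj_on (\<lambda>(x, y). {x, y}) (set L)"
proof (rule inj_onI)
  fix p q assume p: "p \<in> set L" and q: "q \<in> set L" and eq: "(\<lambda>(x, y). {x, y}) p = (\<lambda>(x, y). {x, y}) q"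
  obtain x y x' y' where xy: "p = (x, y)" "q = (x', y')"
    by (cases p, cases q)
  then have "x < y" "x' < y'"
    using p q assms by auto
  moreover have "{x, y} = {x', y'}"
    using eq by (simp add: xy)
  then have "x = x' \<and> y = y' \<or> x = y' \<and> y = x'"
    by (rule iffD1[OF doubleton_eq_iff])
  ultimately have "x = x' \<and> y = y'"
    by linarith
  then show "p = q"
    by (simp add: xy)
qed

text \<open>Storing images as increasing pairs reduces an isomorphism of explicit graphs to an
  equality of finite sets of pairs, which evaluation settles.\<close>

lemma isomorphic_edge_set:
  assumes "distinct (map f vs)" "set (map f vs) = W"
    and "set (map (\<lambda>(x, y). (min (f x) (f y), max (f x) (f y))) L) = set M"
  shows "isomorphic (Graph (set vs) (edge_set L)) (Graph W (edge_set M))"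
proof -
  have "f ` {x, y} = {min (f x) (f y), max (f x) (f y)}" for x y
    by (auto simp: min_def max_def)
  then have "(`) f ` edge_set L = edge_set (map (\<lambda>(x, y). (min (f x) (f y), max (f x) (f y))) L)"
    unfolding edge_set_def image_image set_map by (intro image_cong) auto
  also have "\<dots> = edge_set M"
    unfolding edge_set_def assms(3) ..
  finally show ?thesis
    unfolding isomorphic_def graph_image_def using assms(1,2)
    by (intro exI[of _ f]) (simp add: distinct_map)
qed

lemma cycle_graph_3_edge_set: "cycle_graph 3 = Graph (set [1, 2, 3]) (edge_set [(1, 2), (2, 3), (3, 1)])"
  by (simp add: cycle_graph_3 edge_set_def)

lemma cycle_graph_4_edge_set:
  "cycle_graph 4 = Graph (set [1, 2, 3, 4]) (edge_set [(1, 2), (2, 3), (3, 4), (4, 1)])"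
  by (simp add: cycle_graph_4 edge_set_def)

lemma Theta1_edge_set:
  "Theta1 = Graph (set [1, 2, 3, 4]) (edge_set [(1, 2), (2, 3), (3, 4), (4, 1), (2, 4)])"
  by (simp add: Theta1_eq edge_set_def)

lemma Theta2_edge_set: "Theta2 = Graph (set [1, 2, 3, 4, 5])
    (edge_set [(1, 2), (2, 3), (3, 4), (4, 5), (5, 1), (1, 3), (1, 4)])"
proof -
  have *: "{1..5} = set [1, 2, 3, 4, 5::nat]" by auto
  show ?thesis
    unfolding Theta2_def * cycle_edges_explicit edge_set_def by auto
qed

lemma Theta3_edge_set: "Theta3 = Graph (set [1, 2, 3, 4, 5, 6])
    (edge_set [(1, 2), (2, 3), (3, 4), (4, 5), (5, 6), (6, 1), (2, 4), (2, 5), (1, 5)])"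
proof -
  have *: "{1..6} = set [1, 2, 3, 4, 5, 6::nat]" by auto
  show ?thesis
    unfolding Theta3_def * cycle_edges_explicit edge_set_def by auto
qed

lemma Theta4_edge_set: "Theta4 = Graph (set [1, 2, 3, 4, 5, 6])
    (edge_set [(1, 2), (2, 3), (3, 4), (4, 5), (5, 6), (6, 1), (2, 4), (2, 5), (2, 6)])"
proof -
  have *: "{1..6} = set [1, 2, 3, 4, 5, 6::nat]" by auto
  show ?thesis
    unfolding Theta4_def * cycle_edges_explicit edge_set_def by auto
qed

text \<open>The edge set is traded for a predicate on finitely many increasing pairs, so that the
  classification becomes a case distinction on which chords are present.\<close>

lemma outer_plane_edge_set:
  assumes C: "outer_plane k C" and L: "set L = {(x, y). x < y \<and> y < k}" "distinct L"
    and P_def: "P = (\<lambda>(x, y). {x, y} \<in> C)"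
  shows "C = edge_set (filter P L)" "card C = length (filter P L)"
    "\<And>a b c d. a < b \<Longrightarrow> b < c \<Longrightarrow> c < d \<Longrightarrow> P (a, c) \<Longrightarrow> \<not> P (b, d)"
    "\<And>i. Suc i < k \<Longrightarrow> P (i, Suc i)" "3 \<le> k \<Longrightarrow> P (0, k - 1)"
proof -
  have C2: "C \<subseteq> nsets {..<k} 2" and nc: "noncrossing C" and cyc: "cycle_edges [0..<k] \<subseteq> C"
    using C by (auto simp: outer_plane_def)
  show eq: "C = edge_set (filter P L)"
  proof (intro equalityI subsetI)
    fix e assume "e \<in> C"
    then obtain x y where "e = {x, y}" "x < y" "y < k"
      using C2 unfolding ordered_nsets_2_eq by auto
    then show "e \<in> edge_set (filter P L)"
      using \<open>e \<in> C\<close> L(1) by (force simp: edge_set_def P_def)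
  qed (auto simp: edge_set_def P_def)
  have "card (edge_set (filter P L)) = card (set (filter P L))"
    unfolding edge_set_def using L(1) by (intro card_image edge_set_sorted_inj) auto
  also have "\<dots> = length (filter P L)"
    using L(2) by (intro distinct_card) simp
  finally show "card C = length (filter P L)"
    using eq by metis
  show "a < b \<Longrightarrow> b < c \<Longrightarrow> c < d \<Longrightarrow> P (a, c) \<Longrightarrow> \<not> P (b, d)" for a b c d
    using nc by (auto simp: P_def noncrossing_def)
  show "Suc i < k \<Longrightarrow> P (i, Suc i)" for i
    using cycle_edgeI[of i "[0..<k]"] cyc by (auto simp: P_def)
  show "P (0, k - 1)" if "3 \<le> k"
  proof -
    have "Suc (k - 1) = k" "0 < k" using that by auto
    then show ?thesis
      using cycle_edgeI[of "k - 1" "[0..<k]"] cyc by (auto simp: P_def insert_commute)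
  qed
qed

lemma pairs_Suc: "{(x, y). x < y \<and> y < Suc k} = {(x, y). x < y \<and> y < k} \<union> (\<lambda>x. (x, k)) ` set [0..<k]"
  by auto

lemma pairs_3: "set [(0, 2), (1, 2), (0, 1)] = {(x, y). x < y \<and> y < (3::nat)}"
  by (auto simp: numeral_eq_Suc less_Suc_eq)

lemma pairs_4: "set [(0, 3), (1, 3), (2, 3), (0, 2), (1, 2), (0, 1)] = {(x, y). x < y \<and> y < (4::nat)}"
proof -
  have "[0..<3] = [0, 1, 2]" by (simp add: upt_rec)
  then show ?thesis
    using pairs_Suc[of 3] unfolding pairs_3[symmetric] by simp
qed

lemma pairs_5: "set [(0, 4), (1, 4), (2, 4), (3, 4), (0, 3), (1, 3), (2, 3), (0, 2), (1, 2), (0, 1)] = {(x, y). x < y \<and> y < (5::nat)}"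
proof -
  have "[0..<4] = [0, 1, 2, 3]" by (simp add: upt_rec)
  then show ?thesis
    using pairs_Suc[of 4] unfolding pairs_4[symmetric] by simp
qed

lemma pairs_6: "set [(0, 5), (1, 5), (2, 5), (3, 5), (4, 5), (0, 4), (1, 4), (2, 4), (3, 4), (0, 3), (1, 3), (2, 3), (0, 2), (1, 2), (0, 1)] = {(x, y). x < y \<and> y < (6::nat)}"
proof -
  have "[0..<5] = [0, 1, 2, 3, 4]" by (simp add: upt_rec)
  then show ?thesis
    using pairs_Suc[of 5] unfolding pairs_5[symmetric] by simp
qed

section \<open>Chord sets of small polygons and their isomorphism types\<close>

lemma noncrossing_chords_3_3:
  fixes P :: "nat \<times> nat \<Rightarrow> bool"
  assumes "P (0, 1)" "P (1, 2)" "P (0, 2)"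
    and "length (filter P [(0, 2), (1, 2), (0, 1)]) = 3"
  shows "filter P [(0, 2), (1, 2), (0, 1)] \<in> set [
    [(0, 2), (1, 2), (0, 1)]]"
  using assms by (simp)

lemma cycle_graph_3_relabelled:
  assumes "M \<in> set [
    [(0, 2), (1, 2), (0, 1)]]"
  shows "isomorphic (cycle_graph 3) (Graph {..<3} (edge_set M))"
proof -
  have V: "{..<3} = set ([0, 1, 2] :: nat list)" by auto
  \<comment> \<open>The list in the witness gives the images of the vertices; the shift by one is
    due to their numbering from 1.\<close>
  have "isomorphic (cycle_graph 3) (Graph {..<3} (edge_set [(0, 2), (1, 2), (0, 1)]))"
    unfolding cycle_graph_3_edge_set V
    by (rule isomorphic_edge_set[of "\<lambda>x. [0, 1, 2] ! (x - 1)"]) auto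
  then show ?thesis using assms by auto
qed

lemma noncrossing_chords_4_4:
  fixes P :: "nat \<times> nat \<Rightarrow> bool"
  assumes "P (0, 1)" "P (1, 2)" "P (2, 3)" "P (0, 3)"
    and "\<not> (P (0, 2) \<and> P (1, 3))"
    and "length (filter P [(0, 3), (1, 3), (2, 3), (0, 2), (1, 2), (0, 1)]) = 4"
  shows "filter P [(0, 3), (1, 3), (2, 3), (0, 2), (1, 2), (0, 1)] \<in> set [
    [(0, 3), (2, 3), (1, 2), (0, 1)]]"
  using assms by (cases "P (0, 2)"; (simp)?; cases "P (1, 3)"; (simp)?)

lemma cycle_graph_4_relabelled:
  assumes "M \<in> set [
    [(0, 3), (2, 3), (1, 2), (0, 1)]]"
  shows "isomorphic (cycle_graph 4) (Graph {..<4} (edge_set M))"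
proof -
  have V: "{..<4} = set ([0, 1, 2, 3] :: nat list)" by auto
  have "isomorphic (cycle_graph 4) (Graph {..<4} (edge_set [(0, 3), (2, 3), (1, 2), (0, 1)]))"
    unfolding cycle_graph_4_edge_set V
    by (rule isomorphic_edge_set[of "\<lambda>x. [0, 1, 2, 3] ! (x - 1)"]) auto
  then show ?thesis using assms by auto
qed

lemma noncrossing_chords_4_5:
  fixes P :: "nat \<times> nat \<Rightarrow> bool"
  assumes "P (0, 1)" "P (1, 2)" "P (2, 3)" "P (0, 3)"
    and "\<not> (P (0, 2) \<and> P (1, 3))"
    and "length (filter P [(0, 3), (1, 3), (2, 3), (0, 2), (1, 2), (0, 1)]) = 5"
  shows "filter P [(0, 3), (1, 3), (2, 3), (0, 2), (1, 2), (0, 1)] \<in> set [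
    [(0, 3), (2, 3), (0, 2), (1, 2), (0, 1)],
    [(0, 3), (1, 3), (2, 3), (1, 2), (0, 1)]]"
  using assms by (cases "P (0, 2)"; (simp)?; cases "P (1, 3)"; (simp)?)

lemma Theta1_relabelled:
  assumes "M \<in> set [
    [(0, 3), (2, 3), (0, 2), (1, 2), (0, 1)],
    [(0, 3), (1, 3), (2, 3), (1, 2), (0, 1)]]"
  shows "isomorphic Theta1 (Graph {..<4} (edge_set M))"
proof -
  have V: "{..<4} = set ([0, 1, 2, 3] :: nat list)" by auto
  have "isomorphic Theta1 (Graph {..<4} (edge_set [(0, 3), (2, 3), (0, 2), (1, 2), (0, 1)]))"
    unfolding Theta1_edge_set V
    by (rule isomorphic_edge_set[of "\<lambda>x. [1, 0, 3, 2] ! (x - 1)"]) auto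
  moreover
  have "isomorphic Theta1 (Graph {..<4} (edge_set [(0, 3), (1, 3), (2, 3), (1, 2), (0, 1)]))"
    unfolding Theta1_edge_set V
    by (rule isomorphic_edge_set[of "\<lambda>x. [0, 1, 2, 3] ! (x - 1)"]) auto
  ultimately show ?thesis using assms by auto
qed

text \<open>The alternatives are the five triangulations of a pentagon, each of them a fan at one
  vertex.\<close>

lemma noncrossing_chords_5_7:
  fixes P :: "nat \<times> nat \<Rightarrow> bool"
  assumes "P (0, 1)" "P (1, 2)" "P (2, 3)" "P (3, 4)" "P (0, 4)"
    and "\<not> (P (0, 2) \<and> P (1, 3))" "\<not> (P (0, 2) \<and> P (1, 4))" "\<not> (P (0, 3) \<and> P (1, 4))" "\<not> (P (0, 3) \<and> P (2, 4))" "\<not> (P (1, 3) \<and> P (2, 4))"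
    and "length (filter P [(0, 4), (1, 4), (2, 4), (3, 4), (0, 3), (1, 3), (2, 3), (0, 2), (1, 2), (0, 1)]) = 7"
  shows "filter P [(0, 4), (1, 4), (2, 4), (3, 4), (0, 3), (1, 3), (2, 3), (0, 2), (1, 2), (0, 1)] \<in> set [
    [(0, 4), (3, 4), (0, 3), (2, 3), (0, 2), (1, 2), (0, 1)],
    [(0, 4), (2, 4), (3, 4), (2, 3), (0, 2), (1, 2), (0, 1)],
    [(0, 4), (3, 4), (0, 3), (1, 3), (2, 3), (1, 2), (0, 1)],
    [(0, 4), (1, 4), (3, 4), (1, 3), (2, 3), (1, 2), (0, 1)],
    [(0, 4), (1, 4), (2, 4), (3, 4), (2, 3), (1, 2), (0, 1)]]"
  using assms by (cases "P (0, 2)"; (simp)?; cases "P (0, 3)"; (simp)?; cases "P (1, 3)"; (simp)?; cases "P (1, 4)"; (simp)?; cases "P (2, 4)"; (simp)?)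

lemma Theta2_relabelled:
  assumes "M \<in> set [
    [(0, 4), (3, 4), (0, 3), (2, 3), (0, 2), (1, 2), (0, 1)],
    [(0, 4), (2, 4), (3, 4), (2, 3), (0, 2), (1, 2), (0, 1)],
    [(0, 4), (3, 4), (0, 3), (1, 3), (2, 3), (1, 2), (0, 1)],
    [(0, 4), (1, 4), (3, 4), (1, 3), (2, 3), (1, 2), (0, 1)],
    [(0, 4), (1, 4), (2, 4), (3, 4), (2, 3), (1, 2), (0, 1)]]"
  shows "isomorphic Theta2 (Graph {..<5} (edge_set M))"
proof -
  have V: "{..<5} = set ([0, 1, 2, 3, 4] :: nat list)" by auto
  have "isomorphic Theta2 (Graph {..<5} (edge_set [(0, 4), (3, 4), (0, 3), (2, 3), (0, 2), (1, 2), (0, 1)]))"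
    unfolding Theta2_edge_set V
    by (rule isomorphic_edge_set[of "\<lambda>x. [0, 1, 2, 3, 4] ! (x - 1)"]) auto
  moreover
  have "isomorphic Theta2 (Graph {..<5} (edge_set [(0, 4), (2, 4), (3, 4), (2, 3), (0, 2), (1, 2), (0, 1)]))"
    unfolding Theta2_edge_set V
    by (rule isomorphic_edge_set[of "\<lambda>x. [2, 1, 0, 4, 3] ! (x - 1)"]) auto
  moreover
  have "isomorphic Theta2 (Graph {..<5} (edge_set [(0, 4), (3, 4), (0, 3), (1, 3), (2, 3), (1, 2), (0, 1)]))"
    unfolding Theta2_edge_set V
    by (rule isomorphic_edge_set[of "\<lambda>x. [3, 2, 1, 0, 4] ! (x - 1)"]) auto
  moreover
  have "isomorphic Theta2 (Graph {..<5} (edge_set [(0, 4), (1, 4), (3, 4), (1, 3), (2, 3), (1, 2), (0, 1)]))"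
    unfolding Theta2_edge_set V
    by (rule isomorphic_edge_set[of "\<lambda>x. [1, 0, 4, 3, 2] ! (x - 1)"]) auto
  moreover
  have "isomorphic Theta2 (Graph {..<5} (edge_set [(0, 4), (1, 4), (2, 4), (3, 4), (2, 3), (1, 2), (0, 1)]))"
    unfolding Theta2_edge_set V
    by (rule isomorphic_edge_set[of "\<lambda>x. [4, 0, 1, 2, 3] ! (x - 1)"]) auto
  ultimately show ?thesis using assms by auto
qed

text \<open>Nine edges mean three chords. The alternatives are the 14 triangulations of a hexagon:
  six zigzags, six fans and two with an inscribed triangle.\<close>

lemma noncrossing_chords_6_9:
  fixes P :: "nat \<times> nat \<Rightarrow> bool"
  assumes "P (0, 1)" "P (1, 2)" "P (2, 3)" "P (3, 4)" "P (4, 5)" "P (0, 5)"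
    and "\<not> (P (0, 2) \<and> P (1, 3))" "\<not> (P (0, 2) \<and> P (1, 4))" "\<not> (P (0, 2) \<and> P (1, 5))" "\<not> (P (0, 3) \<and> P (1, 4))" "\<not> (P (0, 3) \<and> P (1, 5))" "\<not> (P (0, 3) \<and> P (2, 4))" "\<not> (P (0, 3) \<and> P (2, 5))" "\<not> (P (0, 4) \<and> P (1, 5))" "\<not> (P (0, 4) \<and> P (2, 5))" "\<not> (P (0, 4) \<and> P (3, 5))" "\<not> (P (1, 3) \<and> P (2, 4))" "\<not> (P (1, 3) \<and> P (2, 5))" "\<not> (P (1, 4) \<and> P (2, 5))" "\<not> (P (1, 4) \<and> P (3, 5))" "\<not> (P (2, 4) \<and> P (3, 5))"
    and "length (filter P [(0, 5), (1, 5), (2, 5), (3, 5), (4, 5), (0, 4), (1, 4), (2, 4), (3, 4), (0, 3), (1, 3), (2, 3), (0, 2), (1, 2), (0, 1)]) = 9"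
  shows "filter P [(0, 5), (1, 5), (2, 5), (3, 5), (4, 5), (0, 4), (1, 4), (2, 4), (3, 4), (0, 3), (1, 3), (2, 3), (0, 2), (1, 2), (0, 1)] \<in> set [
    [(0, 5), (4, 5), (0, 4), (3, 4), (0, 3), (2, 3), (0, 2), (1, 2), (0, 1)],
    [(0, 5), (3, 5), (4, 5), (3, 4), (0, 3), (2, 3), (0, 2), (1, 2), (0, 1)],
    [(0, 5), (4, 5), (0, 4), (2, 4), (3, 4), (2, 3), (0, 2), (1, 2), (0, 1)],
    [(0, 5), (2, 5), (4, 5), (2, 4), (3, 4), (2, 3), (0, 2), (1, 2), (0, 1)],
    [(0, 5), (2, 5), (3, 5), (4, 5), (3, 4), (2, 3), (0, 2), (1, 2), (0, 1)],
    [(0, 5), (4, 5), (0, 4), (3, 4), (0, 3), (1, 3), (2, 3), (1, 2), (0, 1)],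
    [(0, 5), (3, 5), (4, 5), (3, 4), (0, 3), (1, 3), (2, 3), (1, 2), (0, 1)],
    [(0, 5), (4, 5), (0, 4), (1, 4), (3, 4), (1, 3), (2, 3), (1, 2), (0, 1)],
    [(0, 5), (4, 5), (0, 4), (1, 4), (2, 4), (3, 4), (2, 3), (1, 2), (0, 1)],
    [(0, 5), (1, 5), (4, 5), (1, 4), (3, 4), (1, 3), (2, 3), (1, 2), (0, 1)],
    [(0, 5), (1, 5), (3, 5), (4, 5), (3, 4), (1, 3), (2, 3), (1, 2), (0, 1)],
    [(0, 5), (1, 5), (4, 5), (1, 4), (2, 4), (3, 4), (2, 3), (1, 2), (0, 1)],
    [(0, 5), (1, 5), (2, 5), (4, 5), (2, 4), (3, 4), (2, 3), (1, 2), (0, 1)],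
    [(0, 5), (1, 5), (2, 5), (3, 5), (4, 5), (3, 4), (2, 3), (1, 2), (0, 1)]]"
  using assms by (cases "P (0, 2)"; (simp)?; cases "P (0, 3)"; (simp)?; cases "P (0, 4)"; (simp)?; cases "P (1, 3)"; (simp)?; cases "P (1, 4)"; (simp)?; cases "P (1, 5)"; (simp)?; cases "P (2, 4)"; (simp)?; cases "P (2, 5)"; (simp)?; cases "P (3, 5)"; (simp)?)

text \<open>The zigzags: the chords form a path through four vertices, like 4, 2, 5, 1 in
  \<open>Theta3\<close>.\<close>

lemma Theta3_relabelled:
  assumes "M \<in> set [
    [(0, 5), (3, 5), (4, 5), (3, 4), (0, 3), (2, 3), (0, 2), (1, 2), (0, 1)],
    [(0, 5), (2, 5), (3, 5), (4, 5), (3, 4), (2, 3), (0, 2), (1, 2), (0, 1)],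
    [(0, 5), (4, 5), (0, 4), (3, 4), (0, 3), (1, 3), (2, 3), (1, 2), (0, 1)],
    [(0, 5), (4, 5), (0, 4), (1, 4), (3, 4), (1, 3), (2, 3), (1, 2), (0, 1)],
    [(0, 5), (1, 5), (4, 5), (1, 4), (2, 4), (3, 4), (2, 3), (1, 2), (0, 1)],
    [(0, 5), (1, 5), (2, 5), (4, 5), (2, 4), (3, 4), (2, 3), (1, 2), (0, 1)]]"
  shows "isomorphic Theta3 (Graph {..<6} (edge_set M))"
proof -
  have V: "{..<6} = set ([0, 1, 2, 3, 4, 5] :: nat list)" by auto
  have "isomorphic Theta3 (Graph {..<6} (edge_set [(0, 5), (3, 5), (4, 5), (3, 4), (0, 3), (2, 3), (0, 2), (1, 2), (0, 1)]))"
    unfolding Theta3_edge_set V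
    by (rule isomorphic_edge_set[of "\<lambda>x. [2, 3, 4, 5, 0, 1] ! (x - 1)"]) auto
  moreover
  have "isomorphic Theta3 (Graph {..<6} (edge_set [(0, 5), (2, 5), (3, 5), (4, 5), (3, 4), (2, 3), (0, 2), (1, 2), (0, 1)]))"
    unfolding Theta3_edge_set V
    by (rule isomorphic_edge_set[of "\<lambda>x. [0, 5, 4, 3, 2, 1] ! (x - 1)"]) auto
  moreover
  have "isomorphic Theta3 (Graph {..<6} (edge_set [(0, 5), (4, 5), (0, 4), (3, 4), (0, 3), (1, 3), (2, 3), (1, 2), (0, 1)]))"
    unfolding Theta3_edge_set V
    by (rule isomorphic_edge_set[of "\<lambda>x. [1, 0, 5, 4, 3, 2] ! (x - 1)"]) auto
  moreover
  have "isomorphic Theta3 (Graph {..<6} (edge_set [(0, 5), (4, 5), (0, 4), (1, 4), (3, 4), (1, 3), (2, 3), (1, 2), (0, 1)]))"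
    unfolding Theta3_edge_set V
    by (rule isomorphic_edge_set[of "\<lambda>x. [0, 1, 2, 3, 4, 5] ! (x - 1)"]) auto
  moreover
  have "isomorphic Theta3 (Graph {..<6} (edge_set [(0, 5), (1, 5), (4, 5), (1, 4), (2, 4), (3, 4), (2, 3), (1, 2), (0, 1)]))"
    unfolding Theta3_edge_set V
    by (rule isomorphic_edge_set[of "\<lambda>x. [2, 1, 0, 5, 4, 3] ! (x - 1)"]) auto
  moreover
  have "isomorphic Theta3 (Graph {..<6} (edge_set [(0, 5), (1, 5), (2, 5), (4, 5), (2, 4), (3, 4), (2, 3), (1, 2), (0, 1)]))"
    unfolding Theta3_edge_set V
    by (rule isomorphic_edge_set[of "\<lambda>x. [1, 2, 3, 4, 5, 0] ! (x - 1)"]) auto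
  ultimately show ?thesis using assms by auto
qed

text \<open>The fans: the chords share a vertex, like 2 in \<open>Theta4\<close>.\<close>

lemma Theta4_relabelled:
  assumes "M \<in> set [
    [(0, 5), (4, 5), (0, 4), (3, 4), (0, 3), (2, 3), (0, 2), (1, 2), (0, 1)],
    [(0, 5), (2, 5), (4, 5), (2, 4), (3, 4), (2, 3), (0, 2), (1, 2), (0, 1)],
    [(0, 5), (3, 5), (4, 5), (3, 4), (0, 3), (1, 3), (2, 3), (1, 2), (0, 1)],
    [(0, 5), (4, 5), (0, 4), (1, 4), (2, 4), (3, 4), (2, 3), (1, 2), (0, 1)],
    [(0, 5), (1, 5), (4, 5), (1, 4), (3, 4), (1, 3), (2, 3), (1, 2), (0, 1)],
    [(0, 5), (1, 5), (2, 5), (3, 5), (4, 5), (3, 4), (2, 3), (1, 2), (0, 1)]]"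
  shows "isomorphic Theta4 (Graph {..<6} (edge_set M))"
proof -
  have V: "{..<6} = set ([0, 1, 2, 3, 4, 5] :: nat list)" by auto
  have "isomorphic Theta4 (Graph {..<6} (edge_set [(0, 5), (4, 5), (0, 4), (3, 4), (0, 3), (2, 3), (0, 2), (1, 2), (0, 1)]))"
    unfolding Theta4_edge_set V
    by (rule isomorphic_edge_set[of "\<lambda>x. [1, 0, 5, 4, 3, 2] ! (x - 1)"]) auto
  moreover
  have "isomorphic Theta4 (Graph {..<6} (edge_set [(0, 5), (2, 5), (4, 5), (2, 4), (3, 4), (2, 3), (0, 2), (1, 2), (0, 1)]))"
    unfolding Theta4_edge_set V
    by (rule isomorphic_edge_set[of "\<lambda>x. [1, 2, 3, 4, 5, 0] ! (x - 1)"]) auto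
  moreover
  have "isomorphic Theta4 (Graph {..<6} (edge_set [(0, 5), (3, 5), (4, 5), (3, 4), (0, 3), (1, 3), (2, 3), (1, 2), (0, 1)]))"
    unfolding Theta4_edge_set V
    by (rule isomorphic_edge_set[of "\<lambda>x. [2, 3, 4, 5, 0, 1] ! (x - 1)"]) auto
  moreover
  have "isomorphic Theta4 (Graph {..<6} (edge_set [(0, 5), (4, 5), (0, 4), (1, 4), (2, 4), (3, 4), (2, 3), (1, 2), (0, 1)]))"
    unfolding Theta4_edge_set V
    by (rule isomorphic_edge_set[of "\<lambda>x. [3, 4, 5, 0, 1, 2] ! (x - 1)"]) auto
  moreover
  have "isomorphic Theta4 (Graph {..<6} (edge_set [(0, 5), (1, 5), (4, 5), (1, 4), (3, 4), (1, 3), (2, 3), (1, 2), (0, 1)]))"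
    unfolding Theta4_edge_set V
    by (rule isomorphic_edge_set[of "\<lambda>x. [0, 1, 2, 3, 4, 5] ! (x - 1)"]) auto
  moreover
  have "isomorphic Theta4 (Graph {..<6} (edge_set [(0, 5), (1, 5), (2, 5), (3, 5), (4, 5), (3, 4), (2, 3), (1, 2), (0, 1)]))"
    unfolding Theta4_edge_set V
    by (rule isomorphic_edge_set[of "\<lambda>x. [0, 5, 4, 3, 2, 1] ! (x - 1)"]) auto
  ultimately show ?thesis using assms by auto
qed

lemma outer_plane_3_3:
  assumes C: "outer_plane 3 C" "card C = 3"
  shows "isomorphic (cycle_graph 3) (Graph {..<3} C)"
proof -
  define P where "P = (\<lambda>(x, y). {x, y} \<in> C)"
  have "distinct ([(0, 2), (1, 2), (0, 1)] :: (nat \<times> nat) list)" by simp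
  note F = outer_plane_edge_set[OF C(1) pairs_3 this P_def]
  have cyc: "P (0, 1)" "P (1, 2)" "P (0, 2)"
    using F(4)[of 0] F(4)[of 1] F(5) by (simp_all add: eval_nat_numeral)
  have "filter P [(0, 2), (1, 2), (0, 1)] \<in> set [
    [(0, 2), (1, 2), (0, 1)]]"
    using noncrossing_chords_3_3[OF cyc F(2)[unfolded C(2), symmetric]] .
  then have "C \<in> edge_set ` set [
    [(0, 2), (1, 2), (0, 1)]]"
    by (subst F(1)) (rule imageI)
  then show ?thesis
    using cycle_graph_3_relabelled by blast
qed

lemma outer_plane_4_4:
  assumes C: "outer_plane 4 C" "card C = 4"
  shows "isomorphic (cycle_graph 4) (Graph {..<4} C)"
proof -
  define P where "P = (\<lambda>(x, y). {x, y} \<in> C)"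
  have "distinct ([(0, 3), (1, 3), (2, 3), (0, 2), (1, 2), (0, 1)] :: (nat \<times> nat) list)" by simp
  note F = outer_plane_edge_set[OF C(1) pairs_4 this P_def]
  have cyc: "P (0, 1)" "P (1, 2)" "P (2, 3)" "P (0, 3)"
    using F(4)[of 0] F(4)[of 1] F(4)[of 2] F(5) by (simp_all add: eval_nat_numeral)
  have nc0: "\<not> (P (a, c) \<and> P (b, d))" if "a < b" "b < c" "c < d" for a b c d
    using F(3)[OF that] by blast
  have nc: "\<not> (P (0, 2) \<and> P (1, 3))"
    by (rule nc0; simp)+
  have "filter P [(0, 3), (1, 3), (2, 3), (0, 2), (1, 2), (0, 1)] \<in> set [
    [(0, 3), (2, 3), (1, 2), (0, 1)]]"
    using noncrossing_chords_4_4[OF cyc nc F(2)[unfolded C(2), symmetric]] .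
  then have "C \<in> edge_set ` set [
    [(0, 3), (2, 3), (1, 2), (0, 1)]]"
    by (subst F(1)) (rule imageI)
  then show ?thesis
    using cycle_graph_4_relabelled by blast
qed

lemma outer_plane_4_5:
  assumes C: "outer_plane 4 C" "card C = 5"
  shows "isomorphic Theta1 (Graph {..<4} C)"
proof -
  define P where "P = (\<lambda>(x, y). {x, y} \<in> C)"
  have "distinct ([(0, 3), (1, 3), (2, 3), (0, 2), (1, 2), (0, 1)] :: (nat \<times> nat) list)" by simp
  note F = outer_plane_edge_set[OF C(1) pairs_4 this P_def]
  have cyc: "P (0, 1)" "P (1, 2)" "P (2, 3)" "P (0, 3)"
    using F(4)[of 0] F(4)[of 1] F(4)[of 2] F(5) by (simp_all add: eval_nat_numeral)
  have nc0: "\<not> (P (a, c) \<and> P (b, d))" if "a < b" "b < c" "c < d" for a b c d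
    using F(3)[OF that] by blast
  have nc: "\<not> (P (0, 2) \<and> P (1, 3))"
    by (rule nc0; simp)+
  have "filter P [(0, 3), (1, 3), (2, 3), (0, 2), (1, 2), (0, 1)] \<in> set [
    [(0, 3), (2, 3), (0, 2), (1, 2), (0, 1)],
    [(0, 3), (1, 3), (2, 3), (1, 2), (0, 1)]]"
    using noncrossing_chords_4_5[OF cyc nc F(2)[unfolded C(2), symmetric]] .
  then have "C \<in> edge_set ` set [
    [(0, 3), (2, 3), (0, 2), (1, 2), (0, 1)],
    [(0, 3), (1, 3), (2, 3), (1, 2), (0, 1)]]"
    by (subst F(1)) (rule imageI)
  then show ?thesis
    using Theta1_relabelled by blast
qed

lemma outer_plane_5_7:
  assumes C: "outer_plane 5 C" "card C = 7"
  shows "isomorphic Theta2 (Graph {..<5} C)"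
proof -
  define P where "P = (\<lambda>(x, y). {x, y} \<in> C)"
  have "distinct ([(0, 4), (1, 4), (2, 4), (3, 4), (0, 3), (1, 3), (2, 3), (0, 2), (1, 2), (0, 1)] :: (nat \<times> nat) list)" by simp
  note F = outer_plane_edge_set[OF C(1) pairs_5 this P_def]
  have cyc: "P (0, 1)" "P (1, 2)" "P (2, 3)" "P (3, 4)" "P (0, 4)"
    using F(4)[of 0] F(4)[of 1] F(4)[of 2] F(4)[of 3] F(5) by (simp_all add: eval_nat_numeral)
  have nc0: "\<not> (P (a, c) \<and> P (b, d))" if "a < b" "b < c" "c < d" for a b c d
    using F(3)[OF that] by blast
  have nc: "\<not> (P (0, 2) \<and> P (1, 3))" "\<not> (P (0, 2) \<and> P (1, 4))" "\<not> (P (0, 3) \<and> P (1, 4))" "\<not> (P (0, 3) \<and> P (2, 4))" "\<not> (P (1, 3) \<and> P (2, 4))"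
    by (rule nc0; simp)+
  have "filter P [(0, 4), (1, 4), (2, 4), (3, 4), (0, 3), (1, 3), (2, 3), (0, 2), (1, 2), (0, 1)] \<in> set [
    [(0, 4), (3, 4), (0, 3), (2, 3), (0, 2), (1, 2), (0, 1)],
    [(0, 4), (2, 4), (3, 4), (2, 3), (0, 2), (1, 2), (0, 1)],
    [(0, 4), (3, 4), (0, 3), (1, 3), (2, 3), (1, 2), (0, 1)],
    [(0, 4), (1, 4), (3, 4), (1, 3), (2, 3), (1, 2), (0, 1)],
    [(0, 4), (1, 4), (2, 4), (3, 4), (2, 3), (1, 2), (0, 1)]]"
    using noncrossing_chords_5_7[OF cyc nc F(2)[unfolded C(2), symmetric]] .
  then have "C \<in> edge_set ` set [
    [(0, 4), (3, 4), (0, 3), (2, 3), (0, 2), (1, 2), (0, 1)],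
    [(0, 4), (2, 4), (3, 4), (2, 3), (0, 2), (1, 2), (0, 1)],
    [(0, 4), (3, 4), (0, 3), (1, 3), (2, 3), (1, 2), (0, 1)],
    [(0, 4), (1, 4), (3, 4), (1, 3), (2, 3), (1, 2), (0, 1)],
    [(0, 4), (1, 4), (2, 4), (3, 4), (2, 3), (1, 2), (0, 1)]]"
    by (subst F(1)) (rule imageI)
  then show ?thesis
    using Theta2_relabelled by blast
qed

lemma edge_set_diff:
  assumes "\<forall>(x, y) \<in> set L \<union> set L'. x < y"
  shows "edge_set L - edge_set L' = edge_set (filter (\<lambda>p. p \<notin> set L') L)"
proof -
  have "inj_on (\<lambda>(x, y). {x, y}) (set (L @ L'))"
    using assms by (intro edge_set_sorted_inj) auto
  then have "(\<lambda>(x, y). {x, y}) ` (set L - set L') = edge_set L - edge_set L'"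
    unfolding edge_set_def by (rule inj_on_image_set_diff) auto
  moreover have "set L - set L' = set (filter (\<lambda>p. p \<notin> set L') L)"
    by auto
  ultimately show ?thesis
    by (simp only: edge_set_def)
qed

text \<open>The inscribed triangle is none of the named graphs. It is kept as an explicit set of
  chords because their lengths are estimated later.\<close>

lemma outer_plane_6_9:
  assumes C: "outer_plane 6 C" "card C = 9"
  shows "isomorphic Theta3 (Graph {..<6} C) \<or> isomorphic Theta4 (Graph {..<6} C) \<or>
    C - cycle_edges [0..<6] \<in> {{{0, 2}, {0, 4}, {2, 4}}, {{1, 3}, {1, 5}, {3, 5}}}"
proof -
  define P where "P = (\<lambda>(x, y). {x, y} \<in> C)"
  have "distinct ([(0, 5), (1, 5), (2, 5), (3, 5), (4, 5), (0, 4), (1, 4), (2, 4), (3, 4), (0, 3), (1, 3), (2, 3), (0, 2), (1, 2), (0, 1)] :: (nat \<times> nat) list)" by simp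
  note F = outer_plane_edge_set[OF C(1) pairs_6 this P_def]
  have cyc: "P (0, 1)" "P (1, 2)" "P (2, 3)" "P (3, 4)" "P (4, 5)" "P (0, 5)"
    using F(4)[of 0] F(4)[of 1] F(4)[of 2] F(4)[of 3] F(4)[of 4] F(5) by (simp_all add: eval_nat_numeral)
  have nc0: "\<not> (P (a, c) \<and> P (b, d))" if "a < b" "b < c" "c < d" for a b c d
    using F(3)[OF that] by blast
  have nc: "\<not> (P (0, 2) \<and> P (1, 3))" "\<not> (P (0, 2) \<and> P (1, 4))" "\<not> (P (0, 2) \<and> P (1, 5))" "\<not> (P (0, 3) \<and> P (1, 4))" "\<not> (P (0, 3) \<and> P (1, 5))" "\<not> (P (0, 3) \<and> P (2, 4))" "\<not> (P (0, 3) \<and> P (2, 5))" "\<not> (P (0, 4) \<and> P (1, 5))" "\<not> (P (0, 4) \<and> P (2, 5))" "\<not> (P (0, 4) \<and> P (3, 5))" "\<not> (P (1, 3) \<and> P (2, 4))" "\<not> (P (1, 3) \<and> P (2, 5))" "\<not> (P (1, 4) \<and> P (2, 5))" "\<not> (P (1, 4) \<and> P (3, 5))" "\<not> (P (2, 4) \<and> P (3, 5))"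
    by (rule nc0; simp)+
  have "filter P [(0, 5), (1, 5), (2, 5), (3, 5), (4, 5), (0, 4), (1, 4), (2, 4), (3, 4), (0, 3), (1, 3), (2, 3), (0, 2), (1, 2), (0, 1)] \<in> set [
    [(0, 5), (4, 5), (0, 4), (3, 4), (0, 3), (2, 3), (0, 2), (1, 2), (0, 1)],
    [(0, 5), (3, 5), (4, 5), (3, 4), (0, 3), (2, 3), (0, 2), (1, 2), (0, 1)],
    [(0, 5), (4, 5), (0, 4), (2, 4), (3, 4), (2, 3), (0, 2), (1, 2), (0, 1)],
    [(0, 5), (2, 5), (4, 5), (2, 4), (3, 4), (2, 3), (0, 2), (1, 2), (0, 1)],
    [(0, 5), (2, 5), (3, 5), (4, 5), (3, 4), (2, 3), (0, 2), (1, 2), (0, 1)],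
    [(0, 5), (4, 5), (0, 4), (3, 4), (0, 3), (1, 3), (2, 3), (1, 2), (0, 1)],
    [(0, 5), (3, 5), (4, 5), (3, 4), (0, 3), (1, 3), (2, 3), (1, 2), (0, 1)],
    [(0, 5), (4, 5), (0, 4), (1, 4), (3, 4), (1, 3), (2, 3), (1, 2), (0, 1)],
    [(0, 5), (4, 5), (0, 4), (1, 4), (2, 4), (3, 4), (2, 3), (1, 2), (0, 1)],
    [(0, 5), (1, 5), (4, 5), (1, 4), (3, 4), (1, 3), (2, 3), (1, 2), (0, 1)],
    [(0, 5), (1, 5), (3, 5), (4, 5), (3, 4), (1, 3), (2, 3), (1, 2), (0, 1)],
    [(0, 5), (1, 5), (4, 5), (1, 4), (2, 4), (3, 4), (2, 3), (1, 2), (0, 1)],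
    [(0, 5), (1, 5), (2, 5), (4, 5), (2, 4), (3, 4), (2, 3), (1, 2), (0, 1)],
    [(0, 5), (1, 5), (2, 5), (3, 5), (4, 5), (3, 4), (2, 3), (1, 2), (0, 1)]]"
    using noncrossing_chords_6_9[OF cyc nc F(2)[unfolded C(2), symmetric]] .
  then have "C \<in> edge_set ` set [
    [(0, 5), (4, 5), (0, 4), (3, 4), (0, 3), (2, 3), (0, 2), (1, 2), (0, 1)],
    [(0, 5), (3, 5), (4, 5), (3, 4), (0, 3), (2, 3), (0, 2), (1, 2), (0, 1)],
    [(0, 5), (4, 5), (0, 4), (2, 4), (3, 4), (2, 3), (0, 2), (1, 2), (0, 1)],
    [(0, 5), (2, 5), (4, 5), (2, 4), (3, 4), (2, 3), (0, 2), (1, 2), (0, 1)],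
    [(0, 5), (2, 5), (3, 5), (4, 5), (3, 4), (2, 3), (0, 2), (1, 2), (0, 1)],
    [(0, 5), (4, 5), (0, 4), (3, 4), (0, 3), (1, 3), (2, 3), (1, 2), (0, 1)],
    [(0, 5), (3, 5), (4, 5), (3, 4), (0, 3), (1, 3), (2, 3), (1, 2), (0, 1)],
    [(0, 5), (4, 5), (0, 4), (1, 4), (3, 4), (1, 3), (2, 3), (1, 2), (0, 1)],
    [(0, 5), (4, 5), (0, 4), (1, 4), (2, 4), (3, 4), (2, 3), (1, 2), (0, 1)],
    [(0, 5), (1, 5), (4, 5), (1, 4), (3, 4), (1, 3), (2, 3), (1, 2), (0, 1)],
    [(0, 5), (1, 5), (3, 5), (4, 5), (3, 4), (1, 3), (2, 3), (1, 2), (0, 1)],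
    [(0, 5), (1, 5), (4, 5), (1, 4), (2, 4), (3, 4), (2, 3), (1, 2), (0, 1)],
    [(0, 5), (1, 5), (2, 5), (4, 5), (2, 4), (3, 4), (2, 3), (1, 2), (0, 1)],
    [(0, 5), (1, 5), (2, 5), (3, 5), (4, 5), (3, 4), (2, 3), (1, 2), (0, 1)]]"
    by (subst F(1)) (rule imageI)
  then obtain M where M: "C = edge_set M" "M \<in> set [
    [(0, 5), (4, 5), (0, 4), (3, 4), (0, 3), (2, 3), (0, 2), (1, 2), (0, 1)],
    [(0, 5), (3, 5), (4, 5), (3, 4), (0, 3), (2, 3), (0, 2), (1, 2), (0, 1)],
    [(0, 5), (4, 5), (0, 4), (2, 4), (3, 4), (2, 3), (0, 2), (1, 2), (0, 1)],
    [(0, 5), (2, 5), (4, 5), (2, 4), (3, 4), (2, 3), (0, 2), (1, 2), (0, 1)],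
    [(0, 5), (2, 5), (3, 5), (4, 5), (3, 4), (2, 3), (0, 2), (1, 2), (0, 1)],
    [(0, 5), (4, 5), (0, 4), (3, 4), (0, 3), (1, 3), (2, 3), (1, 2), (0, 1)],
    [(0, 5), (3, 5), (4, 5), (3, 4), (0, 3), (1, 3), (2, 3), (1, 2), (0, 1)],
    [(0, 5), (4, 5), (0, 4), (1, 4), (3, 4), (1, 3), (2, 3), (1, 2), (0, 1)],
    [(0, 5), (4, 5), (0, 4), (1, 4), (2, 4), (3, 4), (2, 3), (1, 2), (0, 1)],
    [(0, 5), (1, 5), (4, 5), (1, 4), (3, 4), (1, 3), (2, 3), (1, 2), (0, 1)],
    [(0, 5), (1, 5), (3, 5), (4, 5), (3, 4), (1, 3), (2, 3), (1, 2), (0, 1)],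
    [(0, 5), (1, 5), (4, 5), (1, 4), (2, 4), (3, 4), (2, 3), (1, 2), (0, 1)],
    [(0, 5), (1, 5), (2, 5), (4, 5), (2, 4), (3, 4), (2, 3), (1, 2), (0, 1)],
    [(0, 5), (1, 5), (2, 5), (3, 5), (4, 5), (3, 4), (2, 3), (1, 2), (0, 1)]]"
    by (rule imageE)
  have upt: "[0..<6] = [0, 1, 2, 3, 4, 5]"
    by (simp add: upt_rec)
  have hexagon: "cycle_edges [0..<6] = edge_set [(0, 1), (1, 2), (2, 3), (3, 4), (4, 5), (0, 5)]"
    unfolding upt cycle_edges_explicit edge_set_def by (simp add: insert_commute)
  have "M \<in> set [[(0, 5), (3, 5), (4, 5), (3, 4), (0, 3), (2, 3), (0, 2), (1, 2), (0, 1)], [(0, 5), (2, 5), (3, 5), (4, 5), (3, 4), (2, 3), (0, 2), (1, 2), (0, 1)], [(0, 5), (4, 5), (0, 4), (3, 4), (0, 3), (1, 3), (2, 3), (1, 2), (0, 1)], [(0, 5), (4, 5), (0, 4), (1, 4), (3, 4), (1, 3), (2, 3), (1, 2), (0, 1)], [(0, 5), (1, 5), (4, 5), (1, 4), (2, 4), (3, 4), (2, 3), (1, 2), (0, 1)], [(0, 5), (1, 5), (2, 5), (4, 5), (2, 4), (3, 4), (2, 3), (1, 2), (0, 1)]] \<or>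
      M \<in> set [[(0, 5), (4, 5), (0, 4), (3, 4), (0, 3), (2, 3), (0, 2), (1, 2), (0, 1)], [(0, 5), (2, 5), (4, 5), (2, 4), (3, 4), (2, 3), (0, 2), (1, 2), (0, 1)], [(0, 5), (3, 5), (4, 5), (3, 4), (0, 3), (1, 3), (2, 3), (1, 2), (0, 1)], [(0, 5), (4, 5), (0, 4), (1, 4), (2, 4), (3, 4), (2, 3), (1, 2), (0, 1)], [(0, 5), (1, 5), (4, 5), (1, 4), (3, 4), (1, 3), (2, 3), (1, 2), (0, 1)], [(0, 5), (1, 5), (2, 5), (3, 5), (4, 5), (3, 4), (2, 3), (1, 2), (0, 1)]] \<or>
      M = [(0, 5), (4, 5), (0, 4), (2, 4), (3, 4), (2, 3), (0, 2), (1, 2), (0, 1)] \<or>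
      M = [(0, 5), (1, 5), (3, 5), (4, 5), (3, 4), (1, 3), (2, 3), (1, 2), (0, 1)]"
    using M(2) unfolding list.set by (elim insertE emptyE) simp_all
  then show ?thesis
  proof (elim disjE)
    assume *: "M \<in> set [[(0, 5), (3, 5), (4, 5), (3, 4), (0, 3), (2, 3), (0, 2), (1, 2), (0, 1)], [(0, 5), (2, 5), (3, 5), (4, 5), (3, 4), (2, 3), (0, 2), (1, 2), (0, 1)], [(0, 5), (4, 5), (0, 4), (3, 4), (0, 3), (1, 3), (2, 3), (1, 2), (0, 1)], [(0, 5), (4, 5), (0, 4), (1, 4), (3, 4), (1, 3), (2, 3), (1, 2), (0, 1)], [(0, 5), (1, 5), (4, 5), (1, 4), (2, 4), (3, 4), (2, 3), (1, 2), (0, 1)], [(0, 5), (1, 5), (2, 5), (4, 5), (2, 4), (3, 4), (2, 3), (1, 2), (0, 1)]]"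
    have "isomorphic Theta3 (Graph {..<6} C)"
      unfolding M(1) using * by (rule Theta3_relabelled)
    then show ?thesis
      by (simp only: simp_thms)
  next
    assume *: "M \<in> set [[(0, 5), (4, 5), (0, 4), (3, 4), (0, 3), (2, 3), (0, 2), (1, 2), (0, 1)], [(0, 5), (2, 5), (4, 5), (2, 4), (3, 4), (2, 3), (0, 2), (1, 2), (0, 1)], [(0, 5), (3, 5), (4, 5), (3, 4), (0, 3), (1, 3), (2, 3), (1, 2), (0, 1)], [(0, 5), (4, 5), (0, 4), (1, 4), (2, 4), (3, 4), (2, 3), (1, 2), (0, 1)], [(0, 5), (1, 5), (4, 5), (1, 4), (3, 4), (1, 3), (2, 3), (1, 2), (0, 1)], [(0, 5), (1, 5), (2, 5), (3, 5), (4, 5), (3, 4), (2, 3), (1, 2), (0, 1)]]"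
    have "isomorphic Theta4 (Graph {..<6} C)"
      unfolding M(1) using * by (rule Theta4_relabelled)
    then show ?thesis
      by (simp only: simp_thms)
  next
    assume *: "M = [(0, 5), (4, 5), (0, 4), (2, 4), (3, 4), (2, 3), (0, 2), (1, 2), (0, 1)]"
    have "C - cycle_edges [0..<6] = {{0, 2}, {0, 4}, {2, 4}}"
      unfolding M(1) * hexagon by (subst edge_set_diff) (auto simp: edge_set_def)
    then show ?thesis
      by (simp only: insert_iff simp_thms)
  next
    assume *: "M = [(0, 5), (1, 5), (3, 5), (4, 5), (3, 4), (1, 3), (2, 3), (1, 2), (0, 1)]"
    have "C - cycle_edges [0..<6] = {{1, 3}, {1, 5}, {3, 5}}"
      unfolding M(1) * hexagon by (subst edge_set_diff) (auto simp: edge_set_def)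
    then show ?thesis
      by (simp only: insert_iff simp_thms)
  qed
qed

section \<open>Exclusion of all other graphs\<close>

text \<open>The sides of an inscribed triangle go round the cycle once: two of them are bounded by
  the direct gap, the longest by the gap across the end.\<close>

lemma sum_cyclic_length_triangle:
  assumes s: "sorted_wrt (<) s" "set s \<subseteq> {..<n}" and abc: "a < b" "b < c" "c < length s"
  shows "(\<Sum>e\<in>{{a, b}, {a, c}, {b, c}}. cyclic_length n T ((!) s ` e)) \<le> n"
proof -
  have lt: "s ! a < s ! b" "s ! b < s ! c" "s ! c < n"
    using sorted_wrt_nth_less[OF s(1)] abc subsetD[OF s(2) nth_mem[OF abc(3)]] by auto
  have "{a, b} \<noteq> {a, c}" "{a, b} \<noteq> {b, c}" "{a, c} \<noteq> {b, c}"
    using abc by (auto simp: doubleton_eq_iff)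
  then have "(\<Sum>e\<in>{{a, b}, {a, c}, {b, c}}. cyclic_length n T ((!) s ` e)) =
      cyclic_length n T {s ! a, s ! b} + (cyclic_length n T {s ! a, s ! c} + cyclic_length n T {s ! b, s ! c})"
    by simp
  also have "\<dots> \<le> (s ! b - s ! a) + ((n - (s ! c - s ! a)) + (s ! c - s ! b))"
    using lt by (intro add_mono) (simp_all add: cyclic_length_pair)
  also have "\<dots> = n"
    using lt by simp
  finally show ?thesis .
qed

lemma num_edges_hamiltonian:
  assumes "simple_graph G" "hamiltonian G"
  shows "3 \<le> num_edges G"
proof -
  obtain xs where xs: "distinct xs" "length xs \<ge> 3" "cycle_edges xs \<subseteq> edges G"
    using assms(2) unfolding hamiltonian_def by blast
  have "finite (edges G)"
    using assms(1) finite_imp_finite_nsets finite_subset unfolding simple_graph_def by blast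
  then have "card (cycle_edges xs) \<le> num_edges G"
    unfolding num_edges_def using xs(3) by (rule card_mono)
  then show ?thesis
    using card_cycle_edges[OF xs(1,2)] xs(2) by simp
qed

lemma outer_plane_card:
  assumes "outer_plane k C" "3 \<le> k"
  shows "card C + 3 \<le> 2 * k" "card (C - cycle_edges [0..<k]) + k = card C"
proof -
  have C: "C \<subseteq> nsets {..<k} 2" "noncrossing C" "cycle_edges [0..<k] \<subseteq> C"
    using assms(1) by (auto simp: outer_plane_def)
  have "{..<k} = {0..k - 1}" using assms(2) by auto
  then have "card C + 1 \<le> 2 * (k - 1 - 0)"
    using C(1,2) assms(2) by (intro card_noncrossing_le) auto
  then show "card C + 3 \<le> 2 * k" using assms(2) by simp
  have fin: "finite C"
    using C(1) finite_imp_finite_nsets finite_subset by blast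
  have k: "card (cycle_edges [0..<k]) = k"
    using card_cycle_edges[of "[0..<k]"] assms(2) by simp
  have "card (C - cycle_edges [0..<k]) = card C - card (cycle_edges [0..<k])"
    using C(3) fin finite_subset by (intro card_Diff_subset) blast+
  moreover have "card (cycle_edges [0..<k]) \<le> card C"
    using C(3) fin by (intro card_mono)
  ultimately show "card (C - cycle_edges [0..<k]) + k = card C"
    using k by simp
qed

lemma geometric_packable_cases:
  assumes G: "simple_graph G" "planar G" "hamiltonian G" and pack: "geometric_packable (plane_drawings G)"
  shows "isomorphic (cycle_graph 3) G \<or> isomorphic (cycle_graph 4) G \<or> isomorphic Theta1 G \<or>
    isomorphic Theta2 G \<or> isomorphic Theta3 G \<or> isomorphic Theta4 G"
proof (rule ccontr)
  assume neg: "\<not> ?thesis"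
  define e k where "e = num_edges G" and "k = num_verts G"
  have e3: "3 \<le> e" using num_edges_hamiltonian[OF G(1,3)] by (simp add: e_def)
  have ge: "0 < num_edges G" using e3 by (simp add: e_def)
  have copy: "\<exists>s C. sorted_wrt (<) s \<and> set s \<subseteq> {..<n} \<and> length s = k \<and> 3 \<le> k \<and> outer_plane k C \<and>
      card C = e \<and> isomorphic G (Graph {..<k} C) \<and>
      F = graph_image (\<lambda>r. parabola (s ! r)) (Graph {..<k} C)"
    if F: "F \<in> plane_drawings G" "verts F \<subseteq> parabola ` {..<n}" for F n
  proof -
    obtain s C where s: "sorted_wrt (<) s" "set s \<subseteq> {..<n}" "length s = num_verts G" "length s \<ge> 3"
      "F = graph_image (\<lambda>r. parabola (s ! r)) (Graph {..<length s} C)"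
      "outer_plane (length s) C" "isomorphic G (Graph {..<length s} C)"
      using plane_drawing_on_parabola[OF G(1,3) F] .
    have "card C = e"
      using num_edges_isomorphic[OF G(1) s(7)] by (simp add: num_edges_def e_def)
    then show ?thesis
      using s unfolding k_def by (intro exI[of _ s] exI[of _ C]) simp
  qed
  \<comment> \<open>If no drawing of \<open>G\<close> fitted on the parabola, the length bound would
    hold vacuously with constant 0, although a quarter of the edge number is positive.\<close>
  have "\<exists>N F. F \<in> plane_drawings G \<and> verts F \<subseteq> parabola ` {..<2 * N}"
  proof (rule ccontr)
    assume "\<not> ?thesis"
    then have "real (num_edges G) * (real 1 / real 2 * (1 - real 1 / real 2)) \<le> 0"
      by (intro packable_length_bound[OF G(1,2) pack ge]) auto
    then show False using ge by simp
  qed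
  then obtain F0 N0 where F0: "F0 \<in> plane_drawings G" "verts F0 \<subseteq> parabola ` {..<2 * N0}"
    by blast
  from copy[OF this] obtain C where k3: "3 \<le> k" and C: "outer_plane k C" "card C = e" "isomorphic G (Graph {..<k} C)"
    by blast
  have k_e: "k \<le> e" "e + 3 \<le> 2 * k"
    using outer_plane_card[OF C(1) k3] C(2) by simp_all
  have ke4: "k * k \<le> 4 * e"
  proof -
    \<comment> \<open>The polygon weighs at most \<open>n\<close>, and each of the e - k chords at
      most T = k n / 2e.\<close>
    define B where "B = 1 + (real e - real k) * real k / (2 * real e)"
    have "real (num_edges G) * (real k / real (2 * e) * (1 - real k / real (2 * e))) \<le> B"
    proof (rule packable_length_bound[OF G(1,2) pack ge])
      show "0 < 2 * e" "2 * k \<le> 2 * e" using e3 k_e by simp_all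
      show "0 \<le> B" using k_e by (simp add: B_def)
      fix N F assume N: "N \<ge> 1" and F: "F \<in> plane_drawings G" "verts F \<subseteq> parabola ` {..<2 * e * N}"
      define n T where "n = 2 * e * N" and "T = k * N"
      obtain s C' where s: "sorted_wrt (<) s" "set s \<subseteq> {..<n}" "length s = k" and C': "outer_plane k C'"
        "card C' = e" "F = graph_image (\<lambda>r. parabola (s ! r)) (Graph {..<k} C')"
        using copy[OF F] unfolding n_def by blast
      have "(\<Sum>d\<in>edges F. point_length n T d)
          \<le> n + (\<Sum>c\<in>C' - cycle_edges [0..<k]. cyclic_length n T ((!) s ` c))"
        by (rule sum_point_length_drawing[OF s k3 C'(1,3)])
      also have "\<dots> \<le> n + (\<Sum>c\<in>C' - cycle_edges [0..<k]. T)"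
        by (intro add_left_mono sum_mono) (simp add: cyclic_length_def)
      also have "\<dots> = n + card (C' - cycle_edges [0..<k]) * T"
        by simp
      also have "card (C' - cycle_edges [0..<k]) = e - k"
        using outer_plane_card(2)[OF C'(1) k3] C'(2) by arith
      finally have "real (\<Sum>d\<in>edges F. point_length n T d) \<le> real (n + (e - k) * T)"
        by (rule of_nat_mono)
      also have "\<dots> = real n + (real e - real k) * real T"
        using k_e by (simp add: of_nat_diff)
      also have "\<dots> = B * real n"
        using e3 by (simp add: B_def n_def T_def field_simps)
      finally show "real (\<Sum>d\<in>edges F. point_length (2 * e * N) (k * N) d) \<le> B * real (2 * e * N)"
        by (simp only: n_def T_def)
    qed
    then have "real k * real k \<le> 4 * real e"
      using e3 by (simp add: B_def e_def[symmetric] field_simps)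
    then have "real (k * k) \<le> real (4 * e)" by simp
    then show ?thesis by (rule of_nat_le_iff[THEN iffD1])
  qed
  have iso: "isomorphic H G" if "isomorphic H (Graph {..<m} C)" "k = m" for H :: "nat graph" and m
    using isomorphic_trans[OF that(1)] isomorphic_sym[OF G(1) C(3)] that(2) by simp
  \<comment> \<open>The two inequalities give k^2 \<le> 8 k - 12, that is (k - 2) (k - 6) \<le>
    0.\<close>
  have "k \<le> 6"
  proof (rule ccontr)
    assume "\<not> k \<le> 6"
    then obtain j where "k = 7 + j"
      using le_Suc_ex[of 7 k] by auto
    then show False using ke4 k_e(2) by (simp add: algebra_simps)
  qed
  then have "k = 3 \<or> k = 4 \<or> k = 5 \<or> k = 6" using k3 by auto
  then have "k = 3 \<and> e = 3 \<or> k = 4 \<and> e = 4 \<or> k = 4 \<and> e = 5 \<or> k = 5 \<and> e = 7 \<or> k = 6 \<and> e = 9"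
  proof (elim disjE)
    assume k: "k = 3"
    have "9 \<le> 4 * e" "e + 3 \<le> 6" using ke4 k_e(2) by (simp_all add: k)
    then show ?thesis using k_e(1) k by linarith
  next
    assume k: "k = 4"
    have "16 \<le> 4 * e" "e + 3 \<le> 8" using ke4 k_e(2) by (simp_all add: k)
    then show ?thesis using k_e(1) k by linarith
  next
    assume k: "k = 5"
    have "25 \<le> 4 * e" "e + 3 \<le> 10" using ke4 k_e(2) by (simp_all add: k)
    then show ?thesis using k_e(1) k by linarith
  next
    assume k: "k = 6"
    have "36 \<le> 4 * e" "e + 3 \<le> 12" using ke4 k_e(2) by (simp_all add: k)
    then show ?thesis using k_e(1) k by linarith
  qed
  then consider "k = 3" "e = 3" | "k = 4" "e = 4" | "k = 4" "e = 5" | "k = 5" "e = 7" | "k = 6" "e = 9"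
    by blast
  then show False
  proof cases
    case 5
    \<comment> \<open>Since \<open>G\<close> is neither \<open>Theta3\<close> nor
      \<open>Theta4\<close>, every drawing of it on the parabola is a hexagon with an inscribed
      triangle.\<close>
    have tri: "C' - cycle_edges [0..<6] \<in> {{{0, 2}, {0, 4}, {2, 4}}, {{1, 3}, {1, 5}, {3, 5}}}"
      if "outer_plane k C'" "card C' = e" "isomorphic G (Graph {..<k} C')" for C'
    proof -
      have "isomorphic (Graph {..<6} C') G"
        using isomorphic_sym[OF G(1) that(3)] 5 by simp
      then show ?thesis
        using outer_plane_6_9[of C'] that(1,2) neg isomorphic_trans[of _ _ G] unfolding 5 by metis
    qed
    \<comment> \<open>At t = 1 / 2 the cutoff has no effect. Hexagon and triangle weigh at most
      \<open>n\<close> each, so the constant is 2, less than the 9 / 4 obtained from nine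
      edges.\<close>
    have "real (num_edges G) * (real 1 / real 2 * (1 - real 1 / real 2)) \<le> 2"
    proof (rule packable_length_bound[OF G(1,2) pack ge])
      fix N F assume N: "N \<ge> (1::nat)" and F: "F \<in> plane_drawings G" "verts F \<subseteq> parabola ` {..<2 * N}"
      define n T where "n = 2 * N" and "T = 1 * N"
      obtain s C' where s: "sorted_wrt (<) s" "set s \<subseteq> {..<n}" "length s = k" and C': "outer_plane k C'"
        "F = graph_image (\<lambda>r. parabola (s ! r)) (Graph {..<k} C')"
        "card C' = e" "isomorphic G (Graph {..<k} C')"
        using copy[OF F] by (fold n_def) (elim exE conjE, rule that)
      have t: "C' - cycle_edges [0..<k] \<in> {{{0, 2}, {0, 4}, {2, 4}}, {{1, 3}, {1, 5}, {3, 5}}}"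
        using tri[OF C'(1,3,4)] unfolding 5(1) .
      have "(\<Sum>d\<in>edges F. point_length n T d)
          \<le> n + (\<Sum>c\<in>C' - cycle_edges [0..<k]. cyclic_length n T ((!) s ` c))"
        by (rule sum_point_length_drawing[OF s k3 C'(1,2)])
      also have "(\<Sum>c\<in>C' - cycle_edges [0..<k]. cyclic_length n T ((!) s ` c)) \<le> n"
        using t
      proof (elim insertE emptyE)
        assume *: "C' - cycle_edges [0..<k] = {{0, 2}, {0, 4}, {2, 4}}"
        show ?thesis
          unfolding * by (rule sum_cyclic_length_triangle[OF s(1,2)]) (simp_all add: s(3) 5)
      next
        assume *: "C' - cycle_edges [0..<k] = {{1, 3}, {1, 5}, {3, 5}}"
        show ?thesis
          unfolding * by (rule sum_cyclic_length_triangle[OF s(1,2)]) (simp_all add: s(3) 5)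
      qed
      finally have "real (\<Sum>d\<in>edges F. point_length n T d) \<le> real (n + n)"
        by (rule of_nat_mono) simp
      then show "real (\<Sum>d\<in>edges F. point_length (2 * N) (1 * N) d) \<le> 2 * real (2 * N)"
        by (simp add: n_def T_def)
    qed auto
    then show False
      using 5 by (simp add: e_def)
  next
    case 1
    have "outer_plane 3 C" "card C = 3" using C 1 by simp_all
    then have "isomorphic (cycle_graph 3) G" using iso[OF outer_plane_3_3] 1(1) by simp
    then show False using neg by simp
  next
    case 2
    have "outer_plane 4 C" "card C = 4" using C 2 by simp_all
    then have "isomorphic (cycle_graph 4) G" using iso[OF outer_plane_4_4] 2(1) by simp
    then show False using neg by simp
  next
    case 3
    have "outer_plane 4 C" "card C = 5" using C 3 by simp_all
    then have "isomorphic Theta1 G" using iso[OF outer_plane_4_5] 3(1) by simp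
    then show False using neg by simp
  next
    case 4
    have "outer_plane 5 C" "card C = 7" using C 4 by simp_all
    then have "isomorphic Theta2 G" using iso[OF outer_plane_5_7] 4(1) by simp
    then show False using neg by simp
  qed
qed

theorem theorem1:
  fixes G :: "'a graph"
  assumes "simple_graph G"
    and "planar G"
    and "hamiltonian G"
  shows "(\<not> (isomorphic (cycle_graph 3) G \<or> isomorphic (cycle_graph 4) G \<or>
              isomorphic Theta1 G \<or> isomorphic Theta2 G \<or>
              isomorphic Theta3 G \<or> isomorphic Theta4 G)
            \<longrightarrow> \<not> geometric_packable (plane_drawings G)) \<and>
         (isomorphic (cycle_graph 3) G \<or> isomorphic (cycle_graph 4) G \<or> isomorphic Theta1 G
            \<longrightarrow> geometric_packable (plane_drawings G))"
proof (intro conjI impI)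
  show "\<not> geometric_packable (plane_drawings G)"
    if "\<not> (isomorphic (cycle_graph 3) G \<or> isomorphic (cycle_graph 4) G \<or> isomorphic Theta1 G \<or>
      isomorphic Theta2 G \<or> isomorphic Theta3 G \<or> isomorphic Theta4 G)"
    using geometric_packable_cases[OF assms] that by blast
  have simple: "simple_graph (cycle_graph 3)" "simple_graph (cycle_graph 4)" "simple_graph Theta1"
    by (auto simp: cycle_graph_3 cycle_graph_4 Theta1_eq simple_graph_def nsets_def)
  have edges: "num_edges (cycle_graph 3) = 3" "num_edges (cycle_graph 4) = 4" "num_edges Theta1 = 5"
    by (simp_all add: num_edges_def cycle_graph_3 cycle_graph_4 Theta1_eq doubleton_eq_iff)
  assume "isomorphic (cycle_graph 3) G \<or> isomorphic (cycle_graph 4) G \<or> isomorphic Theta1 G"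
  then show "geometric_packable (plane_drawings G)"
  proof (elim disjE)
    assume iso: "isomorphic (cycle_graph 3) G"
    then have "num_edges G = 3" using num_edges_isomorphic[OF simple(1)] edges by simp
    then show ?thesis
      using tileable_triangles[OF assms(1) iso]
      by (intro tileable_imp_geometric_packable[OF assms(1,2), of 3]) auto
  next
    assume iso: "isomorphic (cycle_graph 4) G"
    then have "num_edges G = 4" using num_edges_isomorphic[OF simple(2)] edges by simp
    then show ?thesis
      using tileable_four_cycles[OF assms(1) iso]
      by (intro tileable_imp_geometric_packable[OF assms(1,2), of 4]) auto
  next
    assume iso: "isomorphic Theta1 G"
    then have "num_edges G = 5" using num_edges_isomorphic[OF simple(3)] edges by simp
    then show ?thesis
      using tileable_Theta1[OF assms(1) iso]
      by (intro tileable_imp_geometric_packable[OF assms(1,2), of 5]) auto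
  qed
qed

end
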